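(* Let $g$ be a rational function on the Riemann sphere of degree at least two. For a critical value $c$ of $g$ let $P(c)=\overline{\bigcup_{n\ge0}g^n(c)}$. Assume that $c_0$ is a critical value of $g$ which is not in the basin of an attracting cycle, and such that $P(c_0)$ is disjoint from the union $X$ of the sets $P(c)$ over all critical values $c\ne c_0$ of $g$. Then $$\chi_-(g,c_0)=\liminf_{n\to\infty}\frac1n\log\|Dg^n(c_0)\|\ge0,$$ where $\|\cdot\|$ denotes the norm of the derivative with respect to the spherical metric. *)

theory Defs
  imports Complex_Main "HOL-Computational_Algebra.Polynomial" "HOL-Computational_Algebra.Polynomial_Factorial" "HOL-Library.Extended_Real" "HOL-Library.Liminf_Limsup"
begin

text \<open>The Riemann sphere: Some z is the finite point z, None is the point at infinity.\<close>
type_synonym sphere = "complex option"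

text \<open>Chordal metric on the Riemann sphere (locally equivalent to the spherical metric,
  ratio tending to 1, so it yields the same derivative norms).\<close>
fun chordal :: "sphere \<Rightarrow> sphere \<Rightarrow> real" where
  "chordal (Some z) (Some w) = 2 * cmod (z - w) / sqrt ((1 + (cmod z)\<^sup>2) * (1 + (cmod w)\<^sup>2))"
| "chordal (Some z) None = 2 / sqrt (1 + (cmod z)\<^sup>2)"
| "chordal None (Some w) = 2 / sqrt (1 + (cmod w)\<^sup>2)"
| "chordal None None = 0"

text \<open>The rational map p/q on the sphere (p, q coprime, q nonzero).\<close>
definition rat_map :: "complex poly \<Rightarrow> complex poly \<Rightarrow> sphere \<Rightarrow> sphere" where
  "rat_map p q x = (case x of
      Some z \<Rightarrow> (if poly q z \<noteq> 0 then Some (poly p z / poly q z) else None)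
    | None \<Rightarrow> (if degree p > degree q then None
               else if degree p = degree q then Some (lead_coeff p / lead_coeff q)
               else Some 0))"

definition rat_degree :: "complex poly \<Rightarrow> complex poly \<Rightarrow> nat" where
  "rat_degree p q = max (degree p) (degree q)"

definition has_sph_deriv_norm :: "(sphere \<Rightarrow> sphere) \<Rightarrow> sphere \<Rightarrow> real \<Rightarrow> bool" where
  "has_sph_deriv_norm f z L \<longleftrightarrow>
     (\<forall>e>0. \<exists>d>0. \<forall>w. w \<noteq> z \<and> chordal w z < d \<longrightarrow>
        \<bar>chordal (f w) (f z) / chordal w z - L\<bar> < e)"

definition sph_deriv_norm :: "(sphere \<Rightarrow> sphere) \<Rightarrow> sphere \<Rightarrow> real" where
  "sph_deriv_norm f z = (THE L. has_sph_deriv_norm f z L)"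

definition critical_point :: "(sphere \<Rightarrow> sphere) \<Rightarrow> sphere \<Rightarrow> bool" where
  "critical_point g z \<longleftrightarrow> sph_deriv_norm g z = 0"

definition critical_value :: "(sphere \<Rightarrow> sphere) \<Rightarrow> sphere \<Rightarrow> bool" where
  "critical_value g c \<longleftrightarrow> (\<exists>z. critical_point g z \<and> g z = c)"

definition sph_closure :: "sphere set \<Rightarrow> sphere set" where
  "sph_closure S = {x. \<forall>e>0. \<exists>y\<in>S. chordal x y < e}"

definition postorbit :: "(sphere \<Rightarrow> sphere) \<Rightarrow> sphere \<Rightarrow> sphere set" where
  "postorbit g c = sph_closure {(g ^^ n) c | n. True}"

definition attracting_periodic :: "(sphere \<Rightarrow> sphere) \<Rightarrow> sphere \<Rightarrow> nat \<Rightarrow> bool" where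
  "attracting_periodic g z k \<longleftrightarrow> k \<ge> 1 \<and> (g ^^ k) z = z \<and> sph_deriv_norm (g ^^ k) z < 1"

definition in_attracting_basin :: "(sphere \<Rightarrow> sphere) \<Rightarrow> sphere \<Rightarrow> bool" where
  "in_attracting_basin g w \<longleftrightarrow>
     (\<exists>z k. attracting_periodic g z k \<and> (\<lambda>n. chordal ((g ^^ (n * k)) w) z) \<longlonglongrightarrow> 0)"

end

theory Submission
  imports Defs "HOL-Complex_Analysis.Complex_Analysis"
    "HOL-Computational_Algebra.Fundamental_Theorem_Algebra"
    "HOL-Computational_Algebra.Field_as_Ring"
begin

text \<open>
  There is a second critical value; after a rotation of the sphere it is infinity, so that the orbit of
  \<open>c = c0\<close> has compact closure in the plane. Let \<open>x i\<close> be the \<open>i\<close>-th point of this orbit and fix a small rate.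

  Suppose that \<open>x b\<close> is close to \<open>c\<close>, at distance \<open>t\<close>, and let \<open>a < b\<close> be the last time at which the distance
  was at most \<open>t\<close>. Pull a disc around \<open>x (b - 1)\<close>, whose image lies in the disc of radius \<open>C t\<close> about \<open>c\<close>,
  back along the orbit to time \<open>a\<close>. The orbits of the other critical values stay away, so the only
  obstruction is that a pullback contains \<open>c\<close>; this happens only after \<open>i\<close> steps for which \<open>x i\<close> is within
  \<open>C t\<close> of \<open>c\<close>, and such times are sparse as \<open>c\<close> is not periodic. At such a time the disc is shrunk by a
  fixed factor, which suffices: otherwise, by Schottky's theorem, either \<open>x (b - i)\<close> would be within \<open>t\<close> of
  \<open>c\<close>, or the pullback would cover a large disc around \<open>c\<close>, which an iterate would then contract into
  itself, so that \<open>c\<close> would be attracted to a cycle. The same distortion estimate bounds the derivative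
  from \<open>x a\<close> to \<open>x b\<close> from below by a quantity that is subexponential in \<open>b - a\<close>. Going back from return to
  return handles all times at which the orbit is close to \<open>c\<close>.

  On an orbit segment that stays away from \<open>c\<close> the derivative of the map is bounded below. Exponential
  contraction along long segments of this kind would produce balls of a fixed radius that are contracted for
  arbitrarily long times, and by compactness again an attracting cycle.
\<close>

section \<open>Distortion and lifting\<close>

text \<open>The order of choices makes the estimate at close returns useful. A shrinking of the disc
  costs a factor that depends only on the map and the orbit, so the spacing \<open>N\<close> of the
  shrinkings can be chosen afterwards, in terms of this factor and the rate; only the closeness
  \<open>\<delta>\<close> depends on \<open>N\<close>. The pullback starts at
  \<open>x (b - 1)\<close> because the last step cannot be inverted with control: a disc of radius
  just above \<open>t\<close> about \<open>x b\<close> contains the critical value \<open>c\<close>.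
  The local degree of the map describes that step instead and compares \<open>t\<close> with the
  radius times the derivative, and \<open>t\<close> cancels from the final bound. An inverse branch
  is injective, so it takes the value \<open>c\<close> at most once, and then one omitted value
  within a multiple of \<open>t\<close> of \<open>c\<close> bounds its derivative by a multiple of
  \<open>t\<close> over the radius. Such a value exists, as a branch that covers the disc of radius
  \<open>8 * (C * t)\<close> would yield an iterate mapping this disc into one of radius
  \<open>C * t\<close>. If \<open>c\<close> is periodic, there is no such spacing; the claim then
  reduces to the multiplier of the cycle, which has modulus at least 1 as the cycle is not
  attracting.\<close>

lemma deriv_bound_of_omitted_value:
  obtains C :: real where "C > 0"
    and "\<And>\<phi> x r y w z. \<lbrakk>0 < r; \<phi> holomorphic_on ball x r; y \<in> ball x (r/4); z \<in> ball x (r/4);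
            \<And>u. u \<in> ball x r \<Longrightarrow> \<phi> u = \<phi> y \<Longrightarrow> u = y; w \<notin> \<phi> ` ball x r\<rbrakk>
          \<Longrightarrow> cmod (deriv \<phi> z) \<le> C * cmod (w - \<phi> y) / r"
proof -
  \<comment> \<open>The bound of Schottky's theorem for a function that omits 0 and 1 and has
    modulus at most 1 at the origin, at points of modulus at most \<open>9/10\<close>.\<close>
  define M where "M = exp (pi * exp (pi * (2 + 2 * 1 + 12 * (9/10) / (1 - 9/10 :: real))))"
  have M: "M > 0" by (simp add: M_def)
  show ?thesis
  proof (rule that[of "8 * (1 + M\<^sup>2)"])
    show "8 * (1 + M\<^sup>2) > 0" by (simp add: add_pos_nonneg)
  next
    fix \<phi> :: "complex \<Rightarrow> complex" and x y w z :: complex and r :: real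
    assume r: "0 < r" and hol: "\<phi> holomorphic_on ball x r" and y: "y \<in> ball x (r/4)"
      and z: "z \<in> ball x (r/4)" and inj: "\<And>u. u \<in> ball x r \<Longrightarrow> \<phi> u = \<phi> y \<Longrightarrow> u = y"
      and w: "w \<notin> \<phi> ` ball x r"
    have yb: "y \<in> ball x r" using y r by auto
    have w0: "w - \<phi> y \<noteq> 0" using w yb by auto
    define u where "u = (\<lambda>\<zeta>. (\<phi> \<zeta> - \<phi> y) / (w - \<phi> y))"
    \<comment> \<open>\<open>1 - u\<close> has a holomorphic square root \<open>s\<close> with value 1 at \<open>y\<close>, and \<open>s\<close> omits 0 and -1: it takes
      the values \<open>\<plusminus>1\<close> only where \<open>u\<close> vanishes, that is, at \<open>y\<close>.\<close>
    have holu: "(\<lambda>\<zeta>. 1 - u \<zeta>) holomorphic_on ball x r"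
      unfolding u_def using w0 by (intro holomorphic_intros hol) auto
    have "\<And>\<zeta>. \<zeta> \<in> ball x r \<Longrightarrow> 1 - u \<zeta> \<noteq> 0"
      using w w0 by (auto simp: u_def field_simps)
    then obtain s0 where s0: "s0 holomorphic_on ball x r" "\<And>\<zeta>. \<zeta> \<in> ball x r \<Longrightarrow> 1 - u \<zeta> = s0 \<zeta> ^ 2"
      using contractible_imp_holomorphic_sqrt[OF holu convex_imp_contractible[OF convex_ball]] by metis
    have "s0 y ^ 2 = 1" using s0(2)[OF yb] by (simp add: u_def)
    then have s0y: "s0 y = 1 \<or> s0 y = -1" by (simp add: power2_eq_1_iff)
    define s where "s = (\<lambda>\<zeta>. s0 \<zeta> * s0 y)"
    have s: "s holomorphic_on ball x r" unfolding s_def by (intro holomorphic_intros s0)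
    have s2: "1 - u \<zeta> = s \<zeta> ^ 2" if "\<zeta> \<in> ball x r" for \<zeta>
      using s0(2)[OF that] \<open>s0 y ^ 2 = 1\<close> by (simp add: s_def power_mult_distrib)
    have sy: "s y = 1" using s0y by (auto simp: s_def)
    have s_omit: "s \<zeta> \<noteq> 0 \<and> s \<zeta> \<noteq> -1" if "\<zeta> \<in> ball x r" for \<zeta>
    proof
      show "s \<zeta> \<noteq> 0" using s2[OF that] \<open>\<And>\<zeta>. \<zeta> \<in> ball x r \<Longrightarrow> 1 - u \<zeta> \<noteq> 0\<close>[OF that] by auto
      show "s \<zeta> \<noteq> -1"
      proof
        assume "s \<zeta> = -1"
        then have "u \<zeta> = 0" using s2[OF that] by auto
        then have "\<phi> \<zeta> = \<phi> y" using w0 by (simp add: u_def)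
        then show False using inj[OF that] \<open>s \<zeta> = -1\<close> sy by auto
      qed
    qed
    \<comment> \<open>The radius \<open>7/10 * r\<close> fits, as \<open>y\<close> is within
      \<open>r/4\<close> of the centre. Points within \<open>r/8\<close> of \<open>z\<close> are
      within \<open>5/8 * r\<close> of \<open>y\<close>, so their parameters have modulus at most
      \<open>25/28 < 9/10\<close>; the Cauchy estimate below uses the circle of radius
      \<open>r/8\<close>.\<close>
    define f where "f = (\<lambda>\<zeta>. - s (y + of_real (7/10 * r) * \<zeta>))"
    have sub: "y + of_real (7/10 * r) * \<zeta> \<in> ball x r" if "\<zeta> \<in> cball 0 1" for \<zeta>
    proof -
      have "cmod (y - x + of_real (7/10*r) * \<zeta>) \<le> cmod (y - x) + 7/10 * r * cmod \<zeta>"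
        using norm_triangle_ineq[of "y - x" "of_real (7/10*r) * \<zeta>"] r by (simp add: norm_mult)
      also have "\<dots> < r/4 + 7/10 * r"
      proof -
        have "7/10 * r * cmod \<zeta> \<le> 7/10 * r" using that r by (simp add: mult_left_le)
        moreover have "cmod (y - x) < r/4" using y by (simp add: dist_norm norm_minus_commute)
        ultimately show ?thesis by linarith
      qed
      finally show ?thesis using r by (simp add: dist_norm norm_minus_commute algebra_simps)
    qed
    have holf: "f holomorphic_on cball 0 1"
    proof -
      have "(s \<circ> (\<lambda>\<zeta>. y + of_real (7/10 * r) * \<zeta>)) holomorphic_on cball 0 1"
        by (intro holomorphic_on_compose_gen[OF _ s] holomorphic_intros) (use sub in auto)
      then show ?thesis unfolding f_def o_def by (intro holomorphic_intros)
    qed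
    have bound: "cmod (s p) \<le> M" if p: "p \<in> cball z (r/8)" for p
    proof -
      define \<zeta> where "\<zeta> = (p - y) / of_real (7/10 * r)"
      have "cmod (p - y) \<le> 5/8 * r"
      proof -
        have "dist p y \<le> dist p z + dist z x + dist x y"
          using dist_triangle[of p y z] dist_triangle[of z y x] by linarith
        then show ?thesis using p y z by (auto simp: dist_norm norm_minus_commute)
      qed
      then have "cmod \<zeta> \<le> 9/10"
      proof -
        have "cmod \<zeta> = cmod (p - y) / (7/10 * r)"
          unfolding \<zeta>_def norm_divide norm_of_real using r by simp
        then have "cmod \<zeta> \<le> (5/8 * r) / (7/10 * r)"
          using \<open>cmod (p - y) \<le> 5/8 * r\<close> r by (simp only: divide_right_mono)
        also have "\<dots> \<le> 9/10" using r by simp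
        finally show ?thesis .
      qed
      then have "cmod (f \<zeta>) \<le> M"
        unfolding M_def
      proof (rule Schottky[OF holf, rotated 4])
        show "cmod (f 0) \<le> 1" by (simp add: f_def sy)
        fix \<zeta> :: complex assume "\<zeta> \<in> cball 0 1"
        from s_omit[OF sub[OF this]] show "\<not> (f \<zeta> = 0 \<or> f \<zeta> = 1)"
          by (auto simp: f_def minus_equation_iff[of _ 1])
      qed auto
      moreover have "f \<zeta> = - s p"
      proof -
        have "y + of_real (7/10 * r) * \<zeta> = p" unfolding \<zeta>_def using r by (simp del: of_real_mult of_real_divide)
        then show ?thesis by (simp only: f_def)
      qed
      ultimately show ?thesis by simp
    qed
    have cb: "cball z (r/8) \<subseteq> ball x r"
    proof
      fix p assume "p \<in> cball z (r/8)"
      then show "p \<in> ball x r" using z r dist_triangle[of x p z] by (auto simp: dist_commute)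
    qed
    have "cmod ((deriv ^^ 1) (\<lambda>\<zeta>. \<phi> \<zeta> - \<phi> y) z) \<le> fact 1 * (cmod (w - \<phi> y) * (1 + M\<^sup>2)) / (r/8) ^ 1"
    proof (rule Cauchy_inequality)
      show "(\<lambda>\<zeta>. \<phi> \<zeta> - \<phi> y) holomorphic_on ball z (r/8)"
        using cb ball_subset_cball by (intro holomorphic_intros holomorphic_on_subset[OF hol]) blast
      show "continuous_on (cball z (r/8)) (\<lambda>\<zeta>. \<phi> \<zeta> - \<phi> y)"
        by (intro holomorphic_on_imp_continuous_on holomorphic_intros holomorphic_on_subset[OF hol] cb)
      show "0 < r / 8" using r by simp
      fix p assume "cmod (z - p) = r / 8"
      then have p: "p \<in> cball z (r/8)" by (simp add: dist_norm)
      have "\<phi> p - \<phi> y = (w - \<phi> y) * u p" using w0 by (simp add: u_def)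
      moreover have "cmod (u p) \<le> 1 + M\<^sup>2"
      proof -
        have "u p = 1 - s p ^ 2" using s2[of p] p cb by (auto simp: algebra_simps)
        then have "cmod (u p) \<le> 1 + cmod (s p) ^ 2"
          using norm_triangle_ineq4[of 1 "s p ^ 2"] by (simp add: norm_power)
        also have "\<dots> \<le> 1 + M\<^sup>2" using bound[OF p] by (simp add: power_mono)
        finally show ?thesis .
      qed
      ultimately show "cmod (\<phi> p - \<phi> y) \<le> cmod (w - \<phi> y) * (1 + M\<^sup>2)"
        by (simp add: norm_mult mult_left_mono)
    qed
    moreover have "deriv (\<lambda>\<zeta>. \<phi> \<zeta> - \<phi> y) z = deriv \<phi> z"
      using holomorphic_on_imp_differentiable_at[OF hol, of z] z r by (subst deriv_diff) auto
    ultimately show "cmod (deriv \<phi> z) \<le> 8 * (1 + M\<^sup>2) * cmod (w - \<phi> y) / r"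
      by (simp add: field_simps)
  qed
qed

text \<open>A proper local homeomorphism with finite fibres is a covering. Properness is stated
  fibrewise: preimages of values near \<open>w\<close> lie in any given neighbourhood of the fibre
  of \<open>w\<close>.\<close>

lemma covering_space_of_proper_holomorphic:
  assumes "open C" and hol: "G holomorphic_on C" and nz: "\<And>z. z \<in> C \<Longrightarrow> deriv G z \<noteq> 0"
    and onto: "G ` C = S" and fin: "\<And>w. w \<in> S \<Longrightarrow> finite (C \<inter> G -` {w})"
    and proper: "\<And>w U. w \<in> S \<Longrightarrow> open U \<Longrightarrow> C \<inter> G -` {w} \<subseteq> U \<Longrightarrow>
      \<exists>r>0. \<forall>z\<in>C. dist (G z) w < r \<longrightarrow> z \<in> U"
  shows "covering_space C G S"
proof
  show contG: "continuous_on C G" using hol by (rule holomorphic_on_imp_continuous_on)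
  show "G ` C = S" by (rule onto)
  fix w assume w: "w \<in> S"
  define Z where "Z = C \<inter> G -` {w}"
  have finZ: "finite Z" using fin[OF w] by (simp add: Z_def)
  have "\<exists>r>0. ball z r \<subseteq> C \<and> inj_on G (ball z r) \<and> (\<forall>z'\<in>Z. z' \<noteq> z \<longrightarrow> 2 * r < dist z z')" if z: "z \<in> Z" for z
  proof -
    obtain r1 where r1: "r1 > 0" "ball z r1 \<subseteq> C" "inj_on G (ball z r1)"
      using has_complex_derivative_locally_injective[OF hol _ \<open>open C\<close>, of z] nz z
      unfolding Z_def by blast
    obtain d where d: "d > 0" "\<And>z'. z' \<in> Z \<Longrightarrow> z' \<noteq> z \<Longrightarrow> d \<le> dist z z'"
      using finite_set_avoid[OF finZ, of z] by blast
    show ?thesis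
    proof (intro exI[of _ "min r1 (d/3)"] conjI ballI impI)
      show "inj_on G (ball z (min r1 (d/3)))" using r1(3) by (rule inj_on_subset) auto
      fix z' assume "z' \<in> Z" "z' \<noteq> z"
      from d(2)[OF this] show "2 * min r1 (d/3) < dist z z'" using d(1) by linarith
    qed (use r1 d in auto)
  qed
  then obtain \<rho> where \<rho>: "\<And>z. z \<in> Z \<Longrightarrow> \<rho> z > 0" "\<And>z. z \<in> Z \<Longrightarrow> ball z (\<rho> z) \<subseteq> C"
      "\<And>z. z \<in> Z \<Longrightarrow> inj_on G (ball z (\<rho> z))"
      "\<And>z z'. z \<in> Z \<Longrightarrow> z' \<in> Z \<Longrightarrow> z' \<noteq> z \<Longrightarrow> 2 * \<rho> z < dist z z'"
    by metis
  define B where "B = (\<lambda>z. ball z (\<rho> z))"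
  have disjB: "B z \<inter> B z' = {}" if "z \<in> Z" "z' \<in> Z" "z \<noteq> z'" for z z'
  proof -
    have "2 * \<rho> z < dist z z'" "2 * \<rho> z' < dist z' z" using \<rho>(4) that by auto
    then have "\<rho> z + \<rho> z' \<le> dist z z'" by (simp add: dist_commute)
    then show ?thesis unfolding B_def by (rule disjoint_ballI)
  qed
  obtain r where r: "r > 0" "\<And>z. z \<in> C \<Longrightarrow> dist (G z) w < r \<Longrightarrow> z \<in> (\<Union>z\<in>Z. B z)"
  proof -
    have "Z \<subseteq> (\<Union>z\<in>Z. B z)" using \<rho>(1) by (fastforce simp: B_def)
    moreover have "open (\<Union>z\<in>Z. B z)" by (auto simp: B_def)
    ultimately have "\<exists>r>0. \<forall>z\<in>C. dist (G z) w < r \<longrightarrow> z \<in> (\<Union>z\<in>Z. B z)"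
      unfolding Z_def by (intro proper[OF w])
    then show ?thesis using that by blast
  qed
  have opG: "open (G ` B z)" if "z \<in> Z" for z
    unfolding B_def
    by (rule open_mapping_thm3[OF holomorphic_on_subset[OF hol \<rho>(2)[OF that]] open_ball \<rho>(3)[OF that]])
  \<comment> \<open>Disjoint injectivity discs around the fibre contain the sheets. The intersection
    of their images is evenly covered once values are so close to \<open>w\<close> that no preimage
    lies outside these discs.\<close>
  define T where "T = ball w r \<inter> (\<Inter>z\<in>Z. G ` B z)"
  have opT: "open T" unfolding T_def using finZ opG by (intro open_Int open_INT open_ball ballI) 
  have wT: "w \<in> T"
  proof -
    have "w \<in> G ` B z" if "z \<in> Z" for z using that \<rho>(1)[OF that] by (auto simp: B_def Z_def intro!: image_eqI[of w G z])
    then show ?thesis using r(1) by (simp add: T_def)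
  qed
  obtain z0 where "z0 \<in> Z" using w onto by (auto simp: Z_def)
  have TS: "T \<subseteq> S"
    using \<rho>(2) \<open>z0 \<in> Z\<close> onto unfolding T_def B_def by blast
  define V where "V = (\<lambda>z. B z \<inter> G -` T)"
  have opV: "open (V z)" if "z \<in> Z" for z
  proof -
    have "continuous_on (B z) G" using contG \<rho>(2)[OF that] unfolding B_def by (rule continuous_on_subset)
    then show ?thesis unfolding V_def
      by (intro continuous_open_preimage opT) (auto simp: B_def)
  qed
  have img: "G ` V z = T" if "z \<in> Z" for z
    using that unfolding V_def T_def by blast
  show "\<exists>T. w \<in> T \<and> openin (top_of_set S) T \<and> (\<exists>v. \<Union> v = C \<inter> G -` T \<and>
         (\<forall>u\<in>v. openin (top_of_set C) u) \<and> pairwise disjnt v \<and> (\<forall>u\<in>v. \<exists>q. homeomorphism u T G q))"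
  proof (intro exI[of _ T] conjI exI[of _ "V ` Z"] ballI)
    show "openin (top_of_set S) T" using opT TS by (simp add: open_openin_trans open_subset)
    show "\<Union> (V ` Z) = C \<inter> G -` T"
      using \<rho>(2) r(2) unfolding V_def B_def T_def by (auto simp: dist_commute)
    show "openin (top_of_set C) u" if "u \<in> V ` Z" for u
      using that opV \<rho>(2) unfolding V_def B_def by (auto intro!: open_subset)
    show "pairwise disjnt (V ` Z)"
      using disjB unfolding V_def pairwise_def disjnt_def by blast
    fix u assume "u \<in> V ` Z"
    then obtain z where z: "z \<in> Z" "u = V z" by auto
    have hu: "G holomorphic_on u"
      using holomorphic_on_subset[OF hol] \<rho>(2) z unfolding V_def B_def by blast
    have iu: "inj_on G u"
      using inj_on_subset[OF \<rho>(3)[OF z(1)]] z(2) by (simp add: V_def B_def)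
    obtain h where "homeomorphism u (G ` u) G h"
      using invariance_of_domain_homeomorphism[of u G] opV[OF z(1)] holomorphic_on_imp_continuous_on[OF hu] iu z(2)
      by auto
    then show "\<exists>q. homeomorphism u T G q" using img[OF z(1)] z(2) by auto
  qed (use wT in auto)
qed

text \<open>A continuous lift exists as the ball is simply connected. It is differentiable because
  the Caratheodory form of the derivative of \<open>G\<close> gives
  \<open>\<phi> t - \<phi> y = h (\<psi> t) * (\<psi> t - \<psi> y)\<close> with
  \<open>h (\<psi> y) \<noteq> 0\<close>.\<close>

lemma holomorphic_lift_ball:
  assumes cov: "covering_space C G S" and "open C" and hol: "G holomorphic_on C"
    and nz: "\<And>z. z \<in> C \<Longrightarrow> deriv G z \<noteq> 0"
    and \<phi>: "\<phi> holomorphic_on ball x r" "\<phi> ` ball x r \<subseteq> S" and r: "0 < r" and a: "a \<in> C" "G a = \<phi> x"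
  obtains \<psi> where "\<psi> holomorphic_on ball x r" "\<psi> ` ball x r \<subseteq> C" "\<psi> x = a"
    "\<And>y. y \<in> ball x r \<Longrightarrow> G (\<psi> y) = \<phi> y"
proof -
  obtain \<psi> where \<psi>: "continuous_on (ball x r) \<psi>" "\<psi> \<in> ball x r \<rightarrow> C" "\<psi> x = a"
    "\<And>y. y \<in> ball x r \<Longrightarrow> G (\<psi> y) = \<phi> y"
    using covering_space_lift_strong[OF cov a(1), of x "ball x r" \<phi>] r \<phi>(2) a(2)
      holomorphic_on_imp_continuous_on[OF \<phi>(1)]
    by (metis centre_in_ball convex_ball convex_imp_locally_path_connected
        convex_imp_simply_connected image_subset_iff_funcset)
  have "\<psi> field_differentiable at y" if y: "y \<in> ball x r" for y
  proof -
    have Cy: "\<psi> y \<in> C" using \<psi>(2) y by auto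
    have "(G has_field_derivative deriv G (\<psi> y)) (at (\<psi> y))"
      by (rule holomorphic_derivI[OF hol \<open>open C\<close> Cy])
    then obtain h where h: "\<And>z. G z - G (\<psi> y) = h z * (z - \<psi> y)" "isCont h (\<psi> y)" "h (\<psi> y) = deriv G (\<psi> y)"
      unfolding CARAT_DERIV by blast
    have c\<psi>: "isCont \<psi> y" using \<psi>(1) y by (simp add: continuous_on_eq_continuous_at)
    have hc: "isCont (\<lambda>t. h (\<psi> t)) y" using c\<psi> h(2) by (rule isCont_o2)
    have hnz: "h (\<psi> y) \<noteq> 0" using h(3) nz[OF Cy] by simp
    have "((\<lambda>t. (\<phi> t - \<phi> y) / (t - y)) \<longlongrightarrow> deriv \<phi> y) (at y)"
      using holomorphic_derivI[OF \<phi>(1) open_ball y] by (simp add: has_field_derivative_iff)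
    moreover have "((\<lambda>t. h (\<psi> t)) \<longlongrightarrow> h (\<psi> y)) (at y)" using hc by (simp add: isCont_def)
    ultimately have "((\<lambda>t. (\<phi> t - \<phi> y) / (t - y) / h (\<psi> t)) \<longlongrightarrow> deriv \<phi> y / h (\<psi> y)) (at y)"
      using hnz by (intro tendsto_divide)
    moreover have "\<forall>\<^sub>F t in at y. (\<phi> t - \<phi> y) / (t - y) / h (\<psi> t) = (\<psi> t - \<psi> y) / (t - y)"
    proof -
      have "\<forall>\<^sub>F t in at y. h (\<psi> t) \<noteq> 0"
        using \<open>((\<lambda>t. h (\<psi> t)) \<longlongrightarrow> h (\<psi> y)) (at y)\<close> hnz by (rule tendsto_imp_eventually_ne)
      moreover have "\<forall>\<^sub>F t in at y. t \<in> ball x r"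
        using y by (intro eventually_at_in_open') auto
      ultimately show ?thesis
      proof eventually_elim
        case (elim t)
        have "\<phi> t - \<phi> y = h (\<psi> t) * (\<psi> t - \<psi> y)" using h(1)[of "\<psi> t"] \<psi>(4) elim y by simp
        then show ?case using elim by simp
      qed
    qed
    ultimately have "((\<lambda>t. (\<psi> t - \<psi> y) / (t - y)) \<longlongrightarrow> deriv \<phi> y / h (\<psi> y)) (at y)"
      by (rule Lim_transform_eventually)
    then show ?thesis unfolding field_differentiable_def has_field_derivative_iff by blast
  qed
  then have "\<psi> holomorphic_on ball x r"
    by (simp add: holomorphic_on_def field_differentiable_at_within)
  then show thesis using that \<psi> by (simp add: image_subset_iff_funcset)
qed

section \<open>Orbits isolated from the other singular values\<close>

text \<open>Distinct elements have distinct quotients by \<open>N\<close>. Since \<open>A\<close>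
  starts at \<open>N\<close>, the quotient 0 does not occur and the bound has no extra 1.\<close>

lemma card_le_of_spaced:
  fixes A :: "nat set"
  assumes "N > 0" "A \<subseteq> {N..M}" and sp: "\<And>i j. i \<in> A \<Longrightarrow> j \<in> A \<Longrightarrow> i < j \<Longrightarrow> N \<le> j - i"
  shows "card A \<le> M div N"
proof -
  have ne: "i div N \<noteq> j div N" if "i \<in> A" "j \<in> A" "i < j" for i j
  proof -
    have "i div N + 1 = (i + N) div N" using \<open>N > 0\<close> by simp
    also have "\<dots> \<le> j div N" using sp[OF that] that(3) by (intro div_le_mono) linarith
    finally show ?thesis by simp
  qed
  have "inj_on (\<lambda>i. i div N) A"
    by (rule inj_onI) (metis ne nat_neq_iff)
  moreover have "(\<lambda>i. i div N) ` A \<subseteq> {1..M div N}"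
    using assms(2) \<open>N > 0\<close> by (auto simp: div_greater_zero_iff Suc_le_eq intro!: div_le_mono)
  ultimately show ?thesis
    using card_inj_on_le[of "\<lambda>i. i div N" A "{1..M div N}"] by simp
qed

section \<open>Iterates, their derivatives and inverse branches\<close>

locale holomorphic_dynamics =
  fixes G :: "complex \<Rightarrow> complex" and Dom :: "complex set"
  assumes open_Dom: "open Dom" and hol_G: "G holomorphic_on Dom"
begin

definition mult :: "nat \<Rightarrow> complex \<Rightarrow> complex" where
  "mult n z = (\<Prod>i<n. deriv G ((G ^^ i) z))"

text \<open>\<open>G\<close> is a total function whose values outside \<open>Dom\<close> carry no
  meaning; on this set the first \<open>n\<close> steps of the orbit are genuine.\<close>

definition dom_iter :: "nat \<Rightarrow> complex set" where
  "dom_iter n = {z. \<forall>i<n. (G ^^ i) z \<in> Dom}"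

lemma mult_0 [simp]: "mult 0 z = 1"
  by (simp add: mult_def)

lemma mult_Suc: "mult (Suc n) z = mult n z * deriv G ((G ^^ n) z)"
  by (simp add: mult_def)

lemma iter_add: "(G ^^ (m + n)) z = (G ^^ n) ((G ^^ m) z)"
  by (metis add.commute comp_apply funpow_add)

lemma mult_add: "mult (m + n) z = mult m z * mult n ((G ^^ m) z)"
  by (induction n) (auto simp: mult_Suc iter_add)

lemma dom_iter_Suc: "z \<in> dom_iter (Suc n) \<longleftrightarrow> z \<in> dom_iter n \<and> (G ^^ n) z \<in> Dom"
  by (auto simp: dom_iter_def less_Suc_eq)

lemma dom_iter_Suc': "z \<in> dom_iter (Suc n) \<longleftrightarrow> z \<in> Dom \<and> G z \<in> dom_iter n"
  unfolding dom_iter_def All_less_Suc2 by (auto simp: funpow_swap1)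

lemma dom_iter_0 [simp]: "dom_iter 0 = UNIV"
  by (simp add: dom_iter_def)

lemma has_field_derivative_iter:
  "z \<in> dom_iter n \<Longrightarrow> ((G ^^ n) has_field_derivative mult n z) (at z)"
proof (induction n)
  case (Suc n)
  then have "((G ^^ n) has_field_derivative mult n z) (at z)" and D: "(G ^^ n) z \<in> Dom"
    by (auto simp: dom_iter_Suc)
  from DERIV_chain[OF holomorphic_derivI[OF hol_G open_Dom D] this(1)]
  show ?case by (simp add: mult_Suc mult.commute o_def)
qed (simp add: id_def)

lemma isCont_iter: "z \<in> dom_iter n \<Longrightarrow> isCont (G ^^ n) z"
  using has_field_derivative_iter DERIV_isCont by blast

lemma open_dom_iter: "open (dom_iter n)"
proof (induction n)
  case (Suc n)
  have "continuous_on (dom_iter n) (G ^^ n)"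
    by (simp add: continuous_at_imp_continuous_on isCont_iter)
  then have "open (dom_iter n \<inter> (G ^^ n) -` Dom)"
    using Suc open_Dom by (intro continuous_open_preimage)
  also have "dom_iter n \<inter> (G ^^ n) -` Dom = dom_iter (Suc n)" by (auto simp: dom_iter_Suc)
  finally show ?case .
qed simp

lemma holomorphic_iter: "(G ^^ n) holomorphic_on dom_iter n"
  using has_field_derivative_iter open_dom_iter by (auto simp: holomorphic_on_open)

lemma deriv_iter: "z \<in> dom_iter n \<Longrightarrow> deriv (G ^^ n) z = mult n z"
  using has_field_derivative_iter DERIV_imp_deriv by blast

definition inv_branch :: "nat \<Rightarrow> (complex \<Rightarrow> complex) \<Rightarrow> complex \<Rightarrow> real \<Rightarrow> bool" where
  "inv_branch m \<phi> x r \<longleftrightarrow> \<phi> holomorphic_on ball x r \<and>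
     (\<forall>y\<in>ball x r. \<phi> y \<in> dom_iter m \<and> (G ^^ m) (\<phi> y) = y)"

lemma inv_branch_subset: "inv_branch m \<phi> x r \<Longrightarrow> s \<le> r \<Longrightarrow> inv_branch m \<phi> x s"
  unfolding inv_branch_def using subset_ball[of s r x]
  by (auto intro: holomorphic_on_subset)

text \<open>Turns an upper bound on the derivative of an inverse branch into a lower bound on the
  derivative of the iterate.\<close>

lemma mult_inv_branch:
  assumes "inv_branch m \<phi> x r" "0 < r"
  shows "mult m (\<phi> x) * deriv \<phi> x = 1"
proof -
  have hol: "\<phi> holomorphic_on ball x r" and d: "\<phi> x \<in> dom_iter m"
    using assms by (auto simp: inv_branch_def)
  have "((G ^^ m) \<circ> \<phi> has_field_derivative mult m (\<phi> x) * deriv \<phi> x) (at x)"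
    using assms(2) by (intro DERIV_chain has_field_derivative_iter d holomorphic_derivI[OF hol]) auto
  moreover have "((G ^^ m) \<circ> \<phi> has_field_derivative 1) (at x)"
    using DERIV_ident
  proof (rule has_field_derivative_transform_within_open[of _ _ _ "ball x r"])
    show "\<And>y. y \<in> ball x r \<Longrightarrow> y = ((G ^^ m) \<circ> \<phi>) y" using assms(1) by (simp add: inv_branch_def)
  qed (use assms in auto)
  ultimately show ?thesis by (rule DERIV_unique)
qed

end

text \<open>The disjointness of the postcritical sets enters only through the assumption \<open>lift\<close>: an inverse branch
  on a disc of radius at most \<open>\<sigma>\<close> around an orbit point can be continued unless it meets \<open>c\<close>.\<close>

locale isolated_orbit = holomorphic_dynamics +
  fixes c :: complex and \<sigma> :: real
  assumes compact_K: "compact (closure (range (\<lambda>i. (G ^^ i) c)))"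
    and K_Dom: "closure (range (\<lambda>i. (G ^^ i) c)) \<subseteq> Dom"
    and crit_K: "\<And>z. z \<in> closure (range (\<lambda>i. (G ^^ i) c)) \<Longrightarrow> deriv G z = 0 \<Longrightarrow> G z = c"
    and fin_fiber: "finite (Dom \<inter> G -` {c})"
    and \<sigma>: "\<sigma> > 0"
    and lift: "\<And>m \<phi> n r a. \<lbrakk>0 < r; r \<le> \<sigma>; inv_branch m \<phi> ((G ^^ n) c) r; c \<notin> \<phi> ` ball ((G ^^ n) c) r;
        a \<in> Dom; G a = \<phi> ((G ^^ n) c)\<rbrakk> \<Longrightarrow>
        \<exists>\<psi>. \<psi> holomorphic_on ball ((G ^^ n) c) r \<and> \<psi> ((G ^^ n) c) = a \<and>
          (\<forall>y\<in>ball ((G ^^ n) c) r. \<psi> y \<in> Dom \<and> G (\<psi> y) = \<phi> y)"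
    and not_attracted: "\<And>a k \<rho>. \<lbrakk>0 < k; 0 < \<rho>; ball ((G ^^ a) c) (8 * \<rho>) \<subseteq> dom_iter k;
        (G ^^ k) ` ball ((G ^^ a) c) (8 * \<rho>) \<subseteq> ball ((G ^^ a) c) \<rho>\<rbrakk> \<Longrightarrow> False"
    and aperiodic: "\<And>n. 0 < n \<Longrightarrow> (G ^^ n) c \<noteq> c"
begin

section \<open>The orbit of \<open>c\<close> and its closure\<close>

definition orb :: "nat \<Rightarrow> complex" where "orb i = (G ^^ i) c"

definition K :: "complex set" where "K = closure (range orb)"

lemma K_eq: "closure (range (\<lambda>i. (G ^^ i) c)) = K"
  by (simp add: K_def orb_def[abs_def])

lemmas compact_K' = compact_K[unfolded K_eq] and K_Dom' = K_Dom[unfolded K_eq]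
  and crit_K' = crit_K[unfolded K_eq]

lemma orb_K [simp]: "orb i \<in> K"
  unfolding K_def by (rule subsetD[OF closure_subset]) simp

lemma orb_Dom [simp]: "orb i \<in> Dom"
  using K_Dom' orb_K by blast

lemma orb_0 [simp]: "orb 0 = c" by (simp add: orb_def)

lemma iter_orb: "(G ^^ n) (orb i) = orb (i + n)"
  by (simp add: orb_def add.commute[of i] funpow_add)

lemma G_orb [simp]: "G (orb i) = orb (Suc i)"
  using iter_orb[of 1 i] by simp

lemma orb_dom_iter [simp]: "orb i \<in> dom_iter n"
  by (simp add: dom_iter_def iter_orb)

lemma deriv_orb_nonzero: "deriv G (orb i) \<noteq> 0"
  using crit_K'[OF orb_K, of i] aperiodic[of "Suc i"] by (auto simp: orb_def)

lemma mult_orb_nonzero: "mult n (orb i) \<noteq> 0"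
  by (simp add: mult_def iter_orb deriv_orb_nonzero)

section \<open>Close returns of the orbit to \<open>c\<close>\<close>

lemma returns_spaced:
  obtains \<delta> where "\<delta> > 0"
    and "\<And>i j. i < j \<Longrightarrow> cmod (orb i - c) < \<delta> \<Longrightarrow> cmod (orb j - c) < \<delta> \<Longrightarrow> N \<le> j - i"
proof -
  have "\<exists>\<delta>>0. \<forall>i j. i < j \<longrightarrow> cmod (orb i - c) < \<delta> \<longrightarrow> cmod (orb j - c) < \<delta> \<longrightarrow> N \<le> j - i"
  proof (induction N)
    case 0
    show ?case by (intro exI[of _ 1]) auto
  next
    case (Suc N)
    then obtain \<delta> where \<delta>: "\<delta> > 0"
      "\<And>i j. i < j \<Longrightarrow> cmod (orb i - c) < \<delta> \<Longrightarrow> cmod (orb j - c) < \<delta> \<Longrightarrow> N \<le> j - i" by blast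
    show ?case
    proof (cases "N = 0")
      case True
      show ?thesis using True by (intro exI[of _ 1]) auto
    next
      case False
      \<comment> \<open>Only a gap of exactly \<open>N\<close> is left to exclude. As
        \<open>G ^^ N\<close> is continuous at \<open>c\<close> and moves \<open>c\<close>, it sends
        points close to \<open>c\<close> to points close to \<open>orb N\<close>, hence away from
        \<open>c\<close>.\<close>
      have "isCont (G ^^ N) c" using isCont_iter[OF orb_dom_iter[of 0]] by simp
      moreover have e: "cmod (orb N - c) / 2 > 0" using aperiodic[of N] False by (simp add: orb_def)
      ultimately obtain d where d: "d > 0"
        "\<And>z. dist z c < d \<Longrightarrow> dist ((G ^^ N) z) ((G ^^ N) c) < cmod (orb N - c) / 2"
        unfolding continuous_at_eps_delta by blast
      define \<delta>' where "\<delta>' = min \<delta> (min d (cmod (orb N - c) / 2))"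
      have "Suc N \<le> j - i" if "i < j" "cmod (orb i - c) < \<delta>'" "cmod (orb j - c) < \<delta>'" for i j
      proof (rule ccontr)
        assume "\<not> Suc N \<le> j - i"
        moreover have "N \<le> j - i" using \<delta>(2)[OF that(1)] that by (simp add: \<delta>'_def)
        ultimately have j: "j = i + N" using that(1) by linarith
        have "dist (orb j) (orb N) < cmod (orb N - c) / 2"
          using d(2)[of "orb i"] that(2) unfolding j iter_orb by (simp add: dist_norm \<delta>'_def orb_def)
        moreover have "dist (orb j) c < cmod (orb N - c) / 2" using that(3) by (simp add: dist_norm \<delta>'_def)
        ultimately have "dist (orb N) c < cmod (orb N - c)"
          using dist_triangle[of "orb N" c "orb j"] by (simp add: dist_commute)
        then show False by (simp add: dist_norm)
      qed
      moreover have "\<delta>' > 0" using \<delta> d e by (simp add: \<delta>'_def)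
      ultimately show ?thesis by blast
    qed
  qed
  then show thesis using that by blast
qed

text \<open>Near a preimage \<open>z0\<close> of \<open>c\<close> one has
  \<open>G z - c = (z - z0) ^ n * h z\<close>. For \<open>r\<close> the distance from
  \<open>x\<close> to \<open>z0\<close>, \<open>cmod (G x - c)\<close> is comparable to
  \<open>r ^ n\<close>, which up to constants also bounds \<open>G - c\<close> on
  \<open>ball x r\<close> from above and \<open>r * cmod (deriv G x)\<close> from below. Compactness
  of \<open>K\<close> makes the constants uniform although \<open>n\<close> varies.\<close>

lemma local_degree_bound:
  obtains C \<delta> where "C \<ge> 1" "\<delta> > 0"
    and "\<And>x. x \<in> K \<Longrightarrow> G x \<noteq> c \<Longrightarrow> cmod (G x - c) < \<delta> \<Longrightarrow>
      \<exists>r>0. r \<le> \<sigma> \<and> ball x r \<subseteq> Dom \<and> (\<forall>z\<in>ball x r. cmod (G z - c) < C * cmod (G x - c)) \<and>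
        cmod (G x - c) \<le> C * (r * cmod (deriv G x))"
proof -
  define good where "good = (\<lambda>C x. \<exists>r>0. r \<le> \<sigma> \<and> ball x r \<subseteq> Dom \<and>
      (\<forall>z\<in>ball x r. cmod (G z - c) < C * cmod (G x - c)) \<and>
        cmod (G x - c) \<le> C * (r * cmod (deriv G x)))"
  have good_mono: "good C' x" if gC: "good C x" and CC: "C \<le> C'" for C C' x
  proof -
    obtain r where r: "r > 0" "r \<le> \<sigma>" "ball x r \<subseteq> Dom"
      "\<forall>z\<in>ball x r. cmod (G z - c) < C * cmod (G x - c)"
        "cmod (G x - c) \<le> C * (r * cmod (deriv G x))"
      using gC unfolding good_def by blast
    have "C * cmod (G x - c) \<le> C' * cmod (G x - c)" using CC by (rule mult_right_mono) auto
    moreover have "C * (r * cmod (deriv G x)) \<le> C' * (r * cmod (deriv G x))"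
      using CC r(1) by (intro mult_right_mono) auto
    ultimately show ?thesis unfolding good_def
      using r by (intro exI[of _ r] conjI ballI) (auto intro: less_le_trans order_trans)
  qed
  have loc: "\<exists>U C \<delta>. open U \<and> z0 \<in> U \<and> \<delta> > 0 \<and> (\<forall>x\<in>U. G x \<noteq> c \<longrightarrow> cmod (G x - c) < \<delta> \<longrightarrow> good C x)"
    if z0: "z0 \<in> K" for z0
  proof (cases "G z0 = c")
    case False
    have "isCont G z0"
      using hol_G open_Dom K_Dom' z0 continuous_on_eq_continuous_at holomorphic_on_imp_continuous_on by blast
    then obtain d where d: "d > 0" "\<And>z. dist z z0 < d \<Longrightarrow> dist (G z) (G z0) < cmod (G z0 - c) / 2"
      unfolding continuous_at_eps_delta using False by (metis half_gt_zero right_minus_eq zero_less_norm_iff)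
    have "cmod (G z0 - c) / 2 \<le> cmod (G x - c)" if "x \<in> ball z0 d" for x
    proof -
      have "dist (G x) (G z0) < cmod (G z0 - c) / 2" using d(2) that by (simp add: dist_commute)
      then show ?thesis
        using dist_triangle[of "G z0" c "G x"] by (simp add: dist_norm norm_minus_commute)
    qed
    \<comment> \<open>The threshold is such that no \<open>x\<close> in this ball satisfies
      \<open>cmod (G x - c) < \<delta>\<close>.\<close>
    then show ?thesis
      using d(1) False by (intro exI[of _ "ball z0 d"] exI[of _ 1] exI[of _ "cmod (G z0 - c) / 2"]) force
  next
    case True
    have z0D: "z0 \<in> Dom" using K_Dom' z0 by auto
    obtain e0 where e0: "e0 > 0" "ball z0 e0 \<subseteq> Dom" using open_Dom z0D by (meson openE)
    have nc: "\<not> (\<lambda>z. G z - c) constant_on ball z0 e0"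
    proof
      assume "(\<lambda>z. G z - c) constant_on ball z0 e0"
      then have "G z - c = G z0 - c" if "z \<in> ball z0 e0" for z
        using that e0(1) unfolding constant_on_def by (metis centre_in_ball)
      then have "ball z0 e0 \<subseteq> Dom \<inter> G -` {c}" using e0 True by auto
      then have "finite (ball z0 e0)" using fin_fiber finite_subset by blast
      then show False using e0(1) by (metis finite_imp_not_open open_ball ball_eq_empty not_le)
    qed
    have hc: "(\<lambda>z. G z - c) holomorphic_on ball z0 e0"
      using hol_G e0(2) by (intro holomorphic_intros) (rule holomorphic_on_subset)
    have z0b: "z0 \<in> ball z0 e0" and f0: "G z0 - c = 0" using e0(1) True by auto
    obtain h r1 n where n: "0 < n" and r1: "0 < r1" "ball z0 r1 \<subseteq> ball z0 e0"
      and h: "h holomorphic_on ball z0 r1" "\<And>w. w \<in> ball z0 r1 \<Longrightarrow> G w - c = (w - z0) ^ n * h w"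
        "\<And>w. w \<in> ball z0 r1 \<Longrightarrow> h w \<noteq> 0"
      by (rule holomorphic_factor_zero_nonconstant[OF hc open_ball connected_ball z0b f0 nc]) (rule that)
    define r2 where "r2 = min (r1 / 3) \<sigma>"
    have r2: "r2 > 0" "r2 \<le> r1 / 3" "r2 \<le> \<sigma>" using r1 \<sigma> by (auto simp: r2_def)
    have cb: "cball z0 (2 * r2) \<subseteq> ball z0 r1" using r2 by auto
    have ch: "continuous_on (cball z0 (2*r2)) h" and cdh: "continuous_on (cball z0 (2*r2)) (deriv h)"
      using holomorphic_on_imp_continuous_on h(1) holomorphic_deriv[OF h(1) open_ball]
        cb continuous_on_subset by blast+
    obtain H where H: "H > 0" "\<And>z. z \<in> cball z0 (2*r2) \<Longrightarrow> cmod (h z) \<le> H"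
      using compact_continuous_image[OF ch compact_cball, THEN compact_imp_bounded] unfolding bounded_pos by blast
    obtain H' where H': "H' > 0" "\<And>z. z \<in> cball z0 (2*r2) \<Longrightarrow> cmod (deriv h z) \<le> H'"
      using compact_continuous_image[OF cdh compact_cball, THEN compact_imp_bounded] unfolding bounded_pos by blast
    have "continuous_on (cball z0 (2*r2)) (\<lambda>z. inverse (h z))"
      using ch h(3) cb by (intro continuous_on_inverse) auto
    from compact_continuous_image[OF this compact_cball, THEN compact_imp_bounded]
    obtain J where J: "J > 0" "\<And>z. z \<in> cball z0 (2*r2) \<Longrightarrow> cmod (inverse (h z)) \<le> J"
      unfolding bounded_pos by blast
    define L where "L = 1 / J"
    have L: "L > 0" using J by (simp add: L_def)
    have hL: "L \<le> cmod (h z)" if "z \<in> cball z0 (2*r2)" for z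
    proof -
      have "h z \<noteq> 0" using h(3) cb that by blast
      then have "1 = cmod (inverse (h z)) * cmod (h z)" by (simp flip: norm_mult)
      also have "\<dots> \<le> J * cmod (h z)" using J(2)[OF that] by (rule mult_right_mono) auto
      finally show ?thesis using J(1) by (simp add: L_def divide_simps mult.commute)
    qed
    \<comment> \<open>Within distance \<open>e\<close> of \<open>z0\<close> the term with
      \<open>deriv h\<close> is at most half of the lower bound \<open>L\<close> for
      \<open>of_nat n * h x\<close>, so the two cannot cancel.\<close>
    define e where "e = min r2 (L / (2 * H'))"
    have e: "e > 0" "e \<le> r2" "e * H' \<le> L / 2"
    proof -
      show "e > 0" using r2 L H' by (simp add: e_def)
      show "e \<le> r2" by (simp add: e_def)
      have "e * H' \<le> L / (2 * H') * H'" using H' by (intro mult_right_mono) (auto simp: e_def)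
      then show "e * H' \<le> L / 2" using H' by simp
    qed
    \<comment> \<open>The first entry covers the growth on the disc, where
      \<open>cmod (z - z0) < 2 * s\<close>, with 1 added for strictness; the second covers the
      derivative.\<close>
    define C where "C = max (2 ^ n * H / L + 1) (4 * H / L)"
    have "good C x" if x: "x \<in> ball z0 e" and ne: "G x \<noteq> c" for x
    proof -
      define s where "s = cmod (x - z0)"
      have xr1: "x \<in> ball z0 r1" using x e(2) r2 by auto
      have xcb: "x \<in> cball z0 (2*r2)" using x e(2) r2 by auto
      have se: "s < e" using x by (simp add: s_def dist_norm norm_minus_commute)
      have s0: "s > 0" using ne True by (auto simp: s_def)
      have t: "cmod (G x - c) = s ^ n * cmod (h x)" by (simp add: h(2)[OF xr1] norm_mult norm_power s_def)
      have tL: "s ^ n * L \<le> cmod (G x - c)" unfolding t using hL[OF xcb] s0 by (intro mult_left_mono) auto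
      have tpos: "cmod (G x - c) > 0" using ne by simp
      have sub: "z \<in> cball z0 (2*r2) \<and> cmod (z - z0) < 2 * s" if "z \<in> ball x s" for z
      proof -
        have "cmod (z - z0) < 2 * s"
          using that norm_triangle_ineq[of "z - x" "x - z0"] by (simp add: s_def dist_norm norm_minus_commute)
        then show ?thesis using se e(2) by (simp add: dist_norm norm_minus_commute)
      qed
      have 1: "cmod (G z - c) < C * cmod (G x - c)" if z: "z \<in> ball x s" for z
      proof -
        have "cmod (G z - c) = cmod (z - z0) ^ n * cmod (h z)"
          using h(2)[of z] sub[OF z] cb by (auto simp: norm_mult norm_power)
        also have "\<dots> \<le> (2 * s) ^ n * H"
          using sub[OF z] H(2)[of z] s0 by (intro mult_mono power_mono) auto
        also have "\<dots> = (2 ^ n * H / L) * (s ^ n * L)" using L by (simp add: power_mult_distrib)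
        also have "\<dots> \<le> (2 ^ n * H / L) * cmod (G x - c)" using tL H L by (intro mult_left_mono) auto
        also have "\<dots> < C * cmod (G x - c)"
          using tpos by (intro mult_strict_right_mono) (auto simp: C_def)
        finally show ?thesis .
      qed
      obtain m where m: "n = Suc m" using n by (cases n) auto
      have "((\<lambda>w. (w - z0) ^ n * h w + c) has_field_derivative
          (of_nat n * (x - z0) ^ m * h x + (x - z0) ^ n * deriv h x)) (at x)"
        unfolding m by (rule derivative_eq_intros holomorphic_derivI[OF h(1) open_ball xr1] refl | simp)+
      then have "(G has_field_derivative (of_nat n * (x - z0) ^ m * h x + (x - z0) ^ n * deriv h x)) (at x)"
        by (rule has_field_derivative_transform_within_open[of _ _ _ "ball z0 r1"])
           (use xr1 in \<open>simp_all flip: h(2)\<close>)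
      then have "deriv G x = of_nat n * (x - z0) ^ m * h x + (x - z0) ^ n * deriv h x"
        by (rule DERIV_imp_deriv)
      then have dG: "deriv G x = (x - z0) ^ m * (of_nat n * h x + (x - z0) * deriv h x)"
        by (simp add: m algebra_simps)
      have "cmod (of_nat n * h x + (x - z0) * deriv h x) \<ge> L / 2"
      proof -
        have "cmod (of_nat n * h x) \<ge> 1 * L"
          unfolding norm_mult norm_of_nat using n hL[OF xcb] L by (intro mult_mono) auto
        moreover have "cmod ((x - z0) * deriv h x) \<le> e * H'"
          unfolding norm_mult using se H'(2)[OF xcb] e(1) by (intro mult_mono) (auto simp: s_def)
        ultimately show ?thesis
          using e(3) norm_diff_ineq[of "of_nat n * h x" "(x - z0) * deriv h x"] by linarith
      qed
      then have "s ^ m * (L / 2) \<le> cmod (deriv G x)"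
        unfolding dG norm_mult norm_power s_def by (intro mult_left_mono) auto
      then have "s * (s ^ m * (L / 2)) \<le> s * cmod (deriv G x)"
        using s0 by (intro mult_left_mono) auto
      then have d2: "s ^ n * (L / 2) \<le> s * cmod (deriv G x)"
        by (simp add: m)
      have "cmod (G x - c) \<le> s ^ n * H" unfolding t using H(2)[OF xcb] s0 by (intro mult_left_mono) auto
      also have "\<dots> = (2 * H / L) * (s ^ n * (L / 2))" using L by simp
      also have "\<dots> \<le> (2 * H / L) * (s * cmod (deriv G x))" using d2 H L by (intro mult_left_mono) auto
      also have "\<dots> \<le> C * (s * cmod (deriv G x))"
      proof (rule mult_right_mono)
        have "2 * H / L \<le> 4 * H / L" using H L by (simp add: divide_right_mono)
        then show "2 * H / L \<le> C" by (simp add: C_def)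
      qed (use s0 in auto)
      finally have 2: "cmod (G x - c) \<le> C * (s * cmod (deriv G x))" .
      have "ball x s \<subseteq> Dom" using sub cb r1(2) e0(2) by blast
      then show ?thesis unfolding good_def using 1 2 s0 se e(2) r2(3) by (intro exI[of _ s]) auto
    qed
    then show ?thesis
      using e(1) by (intro exI[of _ "ball z0 e"] exI[of _ C] exI[of _ 1]) auto
  qed
  then obtain U Cf \<delta>f where U: "\<And>z. z \<in> K \<Longrightarrow> open (U z)" "\<And>z. z \<in> K \<Longrightarrow> z \<in> U z" "\<And>z. z \<in> K \<Longrightarrow> \<delta>f z > 0"
    "\<And>z x. z \<in> K \<Longrightarrow> x \<in> U z \<Longrightarrow> G x \<noteq> c \<Longrightarrow> cmod (G x - c) < \<delta>f z \<Longrightarrow> good (Cf z) x"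
    by metis
  have KU: "K \<subseteq> (\<Union>z\<in>K. U z)" using U(2) by blast
  obtain T where T: "T \<subseteq> K" "finite T" "K \<subseteq> (\<Union>z\<in>T. U z)"
    by (rule compactE_image[OF compact_K' U(1) KU]) (assumption, rule that)
  define C where "C = Max (insert 1 (Cf ` T))"
  define \<delta> where "\<delta> = Min (insert 1 (\<delta>f ` T))"
  show thesis
  proof (rule that[of C \<delta>])
    show "1 \<le> C" using T by (simp add: C_def)
    show "0 < \<delta>" using T U(3) by (auto simp: \<delta>_def)
    fix x assume x: "x \<in> K" "G x \<noteq> c" "cmod (G x - c) < \<delta>"
    then obtain z where z: "z \<in> T" "x \<in> U z" using T by blast
    have "\<delta> \<le> \<delta>f z" "Cf z \<le> C" using z T by (auto simp: C_def \<delta>_def)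
    moreover have "z \<in> K" using T(1) z(1) by blast
    ultimately have "good (Cf z) x" using U(4)[OF _ z(2) x(2)] x(3) by simp
    then have "good C x" using \<open>Cf z \<le> C\<close> by (rule good_mono)
    then show "\<exists>r>0. r \<le> \<sigma> \<and> ball x r \<subseteq> Dom \<and> (\<forall>z\<in>ball x r. cmod (G z - c) < C * cmod (G x - c)) \<and>
        cmod (G x - c) \<le> C * (r * cmod (deriv G x))" by (simp add: good_def)
  qed
qed

text \<open>Each shrinking costs a factor \<open>1 / Q\<close>, and at most
  \<open>(b - a) div N\<close> of them occur. The 1 in the exponent pays for the distortion bound
  and for the last application of \<open>G\<close>.\<close>

lemma last_return_expands:
  obtains \<kappa> where "0 < \<kappa>" "\<kappa> < 1"
    and "\<And>N. 0 < N \<Longrightarrow> \<exists>\<delta>>0. \<forall>a b. a < b \<longrightarrow> cmod (orb b - c) < \<delta> \<longrightarrow> cmod (orb a - c) \<le> cmod (orb b - c) \<longrightarrow>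
      (\<forall>j. a < j \<longrightarrow> j < b \<longrightarrow> cmod (orb b - c) < cmod (orb j - c)) \<longrightarrow>
      N \<le> b - a \<and> \<kappa> ^ (1 + (b - a) div N) \<le> cmod (mult (b - a) (orb a))"
proof -
  obtain A where A: "A > 0"
    and deriv_le: "\<And>\<phi> x r y w z. \<lbrakk>0 < r; \<phi> holomorphic_on ball x r; y \<in> ball x (r/4); z \<in> ball x (r/4);
            \<And>u. u \<in> ball x r \<Longrightarrow> \<phi> u = \<phi> y \<Longrightarrow> u = y; w \<notin> \<phi> ` ball x r\<rbrakk>
          \<Longrightarrow> cmod (deriv \<phi> z) \<le> A * cmod (w - \<phi> y) / r"
    by (rule deriv_bound_of_omitted_value) blast
  obtain C \<delta>0 where C: "C \<ge> 1" and \<delta>0: "\<delta>0 > 0"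
    and local: "\<And>x. x \<in> K \<Longrightarrow> G x \<noteq> c \<Longrightarrow> cmod (G x - c) < \<delta>0 \<Longrightarrow>
      \<exists>r>0. r \<le> \<sigma> \<and> ball x r \<subseteq> Dom \<and> (\<forall>z\<in>ball x r. cmod (G z - c) < C * cmod (G x - c)) \<and>
        cmod (G x - c) \<le> C * (r * cmod (deriv G x))"
    by (rule local_degree_bound) blast
  \<comment> \<open>The 4 puts the shrunk disc into the quarter disc where the derivative bound
    holds; \<open>8 * A * C\<close> ensures that the branch changes by at most \<open>t\<close>
    between the centre and a point of the shrunk disc.\<close>
  define Q where "Q = max 4 (8 * A * C)"
  have Q: "Q \<ge> 4" "8 * A * C \<le> Q" by (auto simp: Q_def)
  define \<kappa> where "\<kappa> = min (1 / (8 * A * C * C)) (1 / Q)"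
  have \<kappa>: "0 < \<kappa>" "\<kappa> < 1" "\<kappa> \<le> 1 / (8 * A * C * C)" "\<kappa> \<le> 1 / Q"
  proof -
    show "0 < \<kappa>" using A C Q by (simp add: \<kappa>_def)
    show "\<kappa> \<le> 1 / (8 * A * C * C)" "\<kappa> \<le> 1 / Q" by (simp_all add: \<kappa>_def)
    moreover have "1 / Q \<le> 1 / 4" using Q(1) by (intro divide_left_mono) auto
    ultimately show "\<kappa> < 1" by linarith
  qed
  show thesis
  proof (rule that[OF \<kappa>(1,2)])
    fix N :: nat assume N: "0 < N"
    obtain \<delta>1 where \<delta>1: "\<delta>1 > 0"
      and spaced: "\<And>i j. i < j \<Longrightarrow> cmod (orb i - c) < \<delta>1 \<Longrightarrow> cmod (orb j - c) < \<delta>1 \<Longrightarrow> N \<le> j - i"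
      by (rule returns_spaced) blast
    \<comment> \<open>Division by \<open>C\<close> is needed because the spacing is applied to times
      at which the orbit is within \<open>C * t\<close> of \<open>c\<close>, not just within
      \<open>t\<close>.\<close>
    define \<delta> where "\<delta> = min \<delta>0 (\<delta>1 / C)"
    have \<delta>: "\<delta> > 0" using \<delta>0 \<delta>1 C by (simp add: \<delta>_def)
    have main: "N \<le> b - a \<and> \<kappa> ^ (1 + (b - a) div N) \<le> cmod (mult (b - a) (orb a))"
      if ab: "a < b" and bd: "cmod (orb b - c) < \<delta>" and aret: "cmod (orb a - c) \<le> cmod (orb b - c)"
        and between: "\<And>j. a < j \<Longrightarrow> j < b \<Longrightarrow> cmod (orb b - c) < cmod (orb j - c)" for a b
    proof -
      define t where "t = cmod (orb b - c)"
      have t: "0 < t" using aperiodic[of b] ab by (auto simp: t_def orb_def)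
      have t\<delta>: "t < \<delta>0" "C * t < \<delta>1" "t < \<delta>1"
      proof -
        show "t < \<delta>0" using bd by (simp add: t_def \<delta>_def)
        have "t < \<delta>1 / C" using bd by (simp add: t_def \<delta>_def)
        then show "C * t < \<delta>1" using C by (simp add: pos_less_divide_eq mult.commute)
        then show "t < \<delta>1" using C t mult_right_mono[of 1 C t] by linarith
      qed
      define x where "x = orb (b - 1)"
      have Gx: "G x = orb b" using ab by (simp add: x_def)
      obtain r where r: "r > 0" "r \<le> \<sigma>" "ball x r \<subseteq> Dom"
        and rC: "\<And>z. z \<in> ball x r \<Longrightarrow> cmod (G z - c) < C * t" and rd: "t \<le> C * (r * cmod (deriv G x))"
        using local[of x] t t\<delta> unfolding Gx t_def by (auto simp: x_def)
      \<comment> \<open>A branch of the \<open>m\<close>-th inverse can meet \<open>c\<close> only if \<open>orb (Suc m)\<close> is close to \<open>c\<close>, so the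
        disc has to shrink at such times only.\<close>
      define cnt where "cnt = (\<lambda>m. card {i. 1 \<le> i \<and> i \<le> m \<and> cmod (orb i - c) < C * t})"
      define \<rho> where "\<rho> = (\<lambda>m. r / Q ^ cnt m)"
      have \<rho>0: "\<rho> m > 0" for m using r Q by (simp add: \<rho>_def)
      have \<rho>r: "\<rho> m \<le> r" for m using r Q by (simp add: \<rho>_def divide_le_eq)
      have cnt_Suc: "cnt (Suc m) = cnt m + (if cmod (orb (Suc m) - c) < C * t then 1 else 0)" for m
      proof -
        have "{i. 1 \<le> i \<and> i \<le> Suc m \<and> cmod (orb i - c) < C * t} =
          (if cmod (orb (Suc m) - c) < C * t then insert (Suc m) {i. 1 \<le> i \<and> i \<le> m \<and> cmod (orb i - c) < C * t}
           else {i. 1 \<le> i \<and> i \<le> m \<and> cmod (orb i - c) < C * t})"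
          by (auto simp: le_Suc_eq)
        moreover have "finite {i. 1 \<le> i \<and> i \<le> m \<and> cmod (orb i - c) < C * t}"
          by (rule finite_subset[of _ "{..m}"]) auto
        ultimately show ?thesis by (simp add: cnt_def)
      qed
      have into: "cmod ((G ^^ Suc m) (\<phi> y) - c) < C * t" if "inv_branch m \<phi> x (\<rho> m)" "y \<in> ball x (\<rho> m)" for m \<phi> y
      proof -
        have "y \<in> ball x r" using that(2) \<rho>r[of m] by auto
        moreover have "(G ^^ Suc m) (\<phi> y) = G y" using that by (simp add: inv_branch_def)
        ultimately show ?thesis using rC by simp
      qed
      have in_dom: "\<phi> y \<in> dom_iter (Suc m)" if "inv_branch m \<phi> x (\<rho> m)" "y \<in> ball x (\<rho> m)" for m \<phi> y
      proof -
        have "y \<in> Dom" using that(2) \<rho>r[of m] r(3) by auto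
        then show ?thesis using that by (simp add: inv_branch_def dom_iter_Suc)
      qed
      \<comment> \<open>If the branch covered a definite neighbourhood of \<open>c\<close>, the return map would contract it.\<close>
      have omit: "\<exists>w. cmod (w - c) \<le> 8 * (C * t) \<and> w \<notin> \<phi> ` ball x (\<rho> m)" if \<phi>: "inv_branch m \<phi> x (\<rho> m)" for m \<phi>
      proof (rule ccontr)
        assume "\<not> ?thesis"
        then have cov: "w \<in> \<phi> ` ball x (\<rho> m)" if "w \<in> ball c (8 * (C * t))" for w
          using that by (auto simp: dist_norm norm_minus_commute)
        show False
        proof (rule not_attracted[of "Suc m" "C * t" 0])
          show "0 < C * t" using C t by simp
          show "ball ((G ^^ 0) c) (8 * (C * t)) \<subseteq> dom_iter (Suc m)"
            using cov in_dom[OF \<phi>] by fastforce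
          show "(G ^^ Suc m) ` ball ((G ^^ 0) c) (8 * (C * t)) \<subseteq> ball ((G ^^ 0) c) (C * t)"
          proof safe
            fix w assume "w \<in> ball ((G ^^ 0) c) (8 * (C * t))"
            then have "w \<in> \<phi> ` ball x (\<rho> m)" by (intro cov) simp
            then obtain y where "y \<in> ball x (\<rho> m)" "w = \<phi> y" by blast
            then show "(G ^^ Suc m) w \<in> ball ((G ^^ 0) c) (C * t)"
              using into[OF \<phi>] by (simp add: dist_norm norm_minus_commute)
          qed
        qed simp
      qed
      have inj: "u = y" if "inv_branch m \<phi> x (\<rho> m)" "u \<in> ball x (\<rho> m)" "y \<in> ball x (\<rho> m)" "\<phi> u = \<phi> y" for m \<phi> u y
        using that unfolding inv_branch_def by metis
      have deriv_core: "cmod (deriv \<phi> z) \<le> 8 * A * C * t / \<rho> m"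
        if \<phi>: "inv_branch m \<phi> x (\<rho> m)" and y: "y \<in> ball x (\<rho> m / 4)" "\<phi> y = c" and z: "z \<in> ball x (\<rho> m / 4)" for m \<phi> y z
      proof -
        obtain w where w: "cmod (w - c) \<le> 8 * (C * t)" "w \<notin> \<phi> ` ball x (\<rho> m)" using omit[OF \<phi>] by blast
        have yb: "y \<in> ball x (\<rho> m)" using y(1) \<rho>0[of m] by auto
        have "cmod (deriv \<phi> z) \<le> A * cmod (w - \<phi> y) / \<rho> m"
          by (rule deriv_le[OF \<rho>0 _ y(1) z _ w(2)]) (use \<phi> inj[OF \<phi> _ yb] in \<open>auto simp: inv_branch_def\<close>)
        also have "\<dots> \<le> A * (8 * (C * t)) / \<rho> m"
          using w(1) A \<rho>0[of m] y(2) by (intro divide_right_mono mult_left_mono) auto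
        finally show ?thesis by (simp add: mult_ac)
      qed
      have branch: "\<exists>\<phi>. inv_branch m \<phi> x (\<rho> m) \<and> \<phi> x = orb (b - 1 - m)" if "m \<le> b - 1 - a" for m
        using that
      proof (induction m)
        case 0
        show ?case by (intro exI[of _ "\<lambda>z. z"]) (auto simp: inv_branch_def x_def)
      next
        case (Suc m)
        then obtain \<phi> where \<phi>: "inv_branch m \<phi> x (\<rho> m)" and \<phi>x: "\<phi> x = orb (b - 1 - m)" by auto
        define j where "j = b - 1 - m"
        have j: "a < j" "j < b" "j = Suc (j - 1)" using Suc.prems ab by (auto simp: j_def)
        have tj: "t < cmod (orb j - c)" using between j by (simp add: t_def)
        have hol: "\<phi> holomorphic_on ball x (\<rho> m)" using \<phi> by (simp add: inv_branch_def)
        have le: "\<rho> (Suc m) \<le> \<rho> m" using \<rho>0[of m] Q r by (auto simp: \<rho>_def cnt_Suc divide_le_eq field_simps)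
        \<comment> \<open>If the branch took the value \<open>c\<close> on the shrunk disc, the
          derivative bound would put its value \<open>orb j\<close> at the centre within
          \<open>t\<close> of \<open>c\<close>, although \<open>a < j\<close> and
          \<open>j < b\<close>. Time \<open>a\<close> itself imposes nothing, as the pullback stops
          there.\<close>
        have c_omit: "c \<notin> \<phi> ` ball x (\<rho> (Suc m))"
        proof
          assume "c \<in> \<phi> ` ball x (\<rho> (Suc m))"
          then obtain y where y: "y \<in> ball x (\<rho> (Suc m))" "\<phi> y = c" by auto
          have yb: "y \<in> ball x (\<rho> m)" using y(1) le by auto
          have "cmod (orb (Suc m) - c) < C * t"
            using into[OF \<phi> yb] unfolding y(2) by (simp add: orb_def)
          then have \<rho>S: "\<rho> (Suc m) = \<rho> m / Q" by (simp add: \<rho>_def cnt_Suc)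
          have "\<rho> m / Q \<le> \<rho> m / 4" using Q \<rho>0[of m] by (intro divide_left_mono) auto
          then have y4: "y \<in> ball x (\<rho> m / 4)" using y(1) unfolding \<rho>S mem_ball by (rule less_le_trans[rotated])
          have "cmod (\<phi> x - \<phi> y) \<le> 8 * A * C * t / \<rho> m * cmod (x - y)"
          proof (rule field_differentiable_bound[of "ball x (\<rho> m / 4)" \<phi> "deriv \<phi>"])
            fix z assume z: "z \<in> ball x (\<rho> m / 4)"
            then have "z \<in> ball x (\<rho> m)" using \<rho>0[of m] by auto
            then show "(\<phi> has_field_derivative deriv \<phi> z) (at z within ball x (\<rho> m / 4))"
              using holomorphic_derivI[OF hol] by blast
            show "cmod (deriv \<phi> z) \<le> 8 * A * C * t / \<rho> m" by (rule deriv_core[OF \<phi> y4 y(2) z])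
          qed (use y4 \<rho>0[of m] in auto)
          also have "\<dots> \<le> 8 * A * C * t / \<rho> m * (\<rho> m / Q)"
            using y(1) A C t \<rho>0[of m] unfolding \<rho>S by (intro mult_left_mono) (auto simp: dist_norm)
          also have "\<dots> = t * ((8 * A * C) / Q)" using \<rho>0[of m] Q by (simp add: field_simps)
          also have "\<dots> \<le> t * 1" using Q t by (intro mult_left_mono) auto
          finally show False using tj unfolding y(2) \<phi>x j_def by simp
        qed
        have \<phi>': "inv_branch m \<phi> x (\<rho> (Suc m))" by (rule inv_branch_subset[OF \<phi> le])
        have "\<exists>\<psi>. \<psi> holomorphic_on ball x (\<rho> (Suc m)) \<and> \<psi> x = orb (j - 1) \<and>
          (\<forall>y\<in>ball x (\<rho> (Suc m)). \<psi> y \<in> Dom \<and> G (\<psi> y) = \<phi> y)"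
          using lift[of "\<rho> (Suc m)" m \<phi> "b - 1" "orb (j - 1)"] \<rho>0[of "Suc m"] \<rho>r[of "Suc m"] r(2) \<phi>' c_omit
            G_orb[of "j - 1"] j(3) \<phi>x
          unfolding orb_def[of "b - 1", symmetric] x_def[symmetric] j_def by simp
        then obtain \<psi> where \<psi>: "\<psi> holomorphic_on ball x (\<rho> (Suc m))" "\<psi> x = orb (j - 1)"
          "\<And>y. y \<in> ball x (\<rho> (Suc m)) \<Longrightarrow> \<psi> y \<in> Dom" "\<And>y. y \<in> ball x (\<rho> (Suc m)) \<Longrightarrow> G (\<psi> y) = \<phi> y"
          by blast
        have "inv_branch (Suc m) \<psi> x (\<rho> (Suc m))"
          using \<psi> \<phi>' unfolding inv_branch_def dom_iter_Suc' by (simp add: funpow_swap1)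
        then show ?case using \<psi>(2) by (intro exI[of _ \<psi>]) (simp add: j_def)
      qed
      define m where "m = b - 1 - a"
      obtain \<phi> where \<phi>: "inv_branch m \<phi> x (\<rho> m)" and "\<phi> x = orb (b - 1 - m)"
        using branch[of m] by (auto simp: m_def)
      then have \<phi>x: "\<phi> x = orb a" using ab by (simp add: m_def)
      have xb: "x \<in> ball x (\<rho> m)" "x \<in> ball x (\<rho> m / 4)" using \<rho>0[of m] by auto
      \<comment> \<open>If the branch meets \<open>c\<close> on the quarter disc, an omitted value
        near \<open>c\<close> gives the bound. Otherwise \<open>c\<close> itself is omitted there,
        and it is within \<open>t\<close> of \<open>orb a\<close> by the choice of
        \<open>a\<close>.\<close>
      have d\<phi>: "cmod (deriv \<phi> x) \<le> 8 * A * C * t / \<rho> m"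
      proof (cases "\<exists>y\<in>ball x (\<rho> m / 4). \<phi> y = c")
        case True
        then show ?thesis using deriv_core[OF \<phi> _ _ xb(2)] by blast
      next
        case False
        have "cmod (deriv \<phi> x) \<le> A * cmod (c - \<phi> x) / (\<rho> m / 4)"
        proof (rule deriv_le)
          show "\<phi> holomorphic_on ball x (\<rho> m / 4)"
            using inv_branch_subset[OF \<phi>, of "\<rho> m / 4"] \<rho>0[of m] by (simp add: inv_branch_def)
          show "u = x" if "u \<in> ball x (\<rho> m / 4)" "\<phi> u = \<phi> x" for u
            using inj[OF \<phi> _ xb(1) that(2)] that(1) \<rho>0[of m] by auto
        qed (use False \<rho>0[of m] in auto)
        also have "\<dots> \<le> A * t / (\<rho> m / 4)"
          using aret A \<rho>0[of m] unfolding \<phi>x t_def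
          by (intro divide_right_mono mult_left_mono) (auto simp: norm_minus_commute)
        also have "\<dots> = 4 * A * t / \<rho> m" using \<rho>0[of m] by simp
        also have "\<dots> \<le> 8 * A * C * t / \<rho> m"
        proof (intro divide_right_mono mult_right_mono)
          have "A * 1 \<le> A * C" using A C by (intro mult_left_mono) auto
          then show "4 * A \<le> 8 * A * C" using A by simp
        qed (use t \<rho>0[of m] in auto)
        finally show ?thesis .
      qed
      have "mult m (orb a) * deriv \<phi> x = 1" using mult_inv_branch[OF \<phi> \<rho>0] \<phi>x by simp
      then have "1 = cmod (mult m (orb a)) * cmod (deriv \<phi> x)" by (metis norm_mult norm_one)
      also have "\<dots> \<le> cmod (mult m (orb a)) * (8 * A * C * t / \<rho> m)" using d\<phi> by (intro mult_left_mono) auto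
      finally have m1: "\<rho> m / (8 * A * C * t) \<le> cmod (mult m (orb a))"
        using A C t \<rho>0[of m] by (simp add: field_simps)
      have bma: "b - a = Suc m" "a + m = b - 1" using ab by (auto simp: m_def)
      \<comment> \<open>The branch contributes a factor \<open>1 / t\<close> and the last step a
        factor \<open>t\<close>, so the bound does not depend on how close the return is.\<close>
      have "(1 / (8 * A * C * C)) * (1 / Q) ^ cnt m = \<rho> m / (8 * A * C * t) * (t / (C * r))"
        using t r C A by (simp add: \<rho>_def field_simps power_one_over)
      also have "\<dots> \<le> cmod (mult m (orb a)) * cmod (deriv G x)"
      proof (rule mult_mono[OF m1])
        show "t / (C * r) \<le> cmod (deriv G x)" using rd C r by (simp add: field_simps)
      qed (use t C r in auto)
      also have "\<dots> = cmod (mult (b - a) (orb a))"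
        by (simp add: bma mult_Suc iter_orb norm_mult x_def)
      finally have low: "(1 / (8 * A * C * C)) * (1 / Q) ^ cnt m \<le> cmod (mult (b - a) (orb a))" .
      have "N \<le> b - a" using spaced[OF ab] aret t\<delta>(3) by (simp add: t_def)
      have "cnt m \<le> m div N"
        unfolding cnt_def
      proof (rule card_le_of_spaced[OF N])
        \<comment> \<open>As \<open>orb 0 = c\<close>, time 0 counts as a close time, and the first
          close time after it is at least \<open>N\<close>.\<close>
        have "N \<le> i" if "1 \<le> i" "cmod (orb i - c) < C * t" for i
          using spaced[of 0 i] that t\<delta>(2) \<delta>1 by simp
        then show "{i. 1 \<le> i \<and> i \<le> m \<and> cmod (orb i - c) < C * t} \<subseteq> {N..m}" by auto
      qed (use spaced t\<delta>(2) in auto)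
      also have "m div N \<le> (b - a) div N" by (rule div_le_mono) (simp add: bma)
      finally have cnt_le: "cnt m \<le> (b - a) div N" .
      have "\<kappa> ^ (1 + (b - a) div N) \<le> \<kappa> ^ (1 + cnt m)"
        using cnt_le \<kappa> by (intro power_decreasing) auto
      also have "\<dots> = \<kappa> * \<kappa> ^ cnt m" by simp
      also have "\<dots> \<le> (1 / (8 * A * C * C)) * (1 / Q) ^ cnt m"
        using \<kappa> A C by (intro mult_mono power_mono) auto
      also note low
      finally show ?thesis using \<open>N \<le> b - a\<close> by simp
    qed
    then show "\<exists>\<delta>>0. \<forall>a b. a < b \<longrightarrow> cmod (orb b - c) < \<delta> \<longrightarrow> cmod (orb a - c) \<le> cmod (orb b - c) \<longrightarrow>
      (\<forall>j. a < j \<longrightarrow> j < b \<longrightarrow> cmod (orb b - c) < cmod (orb j - c)) \<longrightarrow>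
      N \<le> b - a \<and> \<kappa> ^ (1 + (b - a) div N) \<le> cmod (mult (b - a) (orb a))"
      using \<delta> by blast
  qed
qed

text \<open>Strong induction from a return to the preceding one at no larger distance. The chain
  ends at time 0, where the distance is 0, and all its times stay below the threshold
  \<open>\<delta>\<close>.\<close>

lemma close_returns_expand:
  assumes "\<epsilon> > 0"
  obtains \<delta> where "\<delta> > 0" "\<And>b. cmod (orb b - c) < \<delta> \<Longrightarrow> exp (- \<epsilon> * real b) \<le> cmod (mult b c)"
proof -
  obtain \<kappa> where \<kappa>: "0 < \<kappa>" "\<kappa> < 1"
    and ret: "\<And>N. 0 < N \<Longrightarrow> \<exists>\<delta>>0. \<forall>a b. a < b \<longrightarrow> cmod (orb b - c) < \<delta> \<longrightarrow> cmod (orb a - c) \<le> cmod (orb b - c) \<longrightarrow>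
      (\<forall>j. a < j \<longrightarrow> j < b \<longrightarrow> cmod (orb b - c) < cmod (orb j - c)) \<longrightarrow>
      N \<le> b - a \<and> \<kappa> ^ (1 + (b - a) div N) \<le> cmod (mult (b - a) (orb a))"
    by (rule last_return_expands) blast
  define L where "L = - ln \<kappa>"
  have L: "L > 0" using \<kappa> by (simp add: L_def)
  \<comment> \<open>As \<open>N \<le> b - a\<close>, the exponent \<open>1 + (b - a) div N\<close>
    is at most twice the quotient; hence the 2.\<close>
  obtain N :: nat where N: "N > 0" "2 * L / \<epsilon> \<le> real N"
  proof -
    obtain n :: nat where "2 * L / \<epsilon> < real n" using reals_Archimedean2 by blast
    moreover have "0 < 2 * L / \<epsilon>" using L assms by simp
    ultimately show ?thesis using that[of n] by simp
  qed
  obtain \<delta> where \<delta>: "\<delta> > 0" and step: "\<And>a b. a < b \<Longrightarrow> cmod (orb b - c) < \<delta> \<Longrightarrow> cmod (orb a - c) \<le> cmod (orb b - c) \<Longrightarrow>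
      (\<And>j. a < j \<Longrightarrow> j < b \<Longrightarrow> cmod (orb b - c) < cmod (orb j - c)) \<Longrightarrow>
      N \<le> b - a \<and> \<kappa> ^ (1 + (b - a) div N) \<le> cmod (mult (b - a) (orb a))"
    using ret[OF N(1)] by blast
  have "exp (- \<epsilon> * real b) \<le> cmod (mult b c)" if "cmod (orb b - c) < \<delta>" for b
    using that
  proof (induction b rule: less_induct)
    case (less b)
    show ?case
    proof (cases "b = 0")
      case False
      define S where "S = {j. j < b \<and> cmod (orb j - c) \<le> cmod (orb b - c)}"
      have S: "finite S" "0 \<in> S" using False by (auto simp: S_def)
      define a where "a = Max S"
      have "a \<in> S" unfolding a_def using S by (intro Max_in) auto
      then have a: "a < b" "cmod (orb a - c) \<le> cmod (orb b - c)" by (auto simp: S_def)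
      have "cmod (orb b - c) < cmod (orb j - c)" if "a < j" "j < b" for j
        using that Max_ge[OF S(1), of j] unfolding a_def[symmetric] by (force simp: S_def)
      from step[OF a(1) less.prems a(2) this]
      have st: "N \<le> b - a" "\<kappa> ^ (1 + (b - a) div N) \<le> cmod (mult (b - a) (orb a))" by auto
      have "exp (- \<epsilon> * real (b - a)) \<le> \<kappa> ^ (1 + (b - a) div N)"
      proof -
        have "real (1 + (b - a) div N) * L \<le> \<epsilon> * real (b - a)"
        proof -
          have "(b - a) div N \<ge> 1" using st(1) N(1) by (simp add: Suc_le_eq div_greater_zero_iff)
          then have "real (1 + (b - a) div N) \<le> 2 * real ((b - a) div N)" by linarith
          also have "\<dots> \<le> 2 * (real (b - a) / real N)" using of_nat_div_le_of_nat[of "b - a" N, where ?'a=real] by simp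
          finally have "real (1 + (b - a) div N) * L \<le> 2 * (real (b - a) / real N) * L"
            by (rule mult_right_mono) (use L in simp)
          also have "\<dots> = real (b - a) * (2 * L / real N)" by simp
          also have "2 * L / real N \<le> \<epsilon>" using N assms by (simp add: field_simps)
          then have "real (b - a) * (2 * L / real N) \<le> real (b - a) * \<epsilon>" by (intro mult_left_mono) auto
          finally show ?thesis by (simp add: mult.commute)
        qed
        then have "exp (- \<epsilon> * real (b - a)) \<le> exp (- (real (1 + (b - a) div N) * L))" by simp
        also have "\<dots> = \<kappa> ^ (1 + (b - a) div N)"
          using \<kappa>(1) exp_of_nat_mult[of "1 + (b - a) div N" "ln \<kappa>"] by (simp add: L_def)
        finally show ?thesis .
      qed
      then have "exp (- \<epsilon> * real a) * exp (- \<epsilon> * real (b - a)) \<le> cmod (mult a c) * cmod (mult (b - a) (orb a))"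
        using less.IH[OF a(1)] a(2) less.prems st(2) by (intro mult_mono) auto
      also have "\<dots> = cmod (mult b c)"
        using mult_add[of a "b - a" c] a(1) by (simp add: norm_mult orb_def)
      finally show ?thesis using a(1) by (simp add: algebra_simps of_nat_diff flip: exp_add)
    qed simp
  qed
  then show thesis using that \<delta> by blast
qed

section \<open>Orbit segments away from \<open>c\<close>\<close>

lemma deriv_lower_bound_off_c:
  assumes "\<delta> > 0"
  obtains p where "0 < p" "p \<le> 1" "\<And>i. \<delta> \<le> cmod (orb (Suc i) - c) \<Longrightarrow> p \<le> cmod (deriv G (orb i))"
proof -
  define S where "S = {z \<in> K. \<delta> \<le> cmod (G z - c)}"
  have contG: "continuous_on K G" and contD: "continuous_on K (deriv G)"
    using holomorphic_on_imp_continuous_on[OF hol_G] holomorphic_on_imp_continuous_on[OF holomorphic_deriv[OF hol_G open_Dom]]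
      continuous_on_subset K_Dom' by blast+
  have "closed S" unfolding S_def
    using compact_K' by (intro continuous_on_closed_Collect_le continuous_intros contG compact_imp_closed)
  moreover have "S = K \<inter> S" by (auto simp: S_def)
  ultimately have "compact S" using compact_Int_closed[OF compact_K'] by metis
  show thesis
  proof (cases "S = {}")
    case True
    have "\<not> \<delta> \<le> cmod (orb (Suc i) - c)" for i
    proof
      assume "\<delta> \<le> cmod (orb (Suc i) - c)"
      then have "orb i \<in> S" by (simp add: S_def)
      then show False using True by simp
    qed
    then show thesis using that[of 1] by simp
  next
    case False
    have "continuous_on S (\<lambda>z. cmod (deriv G z))"
      by (intro continuous_on_norm continuous_on_subset[OF contD]) (auto simp: S_def)
    then obtain z where z: "z \<in> S" "\<And>y. y \<in> S \<Longrightarrow> cmod (deriv G z) \<le> cmod (deriv G y)"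
      using continuous_attains_inf[OF \<open>compact S\<close> False] by blast
    have "deriv G z \<noteq> 0" using crit_K'[of z] z(1) assms by (auto simp: S_def)
    then show thesis
      by (intro that[of "min 1 (cmod (deriv G z))"]) (auto simp: S_def intro!: min.coboundedI2 z(2))
  qed
qed

text \<open>The radius is a Lebesgue number of the cover of \<open>K\<close> by open sets on which
  \<open>deriv G\<close> varies by less than \<open>\<eta>\<close>.\<close>

lemma uniform_linear_bound:
  assumes "\<eta> > 0"
  obtains r where "r > 0" "\<And>x. x \<in> K \<Longrightarrow> ball x r \<subseteq> Dom"
    "\<And>x z. x \<in> K \<Longrightarrow> z \<in> ball x r \<Longrightarrow> cmod (G z - G x) \<le> (cmod (deriv G x) + \<eta>) * cmod (z - x)"
proof -
  define \<G> where "\<G> = {U. open U \<and> U \<subseteq> Dom \<and> (\<forall>w\<in>U. \<forall>w'\<in>U. cmod (deriv G w - deriv G w') < \<eta>)}"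
  have cover: "K \<subseteq> \<Union>\<G>"
  proof
    fix x assume "x \<in> K"
    then have x: "x \<in> Dom" using K_Dom' by auto
    have "isCont (deriv G) x"
      using holomorphic_on_imp_continuous_on[OF holomorphic_deriv[OF hol_G open_Dom]] open_Dom x
        continuous_on_eq_continuous_at by blast
    then obtain d where d: "d > 0" "\<And>y. dist y x < d \<Longrightarrow> dist (deriv G y) (deriv G x) < \<eta> / 2"
      unfolding continuous_at_eps_delta using assms by (meson half_gt_zero)
    have "cmod (deriv G w - deriv G w') < \<eta>" if "w \<in> ball x d" "w' \<in> ball x d" for w w'
    proof -
      have "dist (deriv G w) (deriv G x) < \<eta> / 2" "dist (deriv G w') (deriv G x) < \<eta> / 2"
        using d(2) that by (auto simp: dist_commute)
      from dist_triangle_half_l[OF this] show ?thesis by (simp add: dist_norm)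
    qed
    then have "ball x d \<inter> Dom \<in> \<G>" unfolding \<G>_def using open_Dom by auto
    then show "x \<in> \<Union>\<G>" using x d(1) by (intro UnionI[of "ball x d \<inter> Dom"]) auto
  qed
  obtain r where r: "0 < r" "\<And>x. x \<in> K \<Longrightarrow> \<exists>U\<in>\<G>. ball x r \<subseteq> U"
    using Heine_Borel_lemma[OF compact_K' cover] by (auto simp: \<G>_def)
  show thesis
  proof (rule that[OF r(1)])
    fix x assume x: "x \<in> K"
    then obtain U where U: "U \<in> \<G>" "ball x r \<subseteq> U" using r(2) by blast
    show sub: "ball x r \<subseteq> Dom" using U by (auto simp: \<G>_def)
    fix z assume z: "z \<in> ball x r"
    show "cmod (G z - G x) \<le> (cmod (deriv G x) + \<eta>) * cmod (z - x)"
    proof (rule field_differentiable_bound[of "ball x r" G "deriv G"])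
      fix w assume w: "w \<in> ball x r"
      show "(G has_field_derivative deriv G w) (at w within ball x r)"
        using holomorphic_derivI[OF hol_G open_Dom] w sub by blast
      have "x \<in> ball x r" using r(1) by simp
      then have "cmod (deriv G w - deriv G x) < \<eta>" using U w unfolding \<G>_def by blast
      then show "cmod (deriv G w) \<le> cmod (deriv G x) + \<eta>"
        using norm_triangle_ineq2[of "deriv G w" "deriv G x"] by linarith
    qed (use z r(1) in auto)
  qed
qed

text \<open>Half of the decay rate is given away: the multipliers decay like
  \<open>(\<mu>\<^sup>2) ^ i\<close>, the nonlinearity costs at most a factor
  \<open>1 / \<mu>\<close> per step, and \<open>\<mu> ^ i\<close> remains. The lower bound
  \<open>p\<close> on the derivatives turns the additive error of the linear bound into this
  relative one.\<close>

lemma contracted_ball: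
  assumes \<mu>: "0 < \<mu>" "\<mu> < 1" and p: "0 < p"
  obtains r where "r > 0"
    "\<And>a n z i. \<lbrakk>\<And>i. i \<le> n \<Longrightarrow> cmod (mult i (orb a)) \<le> (\<mu>\<^sup>2) ^ i; \<And>i. i < n \<Longrightarrow> p \<le> cmod (deriv G (orb (a + i)));
      z \<in> ball (orb a) r; i \<le> n\<rbrakk> \<Longrightarrow> z \<in> dom_iter i \<and> cmod ((G ^^ i) z - orb (a + i)) \<le> \<mu> ^ i * cmod (z - orb a)"
proof -
  \<comment> \<open>Chosen so that \<open>D + \<eta> \<le> D / \<mu>\<close> whenever
    \<open>p \<le> D\<close>.\<close>
  define \<eta> where "\<eta> = p * (1 / \<mu> - 1)"
  have "\<eta> > 0" using \<mu> p by (simp add: \<eta>_def)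
  obtain r where r: "r > 0" "\<And>x. x \<in> K \<Longrightarrow> ball x r \<subseteq> Dom"
    "\<And>x z. x \<in> K \<Longrightarrow> z \<in> ball x r \<Longrightarrow> cmod (G z - G x) \<le> (cmod (deriv G x) + \<eta>) * cmod (z - x)"
    by (rule uniform_linear_bound[OF \<open>\<eta> > 0\<close>]) blast
  show thesis
  proof (rule that[OF r(1)])
    fix a n z i
    assume m: "\<And>i. i \<le> n \<Longrightarrow> cmod (mult i (orb a)) \<le> (\<mu>\<^sup>2) ^ i"
      and low: "\<And>i. i < n \<Longrightarrow> p \<le> cmod (deriv G (orb (a + i)))"
      and z: "z \<in> ball (orb a) r" and "i \<le> n"
    have close: "cmod ((G ^^ i) z - orb (a + i)) \<le> \<mu> ^ i * cmod (z - orb a)"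
      if "\<mu> ^ i * cmod ((G ^^ i) z - orb (a + i)) \<le> cmod (mult i (orb a)) * cmod (z - orb a)" "i \<le> n" for i
    proof -
      have "\<mu> ^ i * cmod ((G ^^ i) z - orb (a + i)) \<le> (\<mu>\<^sup>2) ^ i * cmod (z - orb a)"
        using that(1) mult_right_mono[OF m[OF that(2)], of "cmod (z - orb a)"] by simp
      also have "(\<mu>\<^sup>2) ^ i = \<mu> ^ i * \<mu> ^ i" by (simp add: power2_eq_square power_mult_distrib)
      finally show ?thesis using \<mu>(1) by (simp add: mult.assoc)
    qed
    \<comment> \<open>The induction compares with the multiplier and not with
      \<open>\<mu> ^ i\<close>, because a single derivative may exceed 1: only the products decay.
      Their decay keeps the point within \<open>r\<close> of the orbit, where the linear bound
      holds.\<close>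
    have "z \<in> dom_iter i \<and> \<mu> ^ i * cmod ((G ^^ i) z - orb (a + i)) \<le> cmod (mult i (orb a)) * cmod (z - orb a)"
      using \<open>i \<le> n\<close>
    proof (induction i)
      case (Suc i)
      then have IH: "z \<in> dom_iter i" "\<mu> ^ i * cmod ((G ^^ i) z - orb (a + i)) \<le> cmod (mult i (orb a)) * cmod (z - orb a)"
        by auto
      define y where "y = (G ^^ i) z"
      have "cmod (y - orb (a + i)) \<le> \<mu> ^ i * cmod (z - orb a)" using close[OF IH(2)] Suc.prems by (simp add: y_def)
      also have "\<dots> \<le> cmod (z - orb a)" using \<mu> by (intro mult_left_le_one_le) (auto intro: power_le_one)
      also have "\<dots> < r" using z by (simp add: dist_norm norm_minus_commute)
      finally have y: "y \<in> ball (orb (a + i)) r" by (simp add: dist_norm norm_minus_commute)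
      have "cmod (deriv G (orb (a + i))) + \<eta> \<le> cmod (deriv G (orb (a + i))) / \<mu>"
      proof -
        have "\<eta> \<le> cmod (deriv G (orb (a + i))) * (1 / \<mu> - 1)"
          unfolding \<eta>_def using low[of i] Suc.prems \<mu> by (intro mult_right_mono) auto
        then show ?thesis by (simp add: algebra_simps)
      qed
      then have "cmod (G y - orb (Suc (a + i))) \<le> cmod (deriv G (orb (a + i))) / \<mu> * cmod (y - orb (a + i))"
        using r(3)[OF orb_K y] mult_right_mono[of _ _ "cmod (y - orb (a + i))"] by fastforce
      then have "\<mu> ^ Suc i * cmod (G y - orb (Suc (a + i)))
          \<le> \<mu> ^ Suc i * (cmod (deriv G (orb (a + i))) / \<mu> * cmod (y - orb (a + i)))"
        using \<mu> by (intro mult_left_mono) auto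
      also have "\<dots> = cmod (deriv G (orb (a + i))) * (\<mu> ^ i * cmod (y - orb (a + i)))" using \<mu> by simp
      also have "\<dots> \<le> cmod (deriv G (orb (a + i))) * (cmod (mult i (orb a)) * cmod (z - orb a))"
        using IH(2) by (intro mult_left_mono) (auto simp: y_def)
      also have "\<dots> = cmod (mult (Suc i) (orb a)) * cmod (z - orb a)"
        by (simp add: mult_Suc iter_orb norm_mult)
      finally have "\<mu> ^ Suc i * cmod (G y - orb (Suc (a + i))) \<le> cmod (mult (Suc i) (orb a)) * cmod (z - orb a)" .
      moreover have "y \<in> Dom" using subsetD[OF r(2)[OF orb_K] y] .
      ultimately show ?case using IH(1) by (simp add: y_def dom_iter_Suc)
    qed simp
    then show "z \<in> dom_iter i \<and> cmod ((G ^^ i) z - orb (a + i)) \<le> \<mu> ^ i * cmod (z - orb a)"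
      using close \<open>i \<le> n\<close> by blast
  qed
qed

text \<open>Since \<open>K\<close> is compact, two of the contracted balls nearly coincide, so that an iterate maps
  a third one well inside itself.\<close>

lemma not_contracted_arbitrarily_long:
  assumes \<mu>: "0 < \<mu>" "\<mu> < 1" and r: "0 < r"
    and contr: "\<And>Q. \<exists>a\<ge>Q. \<forall>z\<in>ball (orb a) r. \<forall>i\<le>Q.
      z \<in> dom_iter i \<and> cmod ((G ^^ i) z - orb (a + i)) \<le> \<mu> ^ i * cmod (z - orb a)"
  shows False
proof -
  obtain f where f: "\<And>Q. Q \<le> f Q" "\<And>Q z i. z \<in> ball (orb (f Q)) r \<Longrightarrow> i \<le> Q \<Longrightarrow>
      z \<in> dom_iter i \<and> cmod ((G ^^ i) z - orb (f Q + i)) \<le> \<mu> ^ i * cmod (z - orb (f Q))"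
    using contr by metis
  obtain l s where s: "strict_mono (s :: nat \<Rightarrow> nat)" "(\<lambda>Q. orb (f (s Q))) \<longlonglongrightarrow> l"
    using compact_K'[unfolded compact_def, rule_format, of "\<lambda>Q. orb (f Q)"] by (auto simp: o_def)
  obtain N where N: "\<mu> ^ N < 1 / 32" using real_arch_pow_inv[of "1/32" \<mu>] \<mu> by auto
  obtain Q0 where Q0: "\<And>Q. Q \<ge> Q0 \<Longrightarrow> dist (orb (f (s Q))) l < r / 100"
    using s(2) r unfolding lim_sequentially by (metis divide_pos_pos zero_less_numeral)
  have close: "dist (orb (f (s Q))) (orb (f (s Q'))) < r / 50" if "Q \<ge> Q0" "Q' \<ge> Q0" for Q Q'
    using Q0[OF that(1)] Q0[OF that(2)] dist_triangle2[of "orb (f (s Q))" "orb (f (s Q'))" l] by linarith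
  \<comment> \<open>\<open>k\<close> steps lead from \<open>orb a1\<close> to the nearby point
    \<open>orb a2\<close>. The ball about \<open>orb a1\<close> is known to contract for
    \<open>s Q0\<close> steps only, possibly fewer than \<open>k\<close>, so a third time
    \<open>a3\<close> with \<open>k \<le> s Q3\<close> is taken; its ball contains the one of radius
    \<open>8 * (r / 12)\<close> about \<open>orb a1\<close>. The image is then within
    \<open>r/50 + r/100 + r/32 < r/12\<close> of \<open>orb a1\<close>.\<close>
  define a1 where "a1 = f (s Q0)"
  define Q2 where "Q2 = Q0 + a1 + N + 1"
  define a2 where "a2 = f (s Q2)"
  have "Q2 \<le> a2" using f(1)[of "s Q2"] seq_suble[OF s(1), of Q2] by (simp add: a2_def)
  define k where "k = a2 - a1"
  have k: "a2 = a1 + k" "N \<le> k" "0 < k" using \<open>Q2 \<le> a2\<close> by (auto simp: Q2_def k_def)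
  define Q3 where "Q3 = Q0 + k"
  define a3 where "a3 = f (s Q3)"
  have ks: "k \<le> s Q3" using seq_suble[OF s(1), of Q3] by (simp add: Q3_def)
  have d12: "dist (orb a2) (orb a1) < r / 50" and d13: "dist (orb a1) (orb a3) < r / 50"
    unfolding a1_def a2_def a3_def by (rule close; simp add: Q2_def Q3_def)+
  have contr3: "z \<in> dom_iter k \<and> cmod ((G ^^ k) z - orb (a3 + k)) \<le> cmod (z - orb a3) / 32"
    if "z \<in> ball (orb a3) r" for z
  proof -
    have "\<mu> ^ k \<le> \<mu> ^ N" using \<mu> k(2) by (intro power_decreasing) auto
    then have "\<mu> ^ k * cmod (z - orb a3) \<le> 1 / 32 * cmod (z - orb a3)"
      using N by (intro mult_right_mono) auto
    then show ?thesis using f(2)[of z "s Q3" k] that ks by (auto simp: a3_def)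
  qed
  have sub: "ball (orb a1) (8 * (r / 12)) \<subseteq> ball (orb a3) r"
  proof
    fix z assume "z \<in> ball (orb a1) (8 * (r / 12))"
    then show "z \<in> ball (orb a3) r"
      using dist_triangle[of "orb a3" z "orb a1"] d13 r by (simp add: dist_commute)
  qed
  have "dist (orb a2) (orb (a3 + k)) < r / 100"
  proof -
    have "orb a1 \<in> ball (orb a3) r" using d13 r by (simp add: dist_commute)
    from contr3[OF this] have "dist (orb a2) (orb (a3 + k)) \<le> dist (orb a1) (orb a3) / 32"
      by (simp add: iter_orb k(1) dist_norm)
    then show ?thesis using d13 r by linarith
  qed
  show False
  proof (rule not_attracted[of k "r / 12" a1])
    show "ball ((G ^^ a1) c) (8 * (r / 12)) \<subseteq> dom_iter k"
      using sub contr3 by (auto simp: orb_def)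
    show "(G ^^ k) ` ball ((G ^^ a1) c) (8 * (r / 12)) \<subseteq> ball ((G ^^ a1) c) (r / 12)"
    proof safe
      fix z assume "z \<in> ball ((G ^^ a1) c) (8 * (r / 12))"
      then have z: "z \<in> ball (orb a3) r" using sub by (auto simp: orb_def)
      have "dist ((G ^^ k) z) (orb (a3 + k)) \<le> r / 32"
        using contr3[OF z] z by (simp add: dist_norm norm_minus_commute)
      moreover have "dist (orb a1) ((G ^^ k) z) \<le> dist (orb a1) (orb a2) + (dist (orb a2) (orb (a3 + k)) + dist (orb (a3 + k)) ((G ^^ k) z))"
        by (rule order_trans[OF dist_triangle[of _ _ "orb a2"]]) (intro add_left_mono dist_triangle)
      ultimately show "(G ^^ k) z \<in> ball ((G ^^ a1) c) (r / 12)"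
        using d12 \<open>dist (orb a2) (orb (a3 + k)) < r / 100\<close> r by (simp add: dist_commute orb_def)
    qed
  qed (use k r in auto)
qed

text \<open>Contraction over a whole segment says nothing about its initial pieces. As in Pliss'
  lemma, there is a later starting time from which every initial piece decays at rate
  \<open>\<epsilon> / 2\<close>; the contraction of balls applies from there.\<close>

lemma far_segments_expand:
  assumes \<epsilon>: "\<epsilon> > 0" and \<delta>: "\<delta> > 0"
  obtains L where "\<And>m n. \<lbrakk>L \<le> n; \<And>i. m < i \<Longrightarrow> i \<le> m + n \<Longrightarrow> \<delta> \<le> cmod (orb i - c)\<rbrakk>
    \<Longrightarrow> exp (- \<epsilon> * real n) \<le> cmod (mult n (orb m))"
proof (rule ccontr)
  assume "\<not> thesis"
  then have bad: "\<exists>m n. L \<le> n \<and> (\<forall>i. m < i \<longrightarrow> i \<le> m + n \<longrightarrow> \<delta> \<le> cmod (orb i - c)) \<and>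
      cmod (mult n (orb m)) < exp (- \<epsilon> * real n)" for L
    using that by (meson not_le)
  obtain p where p: "0 < p" "p \<le> 1" "\<And>i. \<delta> \<le> cmod (orb (Suc i) - c) \<Longrightarrow> p \<le> cmod (deriv G (orb i))"
    by (rule deriv_lower_bound_off_c[OF \<delta>]) blast
  define \<mu> where "\<mu> = exp (- \<epsilon> / 4)"
  have \<mu>: "0 < \<mu>" "\<mu> < 1" using \<epsilon> by (auto simp: \<mu>_def)
  have \<mu>2: "(\<mu>\<^sup>2) ^ i = exp (- (\<epsilon> / 2) * real i)" for i
    by (simp add: \<mu>_def flip: exp_of_nat_mult power_mult)
  obtain r where r: "r > 0"
    "\<And>a n z i. \<lbrakk>\<And>i. i \<le> n \<Longrightarrow> cmod (mult i (orb a)) \<le> (\<mu>\<^sup>2) ^ i; \<And>i. i < n \<Longrightarrow> p \<le> cmod (deriv G (orb (a + i)));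
      z \<in> ball (orb a) r; i \<le> n\<rbrakk> \<Longrightarrow> z \<in> dom_iter i \<and> cmod ((G ^^ i) z - orb (a + i)) \<le> \<mu> ^ i * cmod (z - orb a)"
    by (rule contracted_ball[OF \<mu> p(1)]) blast
  show False
  proof (rule not_contracted_arbitrarily_long[OF \<mu> r(1)])
    fix Q :: nat
    \<comment> \<open>From length \<open>L0\<close> on, the surplus decay
      \<open>exp (- (\<epsilon> / 2) * real n)\<close> beats the largest loss
      \<open>p ^ (2 * Q)\<close> that \<open>2 * Q\<close> single steps can cause.\<close>
    obtain L0 :: nat where L0: "exp (- (\<epsilon> / 2) * real L0) < p ^ (2 * Q)"
    proof -
      obtain l where "exp (- (\<epsilon> / 2)) ^ l < p ^ (2 * Q)"
        using real_arch_pow_inv[of "p ^ (2 * Q)" "exp (- (\<epsilon> / 2))"] p \<epsilon> by auto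
      then show ?thesis using that[of l] by (simp add: mult.commute flip: exp_of_nat_mult)
    qed
    obtain m n where n: "max Q L0 \<le> n" and far: "\<And>i. m < i \<Longrightarrow> i \<le> m + n \<Longrightarrow> \<delta> \<le> cmod (orb i - c)"
      and small: "cmod (mult n (orb m)) < exp (- \<epsilon> * real n)"
      using bad by blast
    have low: "p \<le> cmod (deriv G (orb (m + i)))" if "i < n" for i
      using p(3)[of "m + i"] far[of "Suc (m + i)"] that by simp
    have low_mult: "p ^ j \<le> cmod (mult j (orb (m + i)))" if "i + j \<le> n" for i j
      using that
    proof (induction j)
      case (Suc j)
      have "p ^ j * p \<le> cmod (mult j (orb (m + i))) * cmod (deriv G (orb (m + i + j)))"
        using Suc low[of "i + j"] p(1) by (intro mult_mono) (auto simp: add.assoc)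
      then show ?case by (simp add: mult_Suc iter_orb norm_mult mult.commute)
    qed simp
    \<comment> \<open>From a time \<open>j\<close> that maximizes \<open>S\<close>, all derivatives up to time \<open>n\<close> decay exponentially.\<close>
    define S where "S = (\<lambda>j. cmod (mult j (orb m)) * exp (\<epsilon> / 2 * real j))"
    \<comment> \<open>Restricting to times from \<open>Q\<close> on makes the starting time
      \<open>m + j\<close> at least \<open>Q\<close>, as the compactness argument requires.\<close>
    have ne: "finite (S ` {Q..n})" "S ` {Q..n} \<noteq> {}" using n by auto
    obtain j where j: "Q \<le> j" "j \<le> n" "S j = Max (S ` {Q..n})" using Max_in[OF ne] by auto
    have Sj: "S i \<le> S j" if "Q \<le> i" "i \<le> n" for i
      unfolding j(3) using that by (intro Max_ge) auto
    have S_add: "S (j + i) = S j * (cmod (mult i (orb (m + j))) * exp (\<epsilon> / 2 * real i))" for i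
    proof -
      have "exp (\<epsilon> / 2 * real (j + i)) = exp (\<epsilon> / 2 * real j) * exp (\<epsilon> / 2 * real i)"
        by (simp add: distrib_left add_divide_distrib flip: exp_add)
      then show ?thesis by (simp only: S_def mult_add iter_orb norm_mult mult_ac)
    qed
    have Sj0: "S j > 0" by (simp add: S_def mult_orb_nonzero)
    have contr: "cmod (mult i (orb (m + j))) \<le> (\<mu>\<^sup>2) ^ i" if "i \<le> n - j" for i
    proof -
      have "S j * (cmod (mult i (orb (m + j))) * exp (\<epsilon> / 2 * real i)) \<le> S j * 1"
        using Sj[of "j + i"] that j by (simp add: S_add)
      then have "cmod (mult i (orb (m + j))) * exp (\<epsilon> / 2 * real i) \<le> 1"
        using Sj0 mult_le_cancel_left_pos by blast
      then show ?thesis unfolding \<mu>2 by (simp add: exp_minus field_simps)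
    qed
    \<comment> \<open>If the maximum were attained within the last \<open>Q\<close> steps,
      \<open>S n\<close> would be at least \<open>p ^ (2 * Q)\<close>: the maximum is at least
      \<open>S Q\<close>, hence at least \<open>p ^ Q\<close>, and the remaining steps lose at most
      another \<open>p ^ Q\<close>. This contradicts the choice of \<open>L0\<close>.\<close>
    have "Q \<le> n - j"
    proof (rule ccontr)
      assume "\<not> Q \<le> n - j"
      have exp1: "1 \<le> exp (\<epsilon> / 2 * real i)" for i using \<epsilon> by simp
      have "p ^ (2 * Q) \<le> p ^ (Q + (n - j))" using p(1,2) \<open>\<not> Q \<le> n - j\<close> by (intro power_decreasing) auto
      also have "\<dots> = p ^ Q * p ^ (n - j)" by (rule power_add)
      also have "\<dots> \<le> S Q * (cmod (mult (n - j) (orb (m + j))) * exp (\<epsilon> / 2 * real (n - j)))"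
      proof (intro mult_mono)
        have "p ^ Q * 1 \<le> S Q" unfolding S_def
          using low_mult[of 0 Q] n exp1 p(1) by (intro mult_mono) auto
        then show "p ^ Q \<le> S Q" by simp
        have "p ^ (n - j) * 1 \<le> cmod (mult (n - j) (orb (m + j))) * exp (\<epsilon> / 2 * real (n - j))"
          using low_mult[of j "n - j"] j p(1) by (intro mult_mono exp1) auto
        then show "p ^ (n - j) \<le> cmod (mult (n - j) (orb (m + j))) * exp (\<epsilon> / 2 * real (n - j))" by simp
      qed (use p(1) in \<open>auto simp: S_def\<close>)
      also have "\<dots> \<le> S j * (cmod (mult (n - j) (orb (m + j))) * exp (\<epsilon> / 2 * real (n - j)))"
        using Sj[of Q] n by (intro mult_right_mono) auto
      also have "\<dots> = S n" using S_add[of "n - j"] j by simp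
      also have "\<dots> \<le> exp (- \<epsilon> * real n) * exp (\<epsilon> / 2 * real n)"
        unfolding S_def using small by (intro mult_right_mono) auto
      also have "\<dots> = exp (- (\<epsilon> / 2) * real n)" by (simp add: algebra_simps flip: exp_add)
      also have "\<dots> \<le> exp (- (\<epsilon> / 2) * real L0)" using n \<epsilon> by simp
      finally show False using L0 by simp
    qed
    have "\<forall>z\<in>ball (orb (m + j)) r. \<forall>i\<le>Q. z \<in> dom_iter i \<and>
        cmod ((G ^^ i) z - orb (m + j + i)) \<le> \<mu> ^ i * cmod (z - orb (m + j))"
      using r(2)[of Q "m + j"] contr low \<open>Q \<le> n - j\<close> by (auto simp: add.assoc)
    then show "\<exists>a\<ge>Q. \<forall>z\<in>ball (orb a) r. \<forall>i\<le>Q.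
      z \<in> dom_iter i \<and> cmod ((G ^^ i) z - orb (a + i)) \<le> \<mu> ^ i * cmod (z - orb a)"
      using j(1) by (intro exI[of _ "m + j"]) auto
  qed
qed

text \<open>The orbit is cut at the last time \<open>b \<le> n\<close> at which it is close to
  \<open>c\<close>. The rest stays away from \<open>c\<close>; if it is too short for the
  exponential estimate, it costs at most \<open>p ^ L\<close>.\<close>

theorem subexponential_lower_bound:
  assumes \<epsilon>: "\<epsilon> > 0"
  obtains C where "C > 0" "\<And>n. C * exp (- \<epsilon> * real n) \<le> cmod (mult n c)"
proof -
  obtain \<delta> where \<delta>: "\<delta> > 0" "\<And>b. cmod (orb b - c) < \<delta> \<Longrightarrow> exp (- \<epsilon> * real b) \<le> cmod (mult b c)"
    by (rule close_returns_expand[OF \<epsilon>]) blast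
  obtain L where L: "\<And>m n. \<lbrakk>L \<le> n; \<And>i. m < i \<Longrightarrow> i \<le> m + n \<Longrightarrow> \<delta> \<le> cmod (orb i - c)\<rbrakk>
    \<Longrightarrow> exp (- \<epsilon> * real n) \<le> cmod (mult n (orb m))"
    by (rule far_segments_expand[OF \<epsilon> \<delta>(1)]) blast
  obtain p where p: "0 < p" "p \<le> 1" "\<And>i. \<delta> \<le> cmod (orb (Suc i) - c) \<Longrightarrow> p \<le> cmod (deriv G (orb i))"
    by (rule deriv_lower_bound_off_c[OF \<delta>(1)]) blast
  show thesis
  proof (rule that[of "p ^ L"])
    show "p ^ L > 0" using p(1) by simp
    fix n
    define B where "B = {b. b \<le> n \<and> cmod (orb b - c) < \<delta>}"
    have B: "finite B" "0 \<in> B" using \<delta>(1) by (auto simp: B_def)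
    define b where "b = Max B"
    have "b \<in> B" unfolding b_def using B by (intro Max_in) auto
    then have b: "b \<le> n" "cmod (orb b - c) < \<delta>" by (auto simp: B_def)
    have far: "\<delta> \<le> cmod (orb i - c)" if "b < i" "i \<le> n" for i
      using that Max_ge[OF B(1), of i] unfolding b_def[symmetric] by (force simp: B_def)
    have "p ^ L * exp (- \<epsilon> * real (n - b)) \<le> cmod (mult (n - b) (orb b))"
    proof (cases "L \<le> n - b")
      case True
      have "p ^ L * exp (- \<epsilon> * real (n - b)) \<le> 1 * exp (- \<epsilon> * real (n - b))"
        using p(1,2) by (intro mult_right_mono power_le_one) auto
      also have "\<dots> \<le> cmod (mult (n - b) (orb b))" using L[OF True, of b] far b(1) by simp
      finally show ?thesis .
    next
      case False
      have "p ^ j \<le> cmod (mult j (orb b))" if "j \<le> n - b" for j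
        using that
      proof (induction j)
        case (Suc j)
        have "p ^ j * p \<le> cmod (mult j (orb b)) * cmod (deriv G (orb (b + j)))"
          using Suc p(1) p(3)[of "b + j"] far[of "Suc (b + j)"] by (intro mult_mono) auto
        then show ?case by (simp add: mult_Suc iter_orb norm_mult mult.commute)
      qed simp
      from this[of "n - b"] have "p ^ (n - b) \<le> cmod (mult (n - b) (orb b))" by simp
      moreover have "p ^ L \<le> p ^ (n - b)" using False p(1,2) by (intro power_decreasing) auto
      moreover have "p ^ L * exp (- \<epsilon> * real (n - b)) \<le> p ^ L * 1"
        using \<epsilon> p(1) by (intro mult_left_mono) auto
      ultimately show ?thesis by linarith
    qed
    then have "exp (- \<epsilon> * real b) * (p ^ L * exp (- \<epsilon> * real (n - b))) \<le> cmod (mult b c) * cmod (mult (n - b) (orb b))"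
      using \<delta>(2)[OF b(2)] p(1) by (intro mult_mono) auto
    also have "\<dots> = cmod (mult n c)"
      using mult_add[of b "n - b" c] b(1) by (simp add: norm_mult orb_def)
    also have "exp (- \<epsilon> * real b) * (p ^ L * exp (- \<epsilon> * real (n - b))) = p ^ L * exp (- \<epsilon> * real n)"
      using b(1) by (simp add: algebra_simps of_nat_diff flip: exp_add)
    finally show "p ^ L * exp (- \<epsilon> * real n) \<le> cmod (mult n c)" .
  qed
qed

end

section \<open>The Riemann sphere\<close>

definition hpt :: "complex \<Rightarrow> complex \<Rightarrow> sphere" where
  "hpt x y = (if y = 0 then None else Some (x / y))"

definition hom :: "nat \<Rightarrow> complex poly \<Rightarrow> complex \<Rightarrow> complex \<Rightarrow> complex" where
  "hom d p x y = (\<Sum>i\<le>d. coeff p i * x ^ i * y ^ (d - i))"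

text \<open>Two forms of common degree \<open>d\<close> without common zero treat infinity like any
  other point, and Moebius maps act on them linearly.\<close>

definition rational_rep :: "nat \<Rightarrow> complex poly \<Rightarrow> complex poly \<Rightarrow> (sphere \<Rightarrow> sphere) \<Rightarrow> bool" where
  "rational_rep d p q g \<longleftrightarrow> degree p \<le> d \<and> degree q \<le> d \<and>
     (\<forall>x y. x \<noteq> 0 \<or> y \<noteq> 0 \<longrightarrow>
        (hom d p x y \<noteq> 0 \<or> hom d q x y \<noteq> 0) \<and> g (hpt x y) = hpt (hom d p x y) (hom d q x y))"

lemma poly_sum_upto:
  fixes p :: "complex poly"
  assumes "degree p \<le> d"
  shows "poly p x = (\<Sum>i\<le>d. coeff p i * x ^ i)"
  unfolding poly_altdef
  by (rule sum.mono_neutral_left) (use assms in \<open>auto simp: coeff_eq_0\<close>)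

lemma hom_1: "degree p \<le> d \<Longrightarrow> hom d p x 1 = poly p x"
  by (simp add: hom_def poly_sum_upto)

lemma hom_0: "hom d p x 0 = coeff p d * x ^ d"
proof -
  have "hom d p x 0 = (\<Sum>i\<le>d. if i = d then coeff p i * x ^ i else 0)"
    unfolding hom_def by (rule sum.cong) auto
  then show ?thesis by simp
qed

lemma hom_eq_poly:
  assumes "degree p \<le> d" "y \<noteq> 0"
  shows "hom d p x y = y ^ d * poly p (x / y)"
  unfolding hom_def poly_sum_upto[OF assms(1)] sum_distrib_left
  by (rule sum.cong) (use assms(2) in \<open>auto simp: power_divide power_diff\<close>)

lemma hom_add: "hom d (p + q) x y = hom d p x y + hom d q x y"
  by (simp add: hom_def algebra_simps sum.distrib)

lemma hom_smult: "hom d (smult c p) x y = c * hom d p x y"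
  by (simp add: hom_def sum_distrib_left mult.assoc)

section \<open>The chordal metric and the spherical derivative\<close>

lemma chordal_Some_le: "chordal (Some z) (Some w) \<le> 2 * cmod (z - w)"
proof -
  have "1 \<le> sqrt ((1 + (cmod z)\<^sup>2) * (1 + (cmod w)\<^sup>2))"
    using mult_mono[of 1 "1 + (cmod z)\<^sup>2" 1 "1 + (cmod w)\<^sup>2"] by simp
  then have "2 * cmod (z - w) / sqrt ((1 + (cmod z)\<^sup>2) * (1 + (cmod w)\<^sup>2)) \<le> 2 * cmod (z - w) / 1"
    by (intro divide_left_mono) auto
  then show ?thesis by simp
qed

lemma chordal_near_finite:
  assumes "e > 0"
  obtains d where "d > 0" "\<And>w. chordal w (Some z) < d \<Longrightarrow> \<exists>w'. w = Some w' \<and> cmod (w' - z) < e"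
proof -
  define A where "A = sqrt (1 + (cmod z)\<^sup>2)"
  have A: "A > 0" by (simp add: A_def add_pos_nonneg)
  \<comment> \<open>The first bound excludes infinity, at chordal distance \<open>2 / A\<close>. The
    second is the value at \<open>s = e\<close> of \<open>2 * s / ((1 + cmod z + s) * A)\<close>,
    which increases with \<open>s\<close> and bounds the chordal distance of points at Euclidean
    distance \<open>s\<close> from below.\<close>
  define d where "d = min (2 / A) (2 * e / ((1 + cmod z + e) * A))"
  have d: "d > 0" using A assms by (simp add: d_def add_pos_nonneg)
  show thesis
  proof (rule that[OF d])
    fix w assume w: "chordal w (Some z) < d"
    show "\<exists>w'. w = Some w' \<and> cmod (w' - z) < e"
    proof (cases w)
      case None
      then show ?thesis using w by (simp add: d_def A_def)
    next
      case (Some w')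
      define s where "s = cmod (w' - z)"
      have "sqrt (1 + (cmod w')\<^sup>2) \<le> 1 + cmod w'"
        by (rule real_le_lsqrt) (auto simp: power2_eq_square algebra_simps)
      also have "\<dots> \<le> 1 + cmod z + s" using norm_triangle_ineq2[of w' z] by (simp add: s_def)
      finally have "sqrt (1 + (cmod w')\<^sup>2) * A \<le> (1 + cmod z + s) * A" using A by (intro mult_right_mono) auto
      moreover have "0 < sqrt (1 + (cmod w')\<^sup>2) * A" using A by (simp add: add_pos_nonneg)
      ultimately have "2 * s / ((1 + cmod z + s) * A) \<le> 2 * s / (sqrt (1 + (cmod w')\<^sup>2) * A)"
        using A by (intro divide_left_mono mult_pos_pos) (auto simp: s_def add_pos_nonneg)
      also have "\<dots> = chordal w (Some z)" by (simp add: Some s_def A_def real_sqrt_mult)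
      also have "\<dots> < 2 * e / ((1 + cmod z + e) * A)" using w by (simp add: d_def)
      finally have *: "2 * s / ((1 + cmod z + s) * A) < 2 * e / ((1 + cmod z + e) * A)" .
      have "s < e"
      proof (rule ccontr)
        assume "\<not> s < e"
        then have "e * (1 + cmod z + s) \<le> s * (1 + cmod z + e)"
          using mult_right_mono[of e s "1 + cmod z"] by (simp add: algebra_simps)
        then have "2 * e / ((1 + cmod z + e) * A) \<le> 2 * s / ((1 + cmod z + s) * A)"
          using A assms by (simp add: s_def divide_simps add_pos_nonneg)
        then show False using * by simp
      qed
      then show ?thesis using Some by (simp add: s_def)
    qed
  qed
qed

lemma has_sph_deriv_norm_unique:
  assumes "has_sph_deriv_norm f (Some z) L" "has_sph_deriv_norm f (Some z) L'"
  shows "L = L'"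
proof (rule ccontr)
  assume "L \<noteq> L'"
  then have e: "\<bar>L - L'\<bar> / 2 > 0" by simp
  obtain d where d: "d > 0" "\<And>w. w \<noteq> Some z \<Longrightarrow> chordal w (Some z) < d \<Longrightarrow>
        \<bar>chordal (f w) (f (Some z)) / chordal w (Some z) - L\<bar> < \<bar>L - L'\<bar> / 2"
    using assms(1)[unfolded has_sph_deriv_norm_def, rule_format, OF e] by blast
  obtain d' where d': "d' > 0" "\<And>w. w \<noteq> Some z \<Longrightarrow> chordal w (Some z) < d' \<Longrightarrow>
        \<bar>chordal (f w) (f (Some z)) / chordal w (Some z) - L'\<bar> < \<bar>L - L'\<bar> / 2"
    using assms(2)[unfolded has_sph_deriv_norm_def, rule_format, OF e] by blast
  define h where "h = min d d' / 4"
  have h: "h > 0" "2 * h < d" "2 * h < d'" using d d' by (auto simp: h_def)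
  define w where "w = Some (z + of_real h)"
  have "chordal w (Some z) \<le> 2 * h" using chordal_Some_le[of "z + of_real h" z] h by (simp add: w_def)
  moreover have "w \<noteq> Some z" using h by (simp add: w_def)
  ultimately have "\<bar>chordal (f w) (f (Some z)) / chordal w (Some z) - L\<bar> < \<bar>L - L'\<bar> / 2"
    "\<bar>chordal (f w) (f (Some z)) / chordal w (Some z) - L'\<bar> < \<bar>L - L'\<bar> / 2"
    using d(2)[of w] d'(2)[of w] h by auto
  then show False by (smt (verit) field_sum_of_halves)
qed

lemma sph_deriv_norm_eq:
  "has_sph_deriv_norm f (Some z) L \<Longrightarrow> sph_deriv_norm f (Some z) = L"
  unfolding sph_deriv_norm_def using has_sph_deriv_norm_unique by blast

lemma has_sph_deriv_norm_finite:
  assumes "open U" "z \<in> U" and f: "\<And>w. w \<in> U \<Longrightarrow> f (Some w) = Some (F w)"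
    and F: "(F has_field_derivative D) (at z)"
  shows "has_sph_deriv_norm f (Some z) (cmod D * (1 + (cmod z)\<^sup>2) / (1 + (cmod (F z))\<^sup>2))"
  unfolding has_sph_deriv_norm_def
proof (intro allI impI)
  fix e :: real assume "e > 0"
  define R where "R = (\<lambda>w. cmod ((F w - F z) / (w - z)) *
    (sqrt (1 + (cmod w)\<^sup>2) * sqrt (1 + (cmod z)\<^sup>2) / (sqrt (1 + (cmod (F w))\<^sup>2) * sqrt (1 + (cmod (F z))\<^sup>2))))"
  have nz: "sqrt (1 + (cmod v)\<^sup>2) \<noteq> 0" for v :: complex by (simp add: add_nonneg_eq_0_iff)
  have ratio: "chordal (f (Some w)) (f (Some z)) / chordal (Some w) (Some z) = R w" if "w \<in> U" "w \<noteq> z" for w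
    using that f[OF that(1)] f[OF assms(2)] by (simp add: R_def norm_divide real_sqrt_mult)
  have "(F \<longlongrightarrow> F z) (at z)" using DERIV_isCont[OF F] by (simp add: isCont_def)
  moreover have "((\<lambda>w. (F w - F z) / (w - z)) \<longlongrightarrow> D) (at z)" using F by (simp add: has_field_derivative_iff)
  ultimately have "(R \<longlongrightarrow> cmod D * (sqrt (1 + (cmod z)\<^sup>2) * sqrt (1 + (cmod z)\<^sup>2) /
      (sqrt (1 + (cmod (F z))\<^sup>2) * sqrt (1 + (cmod (F z))\<^sup>2)))) (at z)"
    unfolding R_def using nz by (intro tendsto_intros) auto
  then have "(R \<longlongrightarrow> cmod D * (1 + (cmod z)\<^sup>2) / (1 + (cmod (F z))\<^sup>2)) (at z)"
    by (simp add: add_pos_nonneg)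
  moreover have "\<forall>\<^sub>F w in at z. w \<in> U" using assms(1,2) by (rule eventually_at_in_open')
  ultimately have "\<forall>\<^sub>F w in at z. w \<in> U \<and> \<bar>R w - cmod D * (1 + (cmod z)\<^sup>2) / (1 + (cmod (F z))\<^sup>2)\<bar> < e"
    by (intro eventually_conj) (auto dest: tendstoD[OF _ \<open>e > 0\<close>] simp: dist_real_def)
  then obtain d0 where d0: "d0 > 0" "\<And>w. w \<noteq> z \<Longrightarrow> dist w z < d0 \<Longrightarrow>
      w \<in> U \<and> \<bar>R w - cmod D * (1 + (cmod z)\<^sup>2) / (1 + (cmod (F z))\<^sup>2)\<bar> < e"
    unfolding eventually_at by auto
  obtain d where d: "d > 0" "\<And>w. chordal w (Some z) < d \<Longrightarrow> \<exists>w'. w = Some w' \<and> cmod (w' - z) < d0"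
    by (rule chordal_near_finite[OF d0(1), of z]) blast
  show "\<exists>d>0. \<forall>w. w \<noteq> Some z \<and> chordal w (Some z) < d \<longrightarrow>
      \<bar>chordal (f w) (f (Some z)) / chordal w (Some z) - cmod D * (1 + (cmod z)\<^sup>2) / (1 + (cmod (F z))\<^sup>2)\<bar> < e"
  proof (intro exI[of _ d] conjI allI impI)
    fix w assume w: "w \<noteq> Some z \<and> chordal w (Some z) < d"
    then obtain w' where w': "w = Some w'" "cmod (w' - z) < d0" using d(2) by blast
    then have "w' \<noteq> z" using w by auto
    then have "w' \<in> U" "\<bar>R w' - cmod D * (1 + (cmod z)\<^sup>2) / (1 + (cmod (F z))\<^sup>2)\<bar> < e"
      using d0(2) w'(2) by (auto simp: dist_norm)
    then show "\<bar>chordal (f w) (f (Some z)) / chordal w (Some z) - cmod D * (1 + (cmod z)\<^sup>2) / (1 + (cmod (F z))\<^sup>2)\<bar> < e"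
      using ratio[OF _ \<open>w' \<noteq> z\<close>] w'(1) by simp
  qed (rule d(1))
qed

lemma subset_sph_closure: "S \<subseteq> sph_closure S"
proof
  fix x assume "x \<in> S"
  moreover have "chordal x x = 0" by (cases x) auto
  ultimately show "x \<in> sph_closure S" unfolding sph_closure_def by force
qed

lemma iterate_in_postorbit: "(g ^^ n) c \<in> postorbit g c"
  unfolding postorbit_def by (rule subsetD[OF subset_sph_closure]) auto

lemma Some_closure_in_sph_closure:
  assumes "z \<in> closure {w. Some w \<in> S}"
  shows "Some z \<in> sph_closure S"
  unfolding sph_closure_def
proof (intro CollectI allI impI)
  fix e :: real assume "e > 0"
  then obtain w where "Some w \<in> S" "dist w z < e / 2"
    using assms unfolding closure_approachable by (metis half_gt_zero mem_Collect_eq)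
  then show "\<exists>y\<in>S. chordal (Some z) y < e"
    using chordal_Some_le[of z w] by (intro bexI[of _ "Some w"]) (auto simp: dist_norm norm_minus_commute)
qed

lemma coprime_of_no_common_root:
  fixes p q :: "complex poly"
  assumes "q \<noteq> 0" "\<And>z. poly p z = 0 \<Longrightarrow> poly q z \<noteq> 0"
  shows "coprime p q"
proof (rule coprimeI)
  fix r assume r: "r dvd p" "r dvd q"
  then have "r \<noteq> 0" using assms(1) by auto
  have "degree r = 0"
  proof (rule ccontr)
    assume "degree r \<noteq> 0"
    then obtain z where "poly r z = 0" using alg_closed_imp_poly_has_root by blast
    then have "poly p z = 0" "poly q z = 0" using r by (auto elim!: dvdE)
    then show False using assms(2) by blast
  qed
  then show "is_unit r" using \<open>r \<noteq> 0\<close> by (simp add: is_unit_iff_degree)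
qed

section \<open>Rational maps\<close>

locale rational_sphere_map =
  fixes d :: nat and p q :: "complex poly" and g :: "sphere \<Rightarrow> sphere"
  assumes rep: "rational_rep d p q g" and d: "d \<ge> 1"
begin

definition Dom :: "complex set" where "Dom = {z. poly q z \<noteq> 0}"

definition G :: "complex \<Rightarrow> complex" where "G z = poly p z / poly q z"

text \<open>The Wronskian, the numerator of the derivative of \<open>p / q\<close>.\<close>

definition W :: "complex poly" where "W = pderiv p * q - p * pderiv q"

lemma deg: "degree p \<le> d" "degree q \<le> d"
  using rep by (auto simp: rational_rep_def)

lemma hom_nonzero: "x \<noteq> 0 \<or> y \<noteq> 0 \<Longrightarrow> hom d p x y \<noteq> 0 \<or> hom d q x y \<noteq> 0"
  and g_hpt: "x \<noteq> 0 \<or> y \<noteq> 0 \<Longrightarrow> g (hpt x y) = hpt (hom d p x y) (hom d q x y)"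
  using rep unfolding rational_rep_def by blast+

lemma no_common_root: "poly p z = 0 \<Longrightarrow> poly q z \<noteq> 0"
  using hom_nonzero[of z 1] by (simp add: hom_1 deg)

lemma top_coeff: "coeff p d \<noteq> 0 \<or> coeff q d \<noteq> 0"
  using hom_nonzero[of 1 0] by (simp add: hom_0)

lemma degree_eq_of_coeff: "degree r \<le> d \<Longrightarrow> coeff r d \<noteq> 0 \<Longrightarrow> degree r = d"
  using le_degree le_antisym by blast

lemma has_root_of_coeff: "degree r \<le> d \<Longrightarrow> coeff r d \<noteq> 0 \<Longrightarrow> \<exists>z :: complex. poly r z = 0"
  using alg_closed_imp_poly_has_root[of r] degree_eq_of_coeff[of r] d by simp

lemma q_nonzero: "q \<noteq> 0"
proof
  assume "q = 0"
  then obtain z where "poly p z = 0" using top_coeff has_root_of_coeff[OF deg(1)] by auto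
  then show False using no_common_root \<open>q = 0\<close> by force
qed

lemma fiber_poly_nonzero: "p - smult w q \<noteq> 0"
proof
  assume "p - smult w q = 0"
  then have pq: "p = smult w q" by simp
  then have "coeff q d \<noteq> 0" using top_coeff by auto
  then obtain z where "poly q z = 0" using has_root_of_coeff[OF deg(2)] by auto
  then show False using no_common_root[of z] pq by simp
qed

lemma coprime_pq: "coprime p q"
  by (rule coprime_of_no_common_root[OF q_nonzero no_common_root])

text \<open>If \<open>W\<close> vanished, coprimality would make \<open>p\<close> and
  \<open>q\<close> divide their own derivatives; in characteristic 0 both would be constant, against
  \<open>d \<ge> 1\<close>.\<close>

lemma W_nonzero: "W \<noteq> 0"
proof
  assume "W = 0"
  then have eq: "pderiv p * q = p * pderiv q" by (simp add: W_def)
  then have "p dvd pderiv p * q" "q dvd pderiv q * p" by (metis dvd_triv_left dvd_triv_right mult.commute)+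
  then have "p dvd pderiv p" "q dvd pderiv q"
    using coprime_dvd_mult_left_iff[OF coprime_pq] coprime_dvd_mult_left_iff[of q p]
      coprime_pq by (auto simp: coprime_commute)
  then have "degree p = 0" "degree q = 0"
    using not_dvd_pderiv by blast+
  then show False using top_coeff d coeff_eq_0 by (metis less_le_trans zero_less_one)
qed

lemma fiber_finite: "finite (Dom \<inter> G -` {w})"
proof (rule finite_subset)
  show "Dom \<inter> G -` {w} \<subseteq> {z. poly (p - smult w q) z = 0}"
    by (auto simp: Dom_def G_def field_simps)
  show "finite {z. poly (p - smult w q) z = 0}"
    using fiber_poly_nonzero by (rule poly_roots_finite)
qed

lemma g_Some: "g (Some z) = (if z \<in> Dom then Some (G z) else None)"
  using g_hpt[of z 1] by (simp add: hpt_def hom_1 deg Dom_def G_def)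

lemma g_None: "g None = hpt (coeff p d) (coeff q d)"
  using g_hpt[of 1 0] by (simp add: hpt_def hom_0)

lemma G_has_derivative: "z \<in> Dom \<Longrightarrow> (G has_field_derivative poly W z / (poly q z)\<^sup>2) (at z)"
  unfolding G_def[abs_def] Dom_def W_def
  by (auto intro!: derivative_eq_intros simp: power2_eq_square)

lemma open_Dom: "open Dom"
  unfolding Dom_def by (intro open_Collect_neq continuous_intros)

sublocale holomorphic_dynamics G Dom
proof
  show "G holomorphic_on Dom"
    using G_has_derivative by (auto simp: holomorphic_on_open[OF open_Dom])
qed (rule open_Dom)

lemma deriv_G: "z \<in> Dom \<Longrightarrow> deriv G z = poly W z / (poly q z)\<^sup>2"
  using G_has_derivative by (rule DERIV_imp_deriv)

lemma deriv_G_eq_0: "z \<in> Dom \<Longrightarrow> deriv G z = 0 \<longleftrightarrow> poly W z = 0"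
  by (simp add: deriv_G Dom_def)

lemma g_iter: "z \<in> dom_iter n \<Longrightarrow> (g ^^ n) (Some z) = Some ((G ^^ n) z)"
  by (induction n) (auto simp: dom_iter_Suc g_Some)

lemma in_dom_iter: "(\<And>n. (g ^^ n) (Some z) \<noteq> None) \<Longrightarrow> z \<in> dom_iter n"
proof (induction n)
  case (Suc n)
  then have "z \<in> dom_iter n" by blast
  moreover have "(G ^^ n) z \<in> Dom"
    using Suc.prems[of "Suc n"] g_iter[OF \<open>z \<in> dom_iter n\<close>] by (simp add: g_Some split: if_splits)
  ultimately show ?case by (simp add: dom_iter_Suc)
qed simp

lemma sph_deriv_norm_iter:
  assumes "z \<in> dom_iter n"
  shows "sph_deriv_norm (g ^^ n) (Some z) = cmod (mult n z) * (1 + (cmod z)\<^sup>2) / (1 + (cmod ((G ^^ n) z))\<^sup>2)"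
  by (rule sph_deriv_norm_eq, rule has_sph_deriv_norm_finite[OF open_dom_iter assms g_iter has_field_derivative_iter[OF assms]])

lemma critical_point_finite: "z \<in> Dom \<Longrightarrow> critical_point g (Some z) \<longleftrightarrow> poly W z = 0"
proof -
  assume z: "z \<in> Dom"
  then have "z \<in> dom_iter 1" by (simp add: dom_iter_def)
  from sph_deriv_norm_iter[OF this] show ?thesis
    using deriv_G_eq_0[OF z] by (simp add: critical_point_def mult_def add_nonneg_eq_0_iff)
qed

text \<open>Critical points at infinity and at poles call for no analysis, as they contribute only
  the values \<open>g None\<close> and \<open>None\<close>.\<close>

lemma finite_critical_values: "finite {v. critical_value g v}"
proof (rule finite_subset)
  show "{v. critical_value g v} \<subseteq> insert (g None) (insert None (g ` Some ` {z. poly W z = 0}))"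
  proof
    fix v assume "v \<in> {v. critical_value g v}"
    then obtain y where y: "critical_point g y" "g y = v" by (auto simp: critical_value_def)
    show "v \<in> insert (g None) (insert None (g ` Some ` {z. poly W z = 0}))"
    proof (cases y)
      case (Some z)
      show ?thesis
      proof (cases "z \<in> Dom")
        case True
        then have "poly W z = 0" using y(1) critical_point_finite Some by simp
        then show ?thesis using y(2) Some by blast
      qed (use y(2) Some in \<open>simp add: g_Some\<close>)
    qed (use y(2) in simp)
  qed
  show "finite (insert (g None) (insert None (g ` Some ` {z. poly W z = 0})))"
    using poly_roots_finite[OF W_nonzero] by simp
qed

text \<open>With \<open>P = p - smult w q\<close>, the distance from \<open>G z\<close> to
  \<open>w\<close> is the modulus of \<open>P / q\<close>, so the point is to bound
  \<open>q / P\<close> off \<open>U\<close>. As infinity is not mapped to \<open>w\<close>,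
  \<open>P\<close> has full degree \<open>d\<close> and the quotient is bounded near infinity; the
  rest is compact and contains no zero of \<open>P\<close>.\<close>

lemma fiber_proper:
  assumes w: "g None \<noteq> Some w" and U: "open U" "Dom \<inter> G -` {w} \<subseteq> U"
  obtains r where "r > 0" "\<And>z. z \<in> Dom \<Longrightarrow> dist (G z) w < r \<Longrightarrow> z \<in> U"
proof -
  define P where "P = p - smult w q"
  have Pd: "coeff P d \<noteq> 0"
  proof
    assume "coeff P d = 0"
    then have "coeff p d = w * coeff q d" by (simp add: P_def)
    then show False using top_coeff w by (auto simp: g_None hpt_def)
  qed
  have degP: "degree P = d"
    using deg by (intro degree_eq_of_coeff Pd) (auto simp: P_def intro!: degree_diff_le)
  \<comment> \<open>The limit of \<open>q / P\<close> at infinity; subtracting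
    \<open>smult k P\<close> brings the degree of the numerator below \<open>d\<close>.\<close>
  define k where "k = coeff q d / coeff P d"
  have "degree (q - smult k P) < d"
  proof (rule ccontr)
    assume "\<not> degree (q - smult k P) < d"
    moreover have "degree (q - smult k P) \<le> d" using deg degP by (intro degree_diff_le) auto
    ultimately have "degree (q - smult k P) = d" by simp
    moreover have "coeff (q - smult k P) d = 0" using Pd by (simp add: k_def)
    ultimately show False using d by (metis degree_0 leading_coeff_0_iff not_one_le_zero)
  qed
  then have "((\<lambda>z. poly (q - smult k P) z / poly P z) \<longlongrightarrow> 0) at_infinity"
    using degP by (intro poly_divide_tendsto_0_at_infinity) simp
  then have "\<forall>\<^sub>F z in at_infinity. cmod (poly (q - smult k P) z / poly P z) < 1"
    by (auto dest: tendstoD[where e = 1])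
  then obtain R where R: "\<And>z. R \<le> cmod z \<Longrightarrow> cmod (poly (q - smult k P) z / poly P z) < 1"
    unfolding eventually_at_infinity by blast
  define B where "B = cmod k + 1"
  have B: "B > 0" by (simp add: B_def add_nonneg_pos)
  have dist_eq: "dist (G z) w = cmod (poly P z) / cmod (poly q z)" if "z \<in> Dom" for z
  proof -
    have "G z - w = poly P z / poly q z" using that by (simp add: G_def P_def Dom_def field_simps)
    then show ?thesis by (simp add: dist_norm norm_divide)
  qed
  have far: "1 / B \<le> dist (G z) w" if "R \<le> cmod z" "z \<in> Dom" "G z \<noteq> w" for z
  proof -
    have Pz: "poly P z \<noteq> 0" using that by (auto simp: P_def G_def Dom_def field_simps)
    have "cmod (poly q z / poly P z) = cmod (poly (q - smult k P) z / poly P z + k)"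
      using Pz by (simp add: field_simps)
    also have "\<dots> \<le> B" using R[OF that(1)] norm_triangle_ineq[of "poly (q - smult k P) z / poly P z" k] by (simp add: B_def)
    finally show ?thesis using Pz that B by (simp add: dist_eq norm_divide divide_simps Dom_def mult.commute)
  qed
  define S where "S = cball 0 R - U"
  have S: "compact S" unfolding S_def using U(1) by (intro compact_diff compact_cball)
  have PS: "poly P z \<noteq> 0" if "z \<in> S" for z
  proof
    assume "poly P z = 0"
    then have pz: "poly p z = w * poly q z" by (simp add: P_def)
    then have "z \<in> Dom" using no_common_root[of z] by (auto simp: Dom_def)
    then have "G z = w" using pz by (simp add: G_def Dom_def)
    then show False using \<open>z \<in> Dom\<close> U(2) that by (auto simp: S_def)
  qed
  have "continuous_on S (\<lambda>z. poly q z / poly P z)"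
    using PS by (intro continuous_intros) auto
  from compact_imp_bounded[OF compact_continuous_image[OF this S]]
  obtain B' where B': "B' > 0" "\<And>z. z \<in> S \<Longrightarrow> cmod (poly q z / poly P z) \<le> B'"
    unfolding bounded_pos by auto
  have near: "1 / B' \<le> dist (G z) w" if "z \<in> S" "z \<in> Dom" for z
    using B'(2)[OF that(1)] PS[OF that(1)] that(2) B'(1)
    by (simp add: dist_eq norm_divide divide_simps Dom_def mult.commute)
  show thesis
  proof (rule that[of "min (1 / B) (1 / B')"])
    show "min (1 / B) (1 / B') > 0" using B B'(1) by simp
    fix z assume z: "z \<in> Dom" "dist (G z) w < min (1 / B) (1 / B')"
    show "z \<in> U"
    proof (rule ccontr)
      assume "z \<notin> U"
      then have "G z \<noteq> w" using U(2) z(1) by auto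
      then have "\<not> R \<le> cmod z" using far[OF _ z(1)] z(2) by fastforce
      then have "z \<in> S" using \<open>z \<notin> U\<close> by (simp add: S_def)
      then show False using near[OF _ z(1)] z(2) by fastforce
    qed
  qed
qed

text \<open>\<open>F\<close> has to contain the critical values, where sheets merge, and the image
  of infinity, near which preimages escape from the plane.\<close>

lemma covering_space_G:
  assumes F: "closed F" and crit: "\<And>z. z \<in> Dom \<Longrightarrow> poly W z = 0 \<Longrightarrow> G z \<in> F"
    and inf: "\<And>w. g None = Some w \<Longrightarrow> w \<in> F"
  shows "covering_space (Dom \<inter> G -` (- F)) G (- F)"
proof (rule covering_space_of_proper_holomorphic)
  show "open (Dom \<inter> G -` (- F))"
    using F by (intro continuous_open_preimage holomorphic_on_imp_continuous_on hol_G open_Dom) auto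
  show "G holomorphic_on Dom \<inter> G -` (- F)" using hol_G by (rule holomorphic_on_subset) auto
  show "deriv G z \<noteq> 0" if "z \<in> Dom \<inter> G -` (- F)" for z
    using that crit[of z] deriv_G_eq_0[of z] by auto
  show "finite (Dom \<inter> G -` (- F) \<inter> G -` {w})" for w
    by (rule finite_subset[OF _ fiber_finite[of w]]) auto
  show "G ` (Dom \<inter> G -` (- F)) = - F"
  proof
    show "- F \<subseteq> G ` (Dom \<inter> G -` (- F))"
    proof
      fix w assume w: "w \<in> - F"
      then have "coeff (p - smult w q) d \<noteq> 0"
        using inf[of w] top_coeff by (auto simp: g_None hpt_def)
      then obtain z where "poly (p - smult w q) z = 0"
        using has_root_of_coeff[OF degree_diff_le[OF deg(1) order_trans[OF degree_smult_le deg(2)]]] by blast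
      then have pz: "poly p z = w * poly q z" by simp
      then have "z \<in> Dom" using no_common_root[of z] by (auto simp: Dom_def)
      then have "G z = w" using pz by (simp add: G_def Dom_def)
      then show "w \<in> G ` (Dom \<inter> G -` (- F))" using \<open>z \<in> Dom\<close> w by auto
    qed
  qed auto
  fix w U assume w: "w \<in> - F" and U: "open U" "Dom \<inter> G -` (- F) \<inter> G -` {w} \<subseteq> U"
  have "Dom \<inter> G -` {w} \<subseteq> U" using U(2) w by auto
  then show "\<exists>r>0. \<forall>z\<in>Dom \<inter> G -` (- F). dist (G z) w < r \<longrightarrow> z \<in> U"
    using fiber_proper[of w U] inf[of w] w U(1) by (metis ComplD IntD1)
qed

text \<open>The limit of the orbit along multiples of \<open>k\<close> is in general another point of the cycle of the
  fixed point found in the disc, since \<open>a\<close> need not be a multiple of \<open>k\<close>.\<close>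

lemma in_attracting_basin_of_contraction:
  assumes orb: "\<And>n. c \<in> dom_iter n" and k: "0 < k" and \<rho>: "0 < \<rho>"
    and sub: "ball ((G ^^ a) c) (8 * \<rho>) \<subseteq> dom_iter k"
    and into: "(G ^^ k) ` ball ((G ^^ a) c) (8 * \<rho>) \<subseteq> ball ((G ^^ a) c) \<rho>"
  shows "in_attracting_basin g (Some c)"
proof -
  define x where "x = (G ^^ a) c"
  define F where "F = G ^^ k"
  have holF: "F holomorphic_on ball x (8 * \<rho>)"
    unfolding F_def x_def by (rule holomorphic_on_subset[OF holomorphic_iter sub])
  have Fx: "cmod (F z - x) \<le> \<rho>" if "z \<in> ball x (8 * \<rho>)" for z
    using into that unfolding F_def x_def by (fastforce simp: dist_norm norm_minus_commute)
  \<comment> \<open>Discs of radius \<open>5 * \<rho>\<close> about points of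
    \<open>cball x \<rho>\<close> lie in the disc of radius \<open>8 * \<rho>\<close>, so the Cauchy
    estimate yields a contraction by \<open>1/5\<close>.\<close>
  have dF: "cmod (deriv F z) \<le> 1 / 5" if z: "z \<in> cball x \<rho>" for z
  proof -
    have cb: "cball z (5 * \<rho>) \<subseteq> ball x (8 * \<rho>)"
    proof
      fix y assume "y \<in> cball z (5 * \<rho>)"
      then show "y \<in> ball x (8 * \<rho>)" using z \<rho> dist_triangle[of x y z] by simp
    qed
    have "cmod ((deriv ^^ 1) (\<lambda>y. F y - x) z) \<le> fact 1 * \<rho> / (5 * \<rho>) ^ 1"
    proof (rule Cauchy_inequality)
      show "(\<lambda>y. F y - x) holomorphic_on ball z (5 * \<rho>)"
        using cb ball_subset_cball by (intro holomorphic_intros holomorphic_on_subset[OF holF]) blast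
      show "continuous_on (cball z (5 * \<rho>)) (\<lambda>y. F y - x)"
        by (intro holomorphic_on_imp_continuous_on holomorphic_intros holomorphic_on_subset[OF holF] cb)
      show "cmod (F y - x) \<le> \<rho>" if "cmod (z - y) = 5 * \<rho>" for y
        by (rule Fx, rule subsetD[OF cb]) (use that in \<open>simp add: dist_norm\<close>)
    qed (use \<rho> in auto)
    moreover have "deriv (\<lambda>y. F y - x) z = deriv F z"
      using holomorphic_on_imp_differentiable_at[OF holF, of z] z \<rho> by (subst deriv_diff) auto
    ultimately show ?thesis using \<rho> by simp
  qed
  have sub8: "cball x \<rho> \<subseteq> ball x (8 * \<rho>)" using \<rho> by auto
  have lip: "dist (F y) (F z) \<le> 1 / 5 * dist y z" if "y \<in> cball x \<rho>" "z \<in> cball x \<rho>" for y z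
    unfolding dist_norm
  proof (rule field_differentiable_bound[of "cball x \<rho>" F "deriv F"])
    show "(F has_field_derivative deriv F u) (at u within cball x \<rho>)" if "u \<in> cball x \<rho>" for u
      using holomorphic_derivI[OF holF open_ball] sub8 that by blast
  qed (use that dF in auto)
  have FS: "F ` cball x \<rho> \<subseteq> cball x \<rho>"
  proof
    fix y assume "y \<in> F ` cball x \<rho>"
    then obtain z where "z \<in> cball x \<rho>" "y = F z" by auto
    then show "y \<in> cball x \<rho>" using Fx[of z] sub8 by (auto simp: dist_norm norm_minus_commute)
  qed
  have "\<exists>!z\<in>cball x \<rho>. F z = z"
    by (rule Banach_fix[of _ "1/5", OF _ _ _ _ FS lip])
       (use \<rho> in \<open>auto simp: complete_eq_closed\<close>)
  then obtain z where z: "z \<in> cball x \<rho>" "F z = z" by blast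
  have z_dom: "z \<in> dom_iter n" for n
  proof (induction n rule: less_induct)
    case (less n)
    have zk: "z \<in> dom_iter k" using z(1) sub8 sub by (auto simp: x_def)
    show ?case
    proof (cases "n \<le> k")
      case True
      then show ?thesis using zk by (auto simp: dom_iter_def)
    next
      case False
      then have "z \<in> dom_iter (n - k)" using less k by simp
      have "(G ^^ i) z \<in> Dom" if "i < n" for i
      proof (cases "i < k")
        case False
        then have "(G ^^ i) z = (G ^^ (i - k)) z"
          using iter_add[of k "i - k" z] z(2) by (simp add: F_def)
        then show ?thesis using \<open>z \<in> dom_iter (n - k)\<close> that False by (simp add: dom_iter_def)
      qed (use zk in \<open>simp add: dom_iter_def\<close>)
      then show ?thesis by (simp add: dom_iter_def)
    qed
  qed
  have conv: "(F ^^ n) x \<in> cball x \<rho> \<and> dist ((F ^^ n) x) z \<le> (1/5) ^ n * dist x z" for n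
  proof (induction n)
    case (Suc n)
    have "dist ((F ^^ Suc n) x) z \<le> 1/5 * dist ((F ^^ n) x) z"
      using lip[of "(F ^^ n) x" z] Suc z by simp
    moreover have "F ((F ^^ n) x) \<in> cball x \<rho>" using Suc FS by blast
    ultimately show ?case using Suc by simp
  qed (use \<rho> in auto)
  have lim: "(\<lambda>n. (F ^^ n) x) \<longlonglongrightarrow> z"
  proof (rule metric_tendsto_imp_tendsto)
    show "(\<lambda>n. (1/5) ^ n * dist x z) \<longlonglongrightarrow> 0"
      by (intro tendsto_mult_left_zero LIMSEQ_realpow_zero) auto
    show "\<forall>\<^sub>F n in sequentially. dist ((F ^^ n) x) z \<le> dist ((1/5) ^ n * dist x z) 0"
      using conv by simp
  qed
  \<comment> \<open>\<open>a + b\<close> is a multiple of \<open>k\<close>, so \<open>G ^^ b\<close>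
    carries the times \<open>a + n * k\<close> to multiples of \<open>k\<close>.\<close>
  define b where "b = a * (k - 1)"
  have ab: "a + b = a * k" using k by (cases k) (auto simp: b_def)
  define z' where "z' = (G ^^ b) z"
  have "isCont (G ^^ b) z" by (rule isCont_iter[OF z_dom])
  from isCont_tendsto_compose[OF this lim]
  have "(\<lambda>n. (G ^^ b) ((F ^^ n) x)) \<longlonglongrightarrow> z'" by (simp add: z'_def)
  moreover have "(G ^^ b) ((F ^^ n) x) = (G ^^ ((n + a) * k)) c" for n
  proof -
    have "(F ^^ n) x = (G ^^ (a + n * k)) c"
      by (simp add: F_def x_def iter_add funpow_mult mult.commute)
    then have "(G ^^ b) ((F ^^ n) x) = (G ^^ (a + n * k + b)) c" by (simp add: iter_add)
    moreover have "a + n * k + b = (n + a) * k" using ab by (simp add: distrib_right)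
    ultimately show ?thesis by (simp only:)
  qed
  ultimately have "(\<lambda>n. (G ^^ ((n + a) * k)) c) \<longlonglongrightarrow> z'" by simp
  then have "(\<lambda>n. (G ^^ (n * k)) c) \<longlonglongrightarrow> z'"
    using LIMSEQ_offset[of "\<lambda>n. (G ^^ (n * k)) c" a z'] by simp
  then have "(\<lambda>n. 2 * cmod ((G ^^ (n * k)) c - z')) \<longlonglongrightarrow> 0"
    by (intro tendsto_mult_right_zero tendsto_norm_zero) (simp add: LIM_zero_iff)
  then have lim': "(\<lambda>n. chordal ((g ^^ (n * k)) (Some c)) (Some z')) \<longlonglongrightarrow> 0"
  proof (rule tendsto_0_le[where K = 1], intro always_eventually allI)
    fix n
    show "norm (chordal ((g ^^ (n * k)) (Some c)) (Some z')) \<le> norm (2 * cmod ((G ^^ (n * k)) c - z')) * 1"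
      using chordal_Some_le[of "(G ^^ (n * k)) c" z'] g_iter[OF orb] by simp
  qed
  have per: "(G ^^ (i + k)) z = (G ^^ i) z" for i
    using iter_add[of k i z] z(2) by (simp add: F_def add.commute)
  have z'_dom: "z' \<in> dom_iter n" for n
    using z_dom[of "b + n"] by (auto simp: dom_iter_def z'_def simp flip: iter_add)
  have z'_fix: "(G ^^ k) z' = z'"
    using per[of b] iter_add[of b k z] by (simp add: z'_def)
  \<comment> \<open>The multiplier is constant along the cycle, as the products differ by a cyclic
    shift. Cancelling \<open>h 0\<close> fails if it is 0, but then both products vanish.\<close>
  have "mult k ((G ^^ j) z) = mult k z" for j
  proof (induction j)
    case (Suc j)
    define h where "h = (\<lambda>i. deriv G ((G ^^ (j + i)) z))"
    have "prod h {..<Suc k} = h 0 * (\<Prod>i<k. h (Suc i))" by (rule prod.lessThan_Suc_shift)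
    moreover have "prod h {..<Suc k} = prod h {..<k} * h k" by simp
    moreover have "h k = h 0" using per[of j] by (simp add: h_def)
    moreover have "prod h {..<k} = mult k ((G ^^ j) z)"
      by (simp add: mult_def h_def iter_add)
    moreover have "(\<Prod>i<k. h (Suc i)) = mult k ((G ^^ Suc j) z)"
      by (simp add: mult_def h_def iter_add funpow_swap1)
    moreover have "h 0 = 0 \<Longrightarrow> prod h {..<k} = 0" using k by auto
    moreover have "h k = 0 \<Longrightarrow> (\<Prod>i<k. h (Suc i)) = 0" using k by (intro prod_zero) (auto intro!: bexI[of _ "k - 1"])
    ultimately have "mult k ((G ^^ Suc j) z) = mult k ((G ^^ j) z)"
      by (cases "h 0 = 0") auto
    then show ?case using Suc by simp
  qed simp
  then have "mult k z' = mult k z" by (simp add: z'_def)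
  also have "\<dots> = deriv F z" using deriv_iter[OF z_dom] by (simp add: F_def)
  finally have "cmod (mult k z') < 1" using dF[OF z(1)] by simp
  then have "sph_deriv_norm (g ^^ k) (Some z') < 1"
    unfolding sph_deriv_norm_iter[OF z'_dom] z'_fix by (simp add: add_pos_nonneg)
  then have "attracting_periodic g (Some z') k"
    using k g_iter[OF z'_dom, of k] by (simp add: attracting_periodic_def z'_fix)
  then show ?thesis using lim' unfolding in_attracting_basin_def by blast
qed

lemma deriv_norm_lower_bound:
  assumes inf: "critical_value g None" and nb: "\<not> in_attracting_basin g (Some c)"
    and disj: "\<And>v. critical_value g v \<Longrightarrow> v \<noteq> Some c \<Longrightarrow> postorbit g (Some c) \<inter> postorbit g v = {}"
    and \<epsilon>: "\<epsilon> > 0"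
  obtains C where "C > 0" "\<And>n. C * exp (- \<epsilon> * real n) \<le> sph_deriv_norm (g ^^ n) (Some c)"
proof -
  define Y where "Y = range (\<lambda>i. (G ^^ i) c)"
  have None_far: "None \<notin> postorbit g (Some c)"
    using disj[OF inf] iterate_in_postorbit[of 0 g None] by auto
  have "(g ^^ n) (Some c) \<noteq> None" for n
    using None_far iterate_in_postorbit[of n g "Some c"] by metis
  then have c_dom: "c \<in> dom_iter n" for n by (rule in_dom_iter)
  have orbit: "(g ^^ n) (Some c) = Some ((G ^^ n) c)" for n by (rule g_iter[OF c_dom])
  have Y_Some: "Y \<subseteq> {w. Some w \<in> {(g ^^ n) (Some c) |n. True}}"
    unfolding Y_def using orbit by force
  have K_post: "Some z \<in> postorbit g (Some c)" if "z \<in> closure Y" for z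
    unfolding postorbit_def using that closure_mono[OF Y_Some] by (intro Some_closure_in_sph_closure) blast
  obtain R where R: "R > 0" "\<And>n. cmod ((G ^^ n) c) \<le> R"
  proof -
    obtain e where e: "e > 0" "\<And>n. e \<le> chordal None ((g ^^ n) (Some c))"
      using None_far unfolding postorbit_def sph_closure_def by (force simp: not_less)
    have "cmod ((G ^^ n) c) \<le> 2 / e" for n
    proof -
      have "e * sqrt (1 + (cmod ((G ^^ n) c))\<^sup>2) \<le> 2"
        using e(2)[of n] by (simp add: orbit pos_le_divide_eq add_pos_nonneg)
      moreover have "cmod ((G ^^ n) c) \<le> sqrt (1 + (cmod ((G ^^ n) c))\<^sup>2)"
        by (rule real_le_rsqrt) simp
      ultimately have "e * cmod ((G ^^ n) c) \<le> 2" using e(1) by (meson mult_left_mono less_imp_le order_trans)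
      then show ?thesis using e(1) by (simp add: pos_le_divide_eq mult.commute)
    qed
    then show ?thesis using that[of "2 / e"] e(1) by simp
  qed
  have K: "compact (closure Y)"
    unfolding compact_closure bounded_iff using R(2) by (auto simp: Y_def)
  have K_Dom: "closure Y \<subseteq> Dom"
  proof
    fix z assume z: "z \<in> closure Y"
    \<comment> \<open>The bound \<open>cmod (G y) \<le> R\<close> on the orbit is written without
      division so that it passes to the closure, where a pole would be a common zero of
      \<open>p\<close> and \<open>q\<close>.\<close>
    have "closed {z. cmod (poly p z) \<le> R * cmod (poly q z)}"
      by (intro closed_Collect_le continuous_intros)
    moreover have "Y \<subseteq> {z. cmod (poly p z) \<le> R * cmod (poly q z)}"
    proof
      fix y assume "y \<in> Y"
      then obtain i where i: "y = (G ^^ i) c" by (auto simp: Y_def)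
      have "y \<in> Dom" using c_dom[of "Suc i"] by (simp add: i dom_iter_Suc)
      moreover have "cmod (G y) \<le> R" using R(2)[of "Suc i"] by (simp add: i)
      ultimately show "y \<in> {z. cmod (poly p z) \<le> R * cmod (poly q z)}"
        by (simp add: G_def Dom_def norm_divide divide_le_eq)
    qed
    ultimately have "closure Y \<subseteq> {z. cmod (poly p z) \<le> R * cmod (poly q z)}" by (intro closure_minimal)
    then show "z \<in> Dom" using z no_common_root[of z] by (auto simp: Dom_def)
  qed
  have crit_val: "critical_value g (Some (G z))" if "z \<in> Dom" "poly W z = 0" for z
    using that critical_point_finite[of z] unfolding critical_value_def by (intro exI[of _ "Some z"]) (auto simp: g_Some)
  have G_K: "G z \<in> closure Y" if "z \<in> closure Y" for z
  proof -
    have "G ` closure Y \<subseteq> closure (G ` Y)"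
      by (intro image_closure_subset closure_subset closed_closure continuous_on_subset[OF holomorphic_on_imp_continuous_on[OF hol_G] K_Dom])
    moreover have "G ((G ^^ i) c) \<in> Y" for i unfolding Y_def by (rule range_eqI[of _ _ "Suc i"]) simp
    then have "G ` Y \<subseteq> Y" by (auto simp: Y_def)
    ultimately show ?thesis using that closure_mono by blast
  qed
  define V where "V = {v. critical_value g v \<and> v \<noteq> Some c}"
  have finV: "finite V" unfolding V_def by (rule finite_subset[OF _ finite_critical_values]) auto
  have "\<exists>s>0. \<forall>k y. (g ^^ k) v = Some y \<longrightarrow> (\<forall>x\<in>closure Y. s \<le> dist x y)" if v: "v \<in> V" for v
  proof -
    define Z where "Z = {w. Some w \<in> {(g ^^ n) v |n. True}}"
    have "Some z \<in> postorbit g v" if "z \<in> closure Z" for z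
      using that unfolding Z_def postorbit_def by (rule Some_closure_in_sph_closure)
    then have "closure Y \<inter> closure Z = {}" using K_post disj v unfolding V_def by blast
    then obtain s where "s > 0" "\<forall>x\<in>closure Y. \<forall>y\<in>closure Z. s \<le> dist x y"
      using separate_compact_closed[OF K closed_closure] by blast
    moreover have "y \<in> closure Z" if "(g ^^ k) v = Some y" for k y
    proof (rule subsetD[OF closure_subset])
      show "y \<in> Z" unfolding Z_def using that by (auto intro!: exI[of _ k])
    qed
    ultimately show ?thesis by blast
  qed
  then obtain s where s: "\<And>v. v \<in> V \<Longrightarrow> s v > 0"
      "\<And>v k y x. v \<in> V \<Longrightarrow> (g ^^ k) v = Some y \<Longrightarrow> x \<in> closure Y \<Longrightarrow> s v \<le> dist x y"
    by metis
  define \<sigma> where "\<sigma> = Min (insert 1 (s ` V))"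
  have \<sigma>: "\<sigma> > 0" using finV s(1) by (auto simp: \<sigma>_def)
  have sep: "\<sigma> \<le> dist x y" if "critical_value g v" "v \<noteq> Some c" "(g ^^ k) v = Some y" "x \<in> closure Y" for v k x y
  proof -
    have v: "v \<in> V" using that by (simp add: V_def)
    then have "\<sigma> \<le> s v" unfolding \<sigma>_def using finV by (intro Min_le) auto
    then show ?thesis using s(2)[OF v that(3,4)] by simp
  qed
  have orbK: "(G ^^ n) c \<in> closure Y" for n
    by (rule subsetD[OF closure_subset]) (simp add: Y_def)
  have "\<exists>C>0. \<forall>n. C * exp (- \<epsilon> * real n) \<le> cmod (mult n c)"
  proof (cases "\<exists>k>0. (G ^^ k) c = c")
    \<comment> \<open>If \<open>c\<close> is periodic with multiplier of modulus below 1, its own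
      cycle attracts it. Otherwise a full period never decreases the derivative, and the minimum
      over one period is a lower bound throughout.\<close>
    case True
    then obtain k where k: "k > 0" "(G ^^ k) c = c" by blast
    have "\<not> cmod (mult k c) < 1"
    proof
      assume "cmod (mult k c) < 1"
      then have "attracting_periodic g (Some c) k"
        using k orbit[of k] sph_deriv_norm_iter[OF c_dom, of k] by (simp add: attracting_periodic_def add_pos_nonneg)
      moreover have "(g ^^ (n * k)) (Some c) = Some c" for n
        using orbit[of k] k(2) by (induction n) (auto simp: funpow_add)
      ultimately have "in_attracting_basin g (Some c)"
        unfolding in_attracting_basin_def by (intro exI[of _ "Some c"] exI[of _ k]) simp
      then show False using nb by simp
    qed
    then have m1: "1 \<le> cmod (mult k c)" by simp
    have nz: "mult n c \<noteq> 0" if "n \<le> k" for n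
    proof
      assume "mult n c = 0"
      then have "mult k c = 0" using mult_add[of n "k - n" c] that by simp
      then show False using m1 by simp
    qed
    define C where "C = Min ((\<lambda>n. cmod (mult n c)) ` {..k})"
    have C: "C > 0" unfolding C_def using nz by auto
    have low: "C \<le> cmod (mult n c)" for n
    proof (induction n rule: less_induct)
      case (less n)
      show ?case
      proof (cases "n \<le> k")
        case True
        then show ?thesis unfolding C_def by (intro Min_le) auto
      next
        case False
        have "C \<le> cmod (mult (n - k) c)" using less False k(1) by simp
        also have "\<dots> \<le> cmod (mult k c) * cmod (mult (n - k) c)" using m1 by (simp add: mult_le_cancel_right1)
        also have "\<dots> = cmod (mult n c)" using mult_add[of k "n - k" c] False k(2) by (simp add: norm_mult)
        finally show ?thesis .
      qed
    qed
    have "C * exp (- \<epsilon> * real n) \<le> cmod (mult n c)" for n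
    proof -
      have "C * exp (- \<epsilon> * real n) \<le> C * 1" using C \<epsilon> by (intro mult_left_mono) auto
      then show ?thesis using low[of n] by simp
    qed
    then show ?thesis using C by blast
  next
    case False
    interpret isolated_orbit G Dom c \<sigma>
    proof
      show "compact (closure (range (\<lambda>i. (G ^^ i) c)))" using K by (simp add: Y_def)
      show "closure (range (\<lambda>i. (G ^^ i) c)) \<subseteq> Dom" using K_Dom by (simp add: Y_def)
      show "G z = c" if z: "z \<in> closure (range (\<lambda>i. (G ^^ i) c))" "deriv G z = 0" for z
      proof (rule ccontr)
        assume "G z \<noteq> c"
        have zK: "z \<in> closure Y" using z(1) by (simp add: Y_def)
        then have "critical_value g (Some (G z))"
          using z(2) K_Dom deriv_G_eq_0[of z] by (intro crit_val) auto
        then show False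
          using sep[of "Some (G z)" 0 "G z" "G z"] \<open>G z \<noteq> c\<close> G_K[OF zK] \<sigma> by simp
      qed
      show "finite (Dom \<inter> G -` {c})" by (rule fiber_finite)
      show "0 < \<sigma>" by (rule \<sigma>)
      show "\<exists>\<psi>. \<psi> holomorphic_on ball ((G ^^ n) c) r \<and> \<psi> ((G ^^ n) c) = a \<and>
          (\<forall>y\<in>ball ((G ^^ n) c) r. \<psi> y \<in> Dom \<and> G (\<psi> y) = \<phi> y)"
        if r: "0 < r" "r \<le> \<sigma>" and \<phi>: "inv_branch m \<phi> ((G ^^ n) c) r"
          and c_omit: "c \<notin> \<phi> ` ball ((G ^^ n) c) r" and a: "a \<in> Dom" "G a = \<phi> ((G ^^ n) c)" for m \<phi> n r a
      proof -
        define x where "x = (G ^^ n) c"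
        \<comment> \<open>An inverse branch avoids \<open>F\<close>: if \<open>\<phi> y\<close> is a
          critical value other than \<open>c\<close>, or the image of infinity, which is itself a
          critical value, then \<open>y\<close> lies on the orbit of a critical value other than
          \<open>c\<close>, yet within \<open>\<sigma>\<close> of the orbit of \<open>c\<close>. The
          value \<open>c\<close> is excluded by \<open>c_omit\<close>.\<close>
        define F where "F = {w. g None = Some w} \<union> G ` {z \<in> Dom. poly W z = 0}"
        have "finite {w. g None = Some w}" by (cases "g None") auto
        moreover have "finite {z \<in> Dom. poly W z = 0}"
          by (rule finite_subset[OF _ poly_roots_finite[OF W_nonzero]]) auto
        ultimately have "closed F" unfolding F_def by (intro finite_imp_closed) simp
        define C where "C = Dom \<inter> G -` (- F)"
        have cov: "covering_space C G (- F)"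
          unfolding C_def by (rule covering_space_G[OF \<open>closed F\<close>]) (auto simp: F_def)
        have omitF: "\<phi> ` ball x r \<subseteq> - F"
        proof safe
          fix y assume y: "y \<in> ball x r" "\<phi> y \<in> F"
          have it: "(g ^^ m) (Some (\<phi> y)) = Some y"
            using \<phi> y(1) g_iter[of "\<phi> y" m] by (simp add: inv_branch_def x_def)
          have close: "dist x y < \<sigma>" using y(1) r(2) by simp
          from y(2) consider "g None = Some (\<phi> y)" | z where "z \<in> Dom" "poly W z = 0" "\<phi> y = G z"
            by (auto simp: F_def)
          then show False
          proof cases
            case 1
            then have "(g ^^ Suc m) None = Some y" using it by (simp add: funpow_swap1)
            then show False using sep[OF inf, of "Suc m" y x] orbK[of n] close by (simp add: x_def)
          next
            case 2
            then have "critical_value g (Some (\<phi> y))" using crit_val by simp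
            moreover have "\<phi> y \<noteq> c" using c_omit y(1) by (auto simp: x_def)
            ultimately show False using sep[OF _ _ it, of x] orbK[of n] close by (simp add: x_def)
          qed
        qed
        have "open C" unfolding C_def
          using \<open>closed F\<close> by (intro continuous_open_preimage holomorphic_on_imp_continuous_on hol_G open_Dom) auto
        have dC: "deriv G z \<noteq> 0" if "z \<in> C" for z
          using that deriv_G_eq_0[of z] by (auto simp: C_def F_def)
        have "\<phi> x \<in> - F" by (rule subsetD[OF omitF imageI]) (use r(1) in simp)
        then have "a \<in> C" using a by (simp add: C_def x_def)
        obtain \<psi> where "\<psi> holomorphic_on ball x r" "\<psi> ` ball x r \<subseteq> C" "\<psi> x = a"
          "\<And>y. y \<in> ball x r \<Longrightarrow> G (\<psi> y) = \<phi> y"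
        proof (rule holomorphic_lift_ball[OF cov \<open>open C\<close> _ dC _ omitF r(1) \<open>a \<in> C\<close>])
          show "G holomorphic_on C" using hol_G by (rule holomorphic_on_subset) (auto simp: C_def)
          show "\<phi> holomorphic_on ball x r" using \<phi> by (simp add: inv_branch_def x_def)
          show "G a = \<phi> x" using a by (simp add: x_def)
        qed (assumption, rule that)
        then show ?thesis unfolding x_def C_def by blast
      qed
      show False if "0 < k" "0 < \<rho>" "ball ((G ^^ a) c) (8 * \<rho>) \<subseteq> dom_iter k"
        "(G ^^ k) ` ball ((G ^^ a) c) (8 * \<rho>) \<subseteq> ball ((G ^^ a) c) \<rho>" for a k \<rho>
        using in_attracting_basin_of_contraction[OF c_dom that] nb by simp
      show "(G ^^ n) c \<noteq> c" if "0 < n" for n using False that by blast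
    qed
    show ?thesis using subexponential_lower_bound[OF \<epsilon>] by blast
  qed
  then obtain C where C: "C > 0" "\<And>n. C * exp (- \<epsilon> * real n) \<le> cmod (mult n c)" by blast
  show thesis
  proof (rule that[of "C / (1 + R\<^sup>2)"])
    show "C / (1 + R\<^sup>2) > 0" using C(1) by (simp add: add_pos_nonneg)
    fix n
    \<comment> \<open>The spherical norm is the Euclidean one times a quotient that is at least
      \<open>1 / (1 + R\<^sup>2)\<close>, as the orbit stays in the disc of radius
      \<open>R\<close>.\<close>
    have "C / (1 + R\<^sup>2) * exp (- \<epsilon> * real n) = C * exp (- \<epsilon> * real n) * 1 / (1 + R\<^sup>2)" by simp
    also have "\<dots> \<le> cmod (mult n c) * (1 + (cmod c)\<^sup>2) / (1 + (cmod ((G ^^ n) c))\<^sup>2)"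
      using C R(2)[of n] by (intro frac_le mult_mono) (auto simp: add_pos_nonneg power_mono)
    finally show "C / (1 + R\<^sup>2) * exp (- \<epsilon> * real n) \<le> sph_deriv_norm (g ^^ n) (Some c)"
      by (simp only: sph_deriv_norm_iter[OF c_dom])
  qed
qed

text \<open>A degree count replaces the Riemann-Hurwitz formula. If \<open>q\<close> is not constant
  and all zeros of \<open>W\<close> were poles, \<open>W\<close> would have the degree of
  \<open>gcd q (pderiv q)\<close>, at most \<open>degree q - 1\<close>; but its coefficient at
  \<open>d - 1 + degree q\<close> has the nonzero factor
  \<open>of_nat d - of_nat (degree q)\<close>.\<close>

lemma exists_finite_critical_value:
  assumes "d \<ge> 2" "g None = None"
  obtains v where "critical_value g v" "v \<noteq> None"
proof -
  have qd: "coeff q d = 0" using assms(2) by (simp add: g_None hpt_def split: if_splits)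
  then have pd: "coeff p d \<noteq> 0" using top_coeff by simp
  have degp: "degree p = d" by (rule degree_eq_of_coeff[OF deg(1) pd])
  have degq: "degree q < d"
    using deg(2) qd q_nonzero leading_coeff_neq_0[OF q_nonzero] le_neq_implies_less by metis
  have "\<exists>z. poly W z = 0 \<and> poly q z \<noteq> 0"
  proof (rule ccontr)
    assume "\<not> ?thesis"
    then have WQ: "poly q z = 0" if "poly W z = 0" for z using that by blast
    show False
    proof (cases "degree q = 0")
      case True
      then obtain k where k: "q = [:k:]" by (meson degree_eq_zeroE)
      then have "k \<noteq> 0" using q_nonzero by auto
      have "W = smult k (pderiv p)" unfolding W_def unfolding k by (simp add: pderiv_pCons mult.commute)
      then have "degree W = d - 1" using \<open>k \<noteq> 0\<close> by (simp add: degree_pderiv degp)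
      then obtain z where "poly W z = 0" using assms(1) alg_closed_imp_poly_has_root[of W] by auto
      then show False using WQ[of z] \<open>k \<noteq> 0\<close> by (simp add: k)
    next
      case False
      then have q'0: "pderiv q \<noteq> 0" by (simp add: pderiv_eq_0_iff)
      \<comment> \<open>With \<open>h\<close> split off, the other factor of \<open>W\<close> cannot
        vanish at a pole: there \<open>s\<close> is 0, while \<open>p\<close> and \<open>e\<close>
        are not.\<close>
      define h where "h = gcd q (pderiv q)"
      define s where "s = q div h"
      define e where "e = pderiv q div h"
      have qs: "q = s * h" and qe: "pderiv q = e * h" by (simp_all add: s_def e_def h_def)
      obtain u w where "h = u * q + w * pderiv q"
        using bezout_coefficients_fst_snd[of q "pderiv q"] unfolding h_def by metis
      from poly_squarefree_decomp[OF q'0 qs qe this]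
      have sroot: "poly s z = 0 \<longleftrightarrow> poly q z = 0" for z by simp
      have "coprime s e" unfolding s_def e_def h_def
        by (rule div_gcd_coprime) (use q_nonzero in simp)
      have WW: "W = h * (pderiv p * s - p * e)"
        unfolding W_def qs[symmetric] using qs qe by (metis (no_types, lifting) mult.assoc mult.commute right_diff_distrib)
      have "degree (pderiv p * s - p * e) = 0"
      proof (rule ccontr)
        assume "degree (pderiv p * s - p * e) \<noteq> 0"
        then obtain z where z: "poly (pderiv p * s - p * e) z = 0" using alg_closed_imp_poly_has_root by blast
        then have "poly q z = 0" using WQ[of z] by (simp add: WW)
        then have "poly s z = 0" "poly p z \<noteq> 0" using sroot no_common_root by auto
        then have "poly e z = 0" using z by simp
        then show False using \<open>coprime s e\<close> \<open>poly s z = 0\<close> coprime_poly_0 by blast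
      qed
      then have "degree W = degree h" using W_nonzero unfolding WW by (subst degree_mult_eq) auto
      also have "\<dots> \<le> degree (pderiv q)" using q'0 unfolding h_def by (intro dvd_imp_degree_le) auto
      also have "\<dots> = degree q - 1" by (rule degree_pderiv)
      finally have "degree W \<le> degree q - 1" .
      moreover have "d - 1 + degree q \<le> degree W"
      proof (rule le_degree)
        have "coeff (pderiv p * q) (degree (pderiv p) + degree q) = lead_coeff (pderiv p) * lead_coeff q"
          by (rule coeff_mult_degree_sum)
        moreover have "lead_coeff (pderiv p) = of_nat d * coeff p d"
          using d by (simp add: degree_pderiv degp coeff_pderiv)
        ultimately have 1: "coeff (pderiv p * q) (d - 1 + degree q) = of_nat d * coeff p d * lead_coeff q"
          by (simp add: degree_pderiv degp)
        have "coeff (p * pderiv q) (degree p + degree (pderiv q)) = lead_coeff p * lead_coeff (pderiv q)"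
          by (rule coeff_mult_degree_sum)
        moreover have "lead_coeff (pderiv q) = of_nat (degree q) * lead_coeff q"
          using False by (simp add: degree_pderiv coeff_pderiv)
        moreover have "degree p + degree (pderiv q) = d - 1 + degree q"
          using False d by (simp add: degree_pderiv degp)
        ultimately have 2: "coeff (p * pderiv q) (d - 1 + degree q) = of_nat (degree q) * coeff p d * lead_coeff q"
          by (simp add: degp mult_ac)
        have "coeff W (d - 1 + degree q) = (of_nat d - of_nat (degree q)) * (coeff p d * lead_coeff q)"
          unfolding W_def coeff_diff 1 2 by (simp add: algebra_simps)
        then show "coeff W (d - 1 + degree q) \<noteq> 0" using degq pd q_nonzero by simp
      qed
      ultimately show False using assms(1) False by linarith
    qed
  qed
  then obtain z where z: "poly W z = 0" "z \<in> Dom" by (auto simp: Dom_def)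
  then show thesis
    using critical_point_finite[OF z(2)]
    by (intro that[of "Some (G z)"]) (auto simp: critical_value_def g_Some intro!: exI[of _ "Some z"])
qed

end

section \<open>Rotations of the sphere\<close>

definition mobius :: "(sphere \<Rightarrow> sphere) \<Rightarrow> bool" where
  "mobius T \<longleftrightarrow> (\<exists>\<alpha> \<beta> \<gamma> \<delta>. \<alpha> * \<delta> - \<beta> * \<gamma> \<noteq> 0 \<and>
     (\<forall>x y. x \<noteq> 0 \<or> y \<noteq> 0 \<longrightarrow> T (hpt x y) = hpt (\<alpha> * x + \<beta> * y) (\<gamma> * x + \<delta> * y)))"

definition sph_isometry :: "(sphere \<Rightarrow> sphere) \<Rightarrow> (sphere \<Rightarrow> sphere) \<Rightarrow> bool" where
  "sph_isometry T T' \<longleftrightarrow> (\<forall>x. T' (T x) = x) \<and> (\<forall>x. T (T' x) = x) \<and>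
     (\<forall>x y. chordal (T x) (T y) = chordal x y)"

section \<open>Homogeneous forms under linear substitution\<close>

lemma det_nonzero_injective:
  fixes \<alpha> \<beta> \<gamma> \<delta> x y :: complex
  assumes "\<alpha> * \<delta> - \<beta> * \<gamma> \<noteq> 0" "x \<noteq> 0 \<or> y \<noteq> 0"
  shows "\<alpha> * x + \<beta> * y \<noteq> 0 \<or> \<gamma> * x + \<delta> * y \<noteq> 0"
proof (rule ccontr)
  assume "\<not> ?thesis"
  then have 0: "\<alpha> * x + \<beta> * y = 0" "\<gamma> * x + \<delta> * y = 0" by auto
  have "(\<alpha> * \<delta> - \<beta> * \<gamma>) * x = \<delta> * (\<alpha> * x + \<beta> * y) - \<beta> * (\<gamma> * x + \<delta> * y)"
    "(\<alpha> * \<delta> - \<beta> * \<gamma>) * y = \<alpha> * (\<gamma> * x + \<delta> * y) - \<gamma> * (\<alpha> * x + \<beta> * y)" by (simp_all add: algebra_simps)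
  then show False using assms 0 by auto
qed

lemma coeff_mult_bounded:
  fixes P Q :: "complex poly"
  assumes "degree P \<le> m" "degree Q \<le> n"
  shows "coeff (P * Q) (m + n) = coeff P m * coeff Q n"
proof (cases "degree P = m \<and> degree Q = n")
  case True
  then show ?thesis using coeff_mult_degree_sum[of P Q] by auto
next
  case False
  then have "degree P < m \<or> degree Q < n" using assms by auto
  moreover from this have "degree (P * Q) < m + n"
    using assms degree_mult_le[of P Q] by linarith
  ultimately show ?thesis by (auto simp: coeff_eq_0)
qed

lemma hom_mult:
  assumes "degree P \<le> m" "degree Q \<le> n"
  shows "hom (m + n) (P * Q) x y = hom m P x y * hom n Q x y"
proof (cases "y = 0")
  case True
  then show ?thesis by (simp add: hom_0 coeff_mult_bounded[OF assms] power_add)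
next
  case False
  have "degree (P * Q) \<le> m + n" using degree_mult_le[of P Q] assms by linarith
  then show ?thesis using False assms by (simp add: hom_eq_poly power_add)
qed

lemma hom_linear_power: "hom i ([:b, a:] ^ i) x y = (a * x + b * y) ^ i"
proof (induction i)
  case (Suc i)
  have "degree ([:b, a:] ^ i) \<le> i" using degree_power_le[of "[:b, a:]" i] by (simp split: if_splits)
  then have "hom (1 + i) ([:b, a:] * [:b, a:] ^ i) x y = hom 1 [:b, a:] x y * hom i ([:b, a:] ^ i) x y"
    by (intro hom_mult) auto
  moreover have "hom 1 [:b, a:] x y = a * x + b * y" by (simp add: hom_def atMost_Suc add.commute)
  ultimately show ?case using Suc by simp
qed (simp add: hom_def)

lemma hom_sum: "hom d (\<Sum>i\<in>I. f i) x y = (\<Sum>i\<in>I. hom d (f i) x y)"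
  by (induction I rule: infinite_finite_induct) (auto simp: hom_add, simp_all add: hom_def)

text \<open>The pullback of the form \<open>hom d p\<close> along two linear forms, with
  \<open>A\<close> and \<open>B\<close> their dehomogenizations.\<close>

definition hom_subst :: "nat \<Rightarrow> complex poly \<Rightarrow> complex poly \<Rightarrow> complex poly \<Rightarrow> complex poly" where
  "hom_subst d p A B = (\<Sum>i\<le>d. smult (coeff p i) (A ^ i * B ^ (d - i)))"

lemma degree_linear_power_mult_le: "i \<le> d \<Longrightarrow> degree ([:b, a:] ^ i * [:b', a':] ^ (d - i)) \<le> d"
proof -
  assume "i \<le> d"
  have "degree ([:b, a:] ^ i) \<le> i" "degree ([:b', a':] ^ (d - i)) \<le> d - i"
    using degree_power_le[of "[:b, a:]" i] degree_power_le[of "[:b', a':]" "d - i"] by (auto split: if_splits)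
  then show ?thesis using degree_mult_le[of "[:b, a:] ^ i" "[:b', a':] ^ (d - i)"] \<open>i \<le> d\<close> by linarith
qed

lemma degree_hom_subst: "degree (hom_subst d p [:b, a:] [:b', a':]) \<le> d"
  unfolding hom_subst_def
  by (intro degree_sum_le order_trans[OF degree_smult_le] degree_linear_power_mult_le) auto

lemma hom_hom_subst:
  "hom d (hom_subst d p [:b, a:] [:b', a':]) x y = hom d p (a * x + b * y) (a' * x + b' * y)"
proof -
  have "hom d ([:b, a:] ^ i * [:b', a':] ^ (d - i)) x y = (a * x + b * y) ^ i * (a' * x + b' * y) ^ (d - i)"
    if "i \<le> d" for i
  proof -
    have "hom (i + (d - i)) ([:b, a:] ^ i * [:b', a':] ^ (d - i)) x y =
        hom i ([:b, a:] ^ i) x y * hom (d - i) ([:b', a':] ^ (d - i)) x y"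
      using degree_power_le[of "[:b, a:]" i] degree_power_le[of "[:b', a':]" "d - i"]
      by (intro hom_mult) (auto split: if_splits)
    then show ?thesis using that by (simp add: hom_linear_power)
  qed
  then show ?thesis
    unfolding hom_subst_def hom_sum hom_smult by (simp add: hom_def[of d p] mult.assoc)
qed

lemma rational_rep_compose:
  assumes rep: "rational_rep d p q g" and "mobius T" "mobius S"
  obtains p' q' where "rational_rep d p' q' (T \<circ> g \<circ> S)"
proof -
  obtain a b c e where detT: "a * e - b * c \<noteq> 0"
    and T: "\<And>x y. x \<noteq> 0 \<or> y \<noteq> 0 \<Longrightarrow> T (hpt x y) = hpt (a * x + b * y) (c * x + e * y)"
    using \<open>mobius T\<close> unfolding mobius_def by blast
  obtain a' b' c' e' where detS: "a' * e' - b' * c' \<noteq> 0"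
    and S: "\<And>x y. x \<noteq> 0 \<or> y \<noteq> 0 \<Longrightarrow> S (hpt x y) = hpt (a' * x + b' * y) (c' * x + e' * y)"
    using \<open>mobius S\<close> unfolding mobius_def by blast
  define p1 where "p1 = hom_subst d p [:b', a':] [:e', c':]"
  define q1 where "q1 = hom_subst d q [:b', a':] [:e', c':]"
  have "rational_rep d (smult a p1 + smult b q1) (smult c p1 + smult e q1) (T \<circ> g \<circ> S)"
    unfolding rational_rep_def
  proof (intro conjI allI impI)
    have "degree p1 \<le> d" "degree q1 \<le> d" unfolding p1_def q1_def by (rule degree_hom_subst)+
    then show "degree (smult a p1 + smult b q1) \<le> d" "degree (smult c p1 + smult e q1) \<le> d"
      by (auto intro!: degree_add_le order_trans[OF degree_smult_le])
    fix x y :: complex assume xy: "x \<noteq> 0 \<or> y \<noteq> 0"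
    define u where "u = a' * x + b' * y"
    define v where "v = c' * x + e' * y"
    have uv: "u \<noteq> 0 \<or> v \<noteq> 0" unfolding u_def v_def by (rule det_nonzero_injective[OF detS xy])
    then have guv: "hom d p u v \<noteq> 0 \<or> hom d q u v \<noteq> 0" "g (hpt u v) = hpt (hom d p u v) (hom d q u v)"
      using rep unfolding rational_rep_def by blast+
    have h: "hom d (smult a p1 + smult b q1) x y = a * hom d p u v + b * hom d q u v"
      "hom d (smult c p1 + smult e q1) x y = c * hom d p u v + e * hom d q u v"
      by (simp_all add: hom_add hom_smult p1_def q1_def hom_hom_subst u_def v_def)
    show "hom d (smult a p1 + smult b q1) x y \<noteq> 0 \<or> hom d (smult c p1 + smult e q1) x y \<noteq> 0"
      unfolding h by (rule det_nonzero_injective[OF detT guv(1)])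
    show "(T \<circ> g \<circ> S) (hpt x y) = hpt (hom d (smult a p1 + smult b q1) x y) (hom d (smult c p1 + smult e q1) x y)"
      unfolding h using S[OF xy] guv T[OF guv(1)] by (simp add: u_def v_def)
  qed
  then show thesis by (rule that)
qed

section \<open>Rotations as isometries of the chordal metric\<close>

lemma hpt_cases:
  obtains x y where "u = hpt x y" "x \<noteq> 0 \<or> y \<noteq> 0"
  by (cases u) (auto simp: hpt_def intro: that[of 1 0] that[of _ 1])

lemma hpt_scale: "k \<noteq> 0 \<Longrightarrow> hpt (k * x) (k * y) = hpt x y"
  by (simp add: hpt_def)

text \<open>A determinant divided by two norms: in this form, invariance under multiples of unitary
  matrices is immediate.\<close>

lemma chordal_hpt:
  assumes "x \<noteq> 0 \<or> y \<noteq> 0" "x' \<noteq> 0 \<or> y' \<noteq> 0"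
  shows "chordal (hpt x y) (hpt x' y') = 2 * cmod (x * y' - x' * y) /
    (sqrt ((cmod x)\<^sup>2 + (cmod y)\<^sup>2) * sqrt ((cmod x')\<^sup>2 + (cmod y')\<^sup>2))"
proof -
  have norm: "sqrt ((cmod u)\<^sup>2 + (cmod v)\<^sup>2) = cmod v * sqrt (1 + (cmod (u / v))\<^sup>2)" if "v \<noteq> 0" for u v :: complex
  proof -
    have "(cmod u)\<^sup>2 + (cmod v)\<^sup>2 = (cmod v)\<^sup>2 * (1 + (cmod (u / v))\<^sup>2)"
      using that by (simp add: norm_divide power_divide distrib_left)
    then show ?thesis by (simp only: real_sqrt_mult real_sqrt_abs abs_norm_cancel)
  qed
  consider "y = 0" "y' = 0" | "y = 0" "y' \<noteq> 0" | "y \<noteq> 0" "y' = 0" | "y \<noteq> 0" "y' \<noteq> 0" by blast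
  then show ?thesis
  proof cases
    case 4
    have "x * y' - x' * y = y * y' * (x / y - x' / y')" using 4 by (simp add: field_simps)
    then show ?thesis using 4 by (simp add: hpt_def norm norm_mult real_sqrt_mult)
  qed (use assms in \<open>auto simp: hpt_def norm norm_mult\<close>)
qed

text \<open>The rotation of the sphere with matrix \<open>((cnj a, 1), (1, - a))\<close>, a multiple of a unitary matrix; it
  maps \<open>Some a\<close> to infinity.\<close>

definition rot :: "complex \<Rightarrow> sphere \<Rightarrow> sphere" where
  "rot a u = (case u of Some z \<Rightarrow> hpt (cnj a * z + 1) (z - a) | None \<Rightarrow> Some (cnj a))"

lemma rot_hpt:
  assumes "x \<noteq> 0 \<or> y \<noteq> 0"
  shows "rot a (hpt x y) = hpt (cnj a * x + 1 * y) (1 * x + (- a) * y)"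
proof (cases "y = 0")
  case True
  then show ?thesis using assms by (simp add: rot_def hpt_def)
next
  case False
  have "hpt (cnj a * (x / y) + 1) (x / y - a) = hpt (y * (cnj a * (x / y) + 1)) (y * (x / y - a))"
    by (rule hpt_scale[OF False, symmetric])
  also have "\<dots> = hpt (cnj a * x + 1 * y) (1 * x + (- a) * y)" using False by (simp add: field_simps)
  finally show ?thesis using False by (simp add: rot_def hpt_def[of x y])
qed

lemma rot_det: "cnj a * (- a) - 1 * 1 \<noteq> 0"
proof
  assume "cnj a * (- a) - 1 * 1 = 0"
  moreover have "complex_of_real (1 + (cmod a)\<^sup>2) = - (cnj a * (- a) - 1 * 1)"
    unfolding of_real_add complex_norm_square by (simp add: algebra_simps)
  ultimately have "complex_of_real (1 + (cmod a)\<^sup>2) = 0" by simp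
  then have "1 + (cmod a)\<^sup>2 = 0" by (simp only: of_real_eq_0_iff)
  then show False by (simp add: add_nonneg_eq_0_iff)
qed

lemma mobius_rot: "mobius (rot a)"
  unfolding mobius_def using rot_det[of a] rot_hpt[of _ _ a] by blast

text \<open>The product of the two matrices is \<open>1 + cnj a * a\<close> times the
  identity.\<close>

lemma rot_rot: "rot (cnj a) (rot a u) = u"
proof -
  obtain x y where u: "u = hpt x y" "x \<noteq> 0 \<or> y \<noteq> 0" by (rule hpt_cases)
  have "1 + cnj a * a \<noteq> 0" using rot_det[of a] by (auto simp: algebra_simps add_eq_0_iff)
  then have "hpt ((1 + cnj a * a) * x) ((1 + cnj a * a) * y) = hpt x y" by (rule hpt_scale)
  then show ?thesis
    unfolding u(1) rot_hpt[OF u(2)] rot_hpt[OF det_nonzero_injective[OF rot_det u(2)]]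
    by (simp add: algebra_simps)
qed

lemma sph_isometry_rot: "sph_isometry (rot a) (rot (cnj a))"
  unfolding sph_isometry_def
proof (intro conjI allI)
  show "rot (cnj a) (rot a u) = u" for u by (rule rot_rot)
  show "rot a (rot (cnj a) u) = u" for u using rot_rot[of "cnj a" u] by simp
  fix u v
  obtain x y where u: "u = hpt x y" "x \<noteq> 0 \<or> y \<noteq> 0" by (rule hpt_cases)
  obtain x' y' where v: "v = hpt x' y'" "x' \<noteq> 0 \<or> y' \<noteq> 0" by (rule hpt_cases)
  define k where "k = 1 + (cmod a)\<^sup>2"
  have k: "k > 0" by (simp add: k_def add_pos_nonneg)
  have norm: "(cmod (cnj a * s + 1 * t))\<^sup>2 + (cmod (1 * s + (- a) * t))\<^sup>2 = k * ((cmod s)\<^sup>2 + (cmod t)\<^sup>2)" for s t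
  proof -
    have "complex_of_real ((cmod (cnj a * s + 1 * t))\<^sup>2 + (cmod (1 * s + (- a) * t))\<^sup>2) =
      complex_of_real (k * ((cmod s)\<^sup>2 + (cmod t)\<^sup>2))"
      unfolding k_def of_real_add of_real_mult complex_norm_square by (simp add: algebra_simps)
    then show ?thesis by (simp only: of_real_eq_iff)
  qed
  have "(cnj a * x + 1 * y) * (1 * x' + (- a) * y') - (cnj a * x' + 1 * y') * (1 * x + (- a) * y) =
      - of_real k * (x * y' - x' * y)"
    unfolding k_def of_real_add complex_norm_square by (simp add: algebra_simps)
  then have det: "cmod ((cnj a * x + 1 * y) * (1 * x' + (- a) * y') - (cnj a * x' + 1 * y') * (1 * x + (- a) * y)) =
      k * cmod (x * y' - x' * y)"
    using k by (simp only: norm_mult norm_minus_cancel norm_of_real abs_of_pos)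
  have scale: "2 * (k * D) / (sqrt k * A * (sqrt k * B)) = 2 * D / (A * B)" for D A B
  proof -
    have "sqrt k * A * (sqrt k * B) = (sqrt k * sqrt k) * (A * B)" by (simp only: mult_ac)
    also have "\<dots> = k * (A * B)" using k by simp
    finally have eq: "sqrt k * A * (sqrt k * B) = k * (A * B)" .
    show ?thesis unfolding eq using k by simp
  qed
  show "chordal (rot a u) (rot a v) = chordal u v"
    unfolding u(1) v(1) rot_hpt[OF u(2)] rot_hpt[OF v(2)]
      chordal_hpt[OF det_nonzero_injective[OF rot_det u(2)] det_nonzero_injective[OF rot_det v(2)]]
      chordal_hpt[OF u(2) v(2)] norm det real_sqrt_mult
    by (rule scale)
qed

lemma exists_rotation_to_infinity:
  obtains S S' where "sph_isometry S S'" "sph_isometry S' S" "mobius S" "mobius S'" "S None = z"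
proof (cases z)
  case None
  have "mobius id" unfolding mobius_def by (rule exI[of _ 1], rule exI[of _ 0], rule exI[of _ 0], rule exI[of _ 1]) simp
  then show thesis using None by (intro that[of id id]) (auto simp: sph_isometry_def)
next
  case (Some a)
  show thesis
    by (rule that[of "rot (cnj a)" "rot a"])
       (use sph_isometry_rot[of a] sph_isometry_rot[of "cnj a"] mobius_rot Some in \<open>auto simp: rot_def\<close>)
qed

section \<open>Invariance under isometries\<close>

lemma has_sph_deriv_norm_isometry:
  assumes T: "sph_isometry T T'" and S: "sph_isometry S S'"
  shows "has_sph_deriv_norm (T \<circ> f \<circ> S) x L \<longleftrightarrow> has_sph_deriv_norm f (S x) L"
proof -
  have surj: "(\<forall>w. P (S w)) \<longleftrightarrow> (\<forall>w. P w)" for P using S unfolding sph_isometry_def by metis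
  have inj: "S w = S x \<longleftrightarrow> w = x" for w using S unfolding sph_isometry_def by metis
  have cT: "chordal (T u) (T v) = chordal u v" and cS: "chordal (S u) (S v) = chordal u v" for u v
    using T S unfolding sph_isometry_def by auto
  show ?thesis
    unfolding has_sph_deriv_norm_def
    using surj[of "\<lambda>w. w \<noteq> S x \<and> chordal w (S x) < d \<longrightarrow> \<bar>chordal (f w) (f (S x)) / chordal w (S x) - L\<bar> < e" for d e, symmetric]
    by (simp add: inj cT cS)
qed

lemma sph_deriv_norm_isometry:
  assumes "sph_isometry T T'" "sph_isometry S S'"
  shows "sph_deriv_norm (T \<circ> f \<circ> S) x = sph_deriv_norm f (S x)"
  unfolding sph_deriv_norm_def has_sph_deriv_norm_isometry[OF assms] ..

lemma critical_value_isometry: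
  assumes T: "sph_isometry T T'" and S: "sph_isometry S S'"
  shows "critical_value (T \<circ> f \<circ> S) v \<longleftrightarrow> critical_value f (T' v)"
proof -
  have "T (f (S z)) = v \<longleftrightarrow> f (S z) = T' v" for z using T unfolding sph_isometry_def by metis
  moreover have "(\<exists>z. P (S z)) \<longleftrightarrow> (\<exists>z. P z)" for P using S unfolding sph_isometry_def by metis
  ultimately show ?thesis
    unfolding critical_value_def critical_point_def sph_deriv_norm_isometry[OF assms] by simp
qed

lemma funpow_conjugate:
  assumes "sph_isometry T T'"
  shows "(T \<circ> g \<circ> T') ^^ n = T \<circ> (g ^^ n) \<circ> T'"
proof (induction n)
  case (Suc n)
  then show ?case using assms by (simp add: sph_isometry_def fun_eq_iff)
qed (use assms in \<open>simp add: sph_isometry_def fun_eq_iff\<close>)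

lemma postorbit_conjugate:
  assumes T: "sph_isometry T T'"
  shows "x \<in> postorbit (T \<circ> g \<circ> T') v \<longleftrightarrow> T' x \<in> postorbit g (T' v)"
proof -
  have "chordal x (T y) = chordal (T' x) y" for y using T unfolding sph_isometry_def by metis
  moreover have "{((T \<circ> g \<circ> T') ^^ n) v |n. True} = T ` {(g ^^ n) (T' v) |n. True}"
    unfolding funpow_conjugate[OF T] by auto
  ultimately show ?thesis
    unfolding postorbit_def sph_closure_def by (simp only: mem_Collect_eq bex_simps)
qed

lemma in_attracting_basin_conjugate:
  assumes T: "sph_isometry T T'" and T': "sph_isometry T' T"
    and basin: "in_attracting_basin (T \<circ> g \<circ> T') w"
  shows "in_attracting_basin g (T' w)"
proof -
  obtain z k where zk: "attracting_periodic (T \<circ> g \<circ> T') z k"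
      "(\<lambda>n. chordal (((T \<circ> g \<circ> T') ^^ (n * k)) w) z) \<longlonglongrightarrow> 0"
    using basin unfolding in_attracting_basin_def by blast
  have "chordal (T y) z = chordal y (T' z)" for y using T unfolding sph_isometry_def by metis
  moreover have "T y = z \<longleftrightarrow> y = T' z" for y using T unfolding sph_isometry_def by metis
  ultimately have "attracting_periodic g (T' z) k" "(\<lambda>n. chordal ((g ^^ (n * k)) (T' w)) (T' z)) \<longlonglongrightarrow> 0"
    using zk unfolding attracting_periodic_def funpow_conjugate[OF T] sph_deriv_norm_isometry[OF T T']
    by auto
  then show ?thesis unfolding in_attracting_basin_def by blast
qed

section \<open>Reduction to the normalized map\<close>

lemma rational_rep_rat_map:
  assumes "q \<noteq> 0" "coprime p q" "rat_degree p q \<ge> 2"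
  shows "rational_rep (rat_degree p q) p q (rat_map p q)"
  unfolding rational_rep_def
proof (intro conjI allI impI)
  define d where "d = rat_degree p q"
  show deg: "degree p \<le> rat_degree p q" "degree q \<le> rat_degree p q" by (auto simp: rat_degree_def)
  fix x y :: complex assume xy: "x \<noteq> 0 \<or> y \<noteq> 0"
  have top: "coeff p d \<noteq> 0 \<or> coeff q d \<noteq> 0"
  proof -
    consider "d = degree q" | "d = degree p" "degree p > 0" 
      by (cases "degree p \<le> degree q") (use assms(3) in \<open>auto simp: d_def rat_degree_def max_def\<close>)
    then show ?thesis using assms(1) by cases auto
  qed
  have "(hom d p x y \<noteq> 0 \<or> hom d q x y \<noteq> 0) \<and> rat_map p q (hpt x y) = hpt (hom d p x y) (hom d q x y)"
  proof (cases "y = 0")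
    case True
    have "rat_map p q None = hpt (coeff p d) (coeff q d)"
      using assms(1) by (auto simp: rat_map_def hpt_def d_def rat_degree_def coeff_eq_0 max_def)
    also have "\<dots> = hpt (x ^ d * coeff p d) (x ^ d * coeff q d)" using xy True by (simp add: hpt_scale)
    finally show ?thesis using True top xy by (simp add: hom_0 hpt_def mult.commute)
  next
    case False
    have dp: "degree p \<le> d" "degree q \<le> d" using deg by (simp_all add: d_def)
    have "poly p (x / y) \<noteq> 0 \<or> poly q (x / y) \<noteq> 0" using assms(2) coprime_poly_0 by blast
    then show ?thesis using False
      by (simp add: hom_eq_poly[OF dp(1)] hom_eq_poly[OF dp(2)] hpt_scale) (simp add: hpt_def rat_map_def)
  qed
  then show "hom (rat_degree p q) p x y \<noteq> 0 \<or> hom (rat_degree p q) q x y \<noteq> 0"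
    "rat_map p q (hpt x y) = hpt (hom (rat_degree p q) p x y) (hom (rat_degree p q) q x y)"
    unfolding d_def by blast+
qed

text \<open>Source and target are rotated independently, which changes critical values only by the
  rotation of the target. So \<open>c0\<close> and one of its preimages can both be moved to
  infinity, where the degree count for maps fixing infinity applies.\<close>

lemma exists_other_critical_value:
  assumes rep: "rational_rep d p q g" and d2: "d \<ge> 2" and c0: "critical_value g c0"
  obtains v where "critical_value g v" "v \<noteq> c0"
proof -
  obtain z where z: "g z = c0" using c0 unfolding critical_value_def by blast
  obtain S S' where S: "sph_isometry S S'" "mobius S" "S None = z"
    by (rule exists_rotation_to_infinity) blast
  obtain T' T where T: "sph_isometry T T'" "mobius T" "T' None = c0"
    by (rule exists_rotation_to_infinity) blast
  obtain p1 q1 where rep1: "rational_rep d p1 q1 (T \<circ> g \<circ> S)"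
    by (rule rational_rep_compose[OF rep T(2) S(2)])
  interpret rational_sphere_map d p1 q1 "T \<circ> g \<circ> S"
    by unfold_locales (use rep1 d2 in auto)
  have "T c0 = None" using T unfolding sph_isometry_def by metis
  then have "(T \<circ> g \<circ> S) None = None" using S(3) z by simp
  then obtain v where v: "critical_value (T \<circ> g \<circ> S) v" "v \<noteq> None"
    using exists_finite_critical_value[OF d2] by blast
  have "T' v \<noteq> c0" using v(2) T unfolding sph_isometry_def by metis
  then show thesis using that v(1) critical_value_isometry[OF T(1) S(1)] by blast
qed

lemma Liminf_ln_over_n_nonneg:
  fixes a :: "nat \<Rightarrow> real"
  assumes "\<And>\<epsilon>. \<epsilon> > 0 \<Longrightarrow> \<exists>C>0. \<forall>n. C * exp (- \<epsilon> * real n) \<le> a n"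
  shows "Liminf sequentially (\<lambda>n. ereal (ln (a n) / real n)) \<ge> 0"
proof (rule ccontr)
  assume "\<not> ?thesis"
  then obtain e where "Liminf sequentially (\<lambda>n. ereal (ln (a n) / real n)) < ereal e" "ereal e < 0"
    using ereal_dense2 by (meson not_le)
  then have e: "e < 0" by simp
  \<comment> \<open>The other half of \<open>- e\<close> absorbs \<open>ln C / real n\<close>, which
    tends to 0.\<close>
  define \<epsilon> where "\<epsilon> = - e / 2"
  have \<epsilon>: "\<epsilon> > 0" using e by (simp add: \<epsilon>_def)
  obtain C where C: "C > 0" "\<And>n. C * exp (- \<epsilon> * real n) \<le> a n" using assms[OF \<epsilon>] by blast
  have "(\<lambda>n. ln C / real n) \<longlonglongrightarrow> 0" by (rule lim_const_over_n)
  then have "\<forall>\<^sub>F n in sequentially. - \<epsilon> < ln C / real n" using \<epsilon> by (auto intro: order_tendstoD)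
  moreover have "\<forall>\<^sub>F n in sequentially. n > 0" by (rule eventually_gt_at_top)
  ultimately have "\<forall>\<^sub>F n in sequentially. ereal e \<le> ereal (ln (a n) / real n)"
  proof eventually_elim
    case (elim n)
    have "ln (C * exp (- \<epsilon> * real n)) \<le> ln (a n)"
      using C(1) C(2)[of n] by (intro ln_mono) (auto intro: less_le_trans[OF _ C(2)])
    then have "ln C - \<epsilon> * real n \<le> ln (a n)" using C(1) by (simp add: ln_mult)
    then have "(ln C - \<epsilon> * real n) / real n \<le> ln (a n) / real n" by (rule divide_right_mono) simp
    then have "ln C / real n - \<epsilon> \<le> ln (a n) / real n" using elim(2) by (simp add: diff_divide_distrib)
    then have "e \<le> ln (a n) / real n" using elim(1) unfolding \<epsilon>_def by linarith
    then show ?case by simp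
  qed
  then have "ereal e \<le> Liminf sequentially (\<lambda>n. ereal (ln (a n) / real n))" by (rule Liminf_bounded)
  then show False using \<open>Liminf sequentially (\<lambda>n. ereal (ln (a n) / real n)) < ereal e\<close> by simp
qed

theorem theorem5p1:
  fixes p q :: "complex poly" and c0 :: sphere
  assumes "q \<noteq> 0" and "coprime p q" and "rat_degree p q \<ge> 2"
    and "critical_value (rat_map p q) c0"
    and "\<not> in_attracting_basin (rat_map p q) c0"
    and "\<forall>c. critical_value (rat_map p q) c \<and> c \<noteq> c0 \<longrightarrow>
           postorbit (rat_map p q) c0 \<inter> postorbit (rat_map p q) c = {}"
  shows "Liminf sequentially
           (\<lambda>n. ereal (ln (sph_deriv_norm (rat_map p q ^^ n) c0) / real n)) \<ge> 0"
proof (rule Liminf_ln_over_n_nonneg)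
  fix \<epsilon> :: real assume \<epsilon>: "\<epsilon> > 0"
  define g where "g = rat_map p q"
  define d where "d = rat_degree p q"
  have rep: "rational_rep d p q g" unfolding g_def d_def by (rule rational_rep_rat_map[OF assms(1-3)])
  have d: "d \<ge> 2" using assms(3) by (simp add: d_def)
  obtain v where v: "critical_value g v" "v \<noteq> c0"
    using exists_other_critical_value[OF rep d] assms(4) unfolding g_def by blast
  obtain T' T where T: "sph_isometry T T'" and T': "sph_isometry T' T" and mob: "mobius T" "mobius T'" and Tv: "T' None = v"
    by (rule exists_rotation_to_infinity) blast
  have TT: "T' (T x) = x" "T (T' x) = x" for x using T unfolding sph_isometry_def by auto
  obtain p' q' where rep': "rational_rep d p' q' (T \<circ> g \<circ> T')"
    by (rule rational_rep_compose[OF rep mob])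
  interpret rational_sphere_map d p' q' "T \<circ> g \<circ> T'"
    by unfold_locales (use rep' d in auto)
  have "T c0 \<noteq> None" using v(2) Tv TT by metis
  then obtain c where c: "T c0 = Some c" by auto
  then have Tc: "T' (Some c) = c0" using TT by metis
  have "critical_value (T \<circ> g \<circ> T') None"
    unfolding critical_value_isometry[OF T T'] Tv by (rule v(1))
  moreover have "\<not> in_attracting_basin (T \<circ> g \<circ> T') (Some c)"
    using in_attracting_basin_conjugate[OF T T', of g "Some c"] assms(5) by (auto simp: Tc g_def)
  moreover have "postorbit (T \<circ> g \<circ> T') (Some c) \<inter> postorbit (T \<circ> g \<circ> T') u = {}"
    if "critical_value (T \<circ> g \<circ> T') u" "u \<noteq> Some c" for u
  proof -
    have "critical_value g (T' u)" using that(1) critical_value_isometry[OF T T'] by simp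
    moreover have "T' u \<noteq> c0" using that(2) c TT by metis
    ultimately have "postorbit g c0 \<inter> postorbit g (T' u) = {}" using assms(6) by (simp add: g_def)
    then show ?thesis by (auto simp: postorbit_conjugate[OF T] Tc)
  qed
  ultimately obtain C where "C > 0" "\<And>n. C * exp (- \<epsilon> * real n) \<le> sph_deriv_norm ((T \<circ> g \<circ> T') ^^ n) (Some c)"
    using deriv_norm_lower_bound[OF _ _ _ \<epsilon>] by blast
  then show "\<exists>C>0. \<forall>n. C * exp (- \<epsilon> * real n) \<le> sph_deriv_norm (rat_map p q ^^ n) c0"
    by (auto simp: funpow_conjugate[OF T] sph_deriv_norm_isometry[OF T T'] Tc g_def)
qed

end
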